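(* Let $\varepsilon>0$ and let $V=V_{n,p}$. (a) There exists $c_0>0$ such that if $p=p(n)\in(\varepsilon,1-\varepsilon)$, then with high probability $h(G_1(V)\cup G_3(V))\ge c_0n$. (b) There exists $c_0>0$ such that the following holds. Let $p=p(n)\in(0,1/2-\varepsilon)$ and let $d=d(n)\ge3$ be odd such that $q:=p(1-p)^{2^d-2}\ge n^{-0.1}$ and $d\le c_0\log n$. Then with high probability $$h(G_d(V))\ge\frac{c_0^d q^{22}\binom nd}{n}.$$
   Context: $V_{n,p}$ is the random subset of $\{0,1\}^n$ containing each point independently with probability $p$; "with high probability" means with probability tending to 1 as $n\to\infty$. For $x,y\in\{0,1\}^n$, $\mathrm{cube}(x,y)=\{z:\min(x_i,y_i)\le z_i\le\max(x_i,y_i)\ \forall i\}$. $G_d(V)$ is the graph on vertex set $V$ in which $x,y$ are adjacent iff their Hamming distance is $d$ and $\mathrm{cube}(x,y)\cap V=\{x,y\}$; $G_1(V)\cup G_3(V)$ is the graph on $V$ whose edge set is the union of the two edge sets. For a graph $G$, $h(G)=\min\{|\partial(U)|/|U| : U\subseteq V(G),\ 1\le|U|\le|V(G)|/2\}$, where $\partial(U)$ is the set of edges with exactly one endpoint in $U$. *)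

theory Defs
  imports "HOL-Probability.Probability"
begin

text \<open>The discrete cube \<open>{0,1}\<^sup>n\<close>: since \<open>n\<close> tends to infinity inside the statement, its points are
  extensional functions on \<open>{..<n}\<close> rather than vectors over an index type.\<close>

definition hypercube :: "nat \<Rightarrow> (nat \<Rightarrow> nat) set" where
  "hypercube n = {..<n} \<rightarrow>\<^sub>E {0, 1}"

definition hamming :: "nat \<Rightarrow> (nat \<Rightarrow> nat) \<Rightarrow> (nat \<Rightarrow> nat) \<Rightarrow> nat" where
  "hamming n x y = card {i. i < n \<and> x i \<noteq> y i}"

definition subcube :: "nat \<Rightarrow> (nat \<Rightarrow> nat) \<Rightarrow> (nat \<Rightarrow> nat) \<Rightarrow> (nat \<Rightarrow> nat) set" where
  "subcube n x y =
     {z \<in> hypercube n. \<forall>i<n. min (x i) (y i) \<le> z i \<and> z i \<le> max (x i) (y i)}"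

definition random_subset :: "nat \<Rightarrow> real \<Rightarrow> (nat \<Rightarrow> nat) set pmf" where
  "random_subset n p =
     map_pmf (\<lambda>f. {x \<in> hypercube n. f x})
       (Pi_pmf (hypercube n) False (\<lambda>_. bernoulli_pmf p))"

definition with_high_probability :: "(nat \<Rightarrow> 'a pmf) \<Rightarrow> (nat \<Rightarrow> 'a \<Rightarrow> bool) \<Rightarrow> bool" where
  "with_high_probability M P \<longleftrightarrow>
     (\<lambda>n. measure_pmf.prob (M n) {x. P n x}) \<longlonglongrightarrow> 1"

text \<open>A graph is a pair of its vertex set and its set of edges, an edge being the set of its two
  endpoints.\<close>

type_synonym 'a graph = "'a set \<times> 'a set set"

definition vertices :: "'a graph \<Rightarrow> 'a set" where
  "vertices G = fst G"

definition edges :: "'a graph \<Rightarrow> 'a set set" where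
  "edges G = snd G"

definition graph_union :: "'a graph \<Rightarrow> 'a graph \<Rightarrow> 'a graph" where
  "graph_union G H = (vertices G \<union> vertices H, edges G \<union> edges H)"

definition edge_boundary :: "'a graph \<Rightarrow> 'a set \<Rightarrow> 'a set set" where
  "edge_boundary G U = {e \<in> edges G. card (e \<inter> U) = 1}"

text \<open>The minimum ranges over a nonempty set exactly when the (finite) graph has at least two
  vertices; otherwise the value is unspecified.\<close>

definition edge_expansion :: "'a graph \<Rightarrow> real" where
  "edge_expansion G =
     Min {real (card (edge_boundary G U)) / real (card U) | U.
            U \<subseteq> vertices G \<and> 1 \<le> card U \<and> real (card U) \<le> real (card (vertices G)) / 2}"

text \<open>Used for \<open>d \<ge> 1\<close> only, where adjacent points are automatically distinct.\<close>

definition cube_graph :: "nat \<Rightarrow> nat \<Rightarrow> (nat \<Rightarrow> nat) set \<Rightarrow> (nat \<Rightarrow> nat) graph" where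
  "cube_graph n d V =
     (V, {{x, y} | x y. x \<in> V \<and> y \<in> V \<and> hamming n x y = d \<and> subcube n x y \<inter> V = {x, y}})"

end

theory Submission
  imports Defs "HOL-Real_Asymp.Real_Asymp"
begin

text \<open>Identify \<open>{0,1}\<^sup>n\<close> with the subsets of \<open>{..<n}\<close> under symmetric difference. Whatever depends on
  the bits at distance at least 2 from a fixed point is so concentrated (bounded differences) that it
  holds at all \<open>2\<^sup>n\<close> points at once; only the directions in which a vertex \<open>x\<close> has a neighbour in \<open>V\<close>
  can be atypical, and these are handled by a union bound over all sets \<open>N\<close> of directions.

  Call \<open>x\<close> live if linearly many of its neighbours are missing from \<open>V\<close>, and call a pair at
  distance \<open>d\<close> good if linearly many directions are missing at both ends. The boundary of \<open>U\<close> is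
  bounded below in three steps. First, averaging the indicator of \<open>U\<close> over spheres gives
  \<open>F : {0,1}\<^sup>n \<rightarrow> [0,1]\<close>, and \<open>k(T) = \<Sum>\<^sub>z F(z) (1 - F(z \<oplus> T))\<close> is subadditive in \<open>T\<close>; hence the sum
  over all \<open>T\<close>, which is at least \<open>|U| |V - U|\<close> up to powers of \<open>p\<close>, is bounded by the sum over
  \<open>d\<close>-sets. Second, live vertices \<open>z \<oplus> A\<close> and \<open>z \<oplus> S \<oplus> B\<close> are joined by many paths of good
  pairs with steps \<open>J, B, S, A, J\<close>. Third, the ends of a good pair \<open>x, x \<oplus> R\<close> are joined by many
  paths \<open>x, x \<oplus> I, x \<oplus> R \<oplus> I, x \<oplus> R\<close> in \<open>G\<^sub>d\<close>.

  For \<open>p < 1/2 - \<epsilon>\<close> all vertices are live. In general a dead vertex has almost all neighbours in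
  \<open>V\<close>, all but boundedly many of them live, so that dead vertices expand through \<open>G\<^sub>1\<close>.\<close>

section \<open>Bounded differences\<close>

text \<open>Every exponent has to exceed a multiple of n, because the bounds must survive a union
  over all points. A bit at distance 1 from \<open>x\<close> lies in a share d/n of the
  \<open>d\<close>-cubes at \<open>x\<close>; counted among the random bits it would leave an
  exponent of order q^6 n at best, too small when q tends to 0. A bit at distance 2 lies in a share
  of order d^2/n^2 only, and the exponent becomes q^6 n^2 up to d^2 and factors of the form C^d. The
  union over \<open>N\<close> costs just one further factor 2^n. The conditions on q and d keep
  these exponents above n.

  Oddness of \<open>d\<close> makes a singleton the sum of three \<open>d\<close>-sets; for even
  \<open>d\<close> no edge joins the two parity classes. When p exceeds 1/2 there are typically
  vertices with all neighbours in \<open>V\<close>; no edge of G_3 leaves them, and this is why (a)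
  includes G_1. The exponent 22 is 12 + 3 + 4 + 3: the two ends and the interior of the five-step
  paths cost p^4 each, the squares cost q^3, the size of \<open>V\<close> is bounded through another
  p^4, and the last q^3 is slack.\<close>

lemma Hoeffding_lemma_two_point:
  fixes P :: "bool pmf" and g :: "bool \<Rightarrow> real"
  assumes s: "s > 0" and c: "\<bar>g True - g False\<bar> \<le> c"
  defines "\<mu> \<equiv> measure_pmf.expectation P g"
  shows "measure_pmf.expectation P (\<lambda>b. exp (s * (g b - \<mu>))) \<le> exp (s\<^sup>2 * c\<^sup>2 / 8)"
proof -
  define lo hi where "lo = min (g True) (g False)" and "hi = max (g True) (g False)"
  interpret interval_bounded_random_variable "measure_pmf P" g lo hi
  proof unfold_locales
    show "AE x in measure_pmf P. g x \<in> {lo..hi}"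
      by (rule AE_I2) (metis (full_types) atLeastAtMost_iff hi_def lo_def max.cobounded1 max.cobounded2 min.cobounded1 min.cobounded2)
  qed auto
  have fin: "integrable (measure_pmf P) h" for h :: "bool \<Rightarrow> real"
    by (rule integrable_measure_pmf_finite) (rule finite_subset[OF subset_UNIV], simp)
  have "ennreal (measure_pmf.expectation P (\<lambda>b. exp (s * (g b - \<mu>)))) =
          (\<integral>\<^sup>+b. exp (s * (g b - \<mu>)) \<partial>measure_pmf P)"
    by (rule nn_integral_eq_integral[symmetric]) (auto intro: fin)
  also have "\<dots> \<le> ennreal (exp (s\<^sup>2 * (hi - lo)\<^sup>2 / 8))"
    unfolding \<mu>_def by (rule Hoeffdings_lemma_nn_integral[OF s])
  finally have "measure_pmf.expectation P (\<lambda>b. exp (s * (g b - \<mu>))) \<le> exp (s\<^sup>2 * (hi - lo)\<^sup>2 / 8)"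
    by simp
  also have "(hi - lo)\<^sup>2 \<le> c\<^sup>2"
    using c by (intro power_mono) (auto simp: hi_def lo_def)
  hence "exp (s\<^sup>2 * (hi - lo)\<^sup>2 / 8) \<le> exp (s\<^sup>2 * c\<^sup>2 / 8)"
    by (auto intro!: mult_left_mono divide_right_mono)
  finally show ?thesis .
qed

lemma finite_set_Pi_pmf:
  fixes P :: "'a \<Rightarrow> bool pmf"
  assumes "finite A"
  shows "finite (set_pmf (Pi_pmf A dflt P))"
proof -
  have "set_pmf (Pi_pmf A dflt P) \<subseteq> PiE_dflt A dflt (\<lambda>_. UNIV)"
    using set_Pi_pmf_subset[OF assms, of dflt P] by (auto simp: PiE_dflt_def)
  moreover have "finite (PiE_dflt A dflt (\<lambda>_. UNIV :: bool set))"
    using assms by (intro finite_PiE_dflt) auto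
  ultimately show ?thesis by (rule finite_subset)
qed

lemma integrable_Pi_pmf:
  fixes P :: "'a \<Rightarrow> bool pmf" and f :: "_ \<Rightarrow> real"
  assumes "finite A"
  shows "integrable (measure_pmf (Pi_pmf A dflt P)) f"
  by (intro integrable_measure_pmf_finite finite_set_Pi_pmf assms)

lemma expectation_Pi_pmf_insert:
  fixes P :: "'a \<Rightarrow> bool pmf" and f :: "_ \<Rightarrow> real"
  assumes "finite A" "v \<notin> A"
  shows "measure_pmf.expectation (Pi_pmf (insert v A) dflt P) f =
           measure_pmf.expectation (P v)
             (\<lambda>b. measure_pmf.expectation (Pi_pmf A dflt P) (\<lambda>\<xi>. f (\<xi>(v := b))))"
proof -
  have "Pi_pmf (insert v A) dflt P =
          P v \<bind> (\<lambda>b. map_pmf (\<lambda>\<xi>. \<xi>(v := b)) (Pi_pmf A dflt P))"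
    by (subst Pi_pmf_insert'[OF assms]) (simp add: map_pmf_def)
  also have "measure_pmf.expectation \<dots> f =
     (\<Sum>b\<in>UNIV. pmf (P v) b *\<^sub>R measure_pmf.expectation (map_pmf (\<lambda>\<xi>. \<xi>(v := b)) (Pi_pmf A dflt P)) f)"
    by (rule pmf_expectation_bind) (auto intro: finite_set_Pi_pmf assms)
  also have "\<dots> = measure_pmf.expectation (P v)
             (\<lambda>b. measure_pmf.expectation (Pi_pmf A dflt P) (\<lambda>\<xi>. f (\<xi>(v := b))))"
    by (subst integral_measure_pmf[of UNIV]) auto
  finally show ?thesis .
qed

text \<open>McDiarmid's argument, one coordinate at a time: \<open>g\<close> is the conditional mean
  given the bit at \<open>v\<close>. Fluctuations about \<open>g\<close> are covered by the
  induction hypothesis, since fixing that bit preserves the other differences; the fluctuation of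
  \<open>g\<close> itself is a two-point Hoeffding bound, since averaging does not increase the
  difference \<open>c v\<close>.\<close>

lemma bounded_differences_mgf:
  fixes P :: "'a \<Rightarrow> bool pmf" and f :: "('a \<Rightarrow> bool) \<Rightarrow> real"
  assumes "finite A" "s > 0"
    and "\<And>v \<xi>. v \<in> A \<Longrightarrow> \<bar>f (\<xi>(v := True)) - f (\<xi>(v := False))\<bar> \<le> c v"
  shows "measure_pmf.expectation (Pi_pmf A dflt P)
           (\<lambda>\<xi>. exp (s * (f \<xi> - measure_pmf.expectation (Pi_pmf A dflt P) f)))
         \<le> exp (s\<^sup>2 * (\<Sum>v\<in>A. (c v)\<^sup>2) / 8)"
  using assms(1,3)
proof (induction A arbitrary: f rule: finite_induct)
  case empty
  show ?case by simp
next
  case (insert v A)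
  let ?E = "measure_pmf.expectation (Pi_pmf A dflt P)"
  let ?S = "s\<^sup>2 * (\<Sum>v\<in>A. (c v)\<^sup>2) / 8"
  note int = integrable_Pi_pmf[OF insert.hyps(1), of dflt P]
  define g where "g = (\<lambda>b. ?E (\<lambda>\<xi>. f (\<xi>(v := b))))"
  define \<mu> where "\<mu> = measure_pmf.expectation (P v) g"
  have fin: "integrable (measure_pmf (P v)) h" for h :: "bool \<Rightarrow> real"
    by (rule integrable_measure_pmf_finite) (rule finite_subset[OF subset_UNIV], simp)
  have IH: "?E (\<lambda>\<xi>. exp (s * (f (\<xi>(v := b)) - g b))) \<le> exp ?S" for b
    unfolding g_def
  proof (rule insert.IH)
    fix u \<xi> assume u: "u \<in> A"
    with insert.hyps have "u \<noteq> v" by auto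
    hence eq: "(\<xi>(v := b))(u := t) = (\<xi>(u := t))(v := b)" for t
      by (metis fun_upd_twist)
    show "\<bar>f ((\<xi>(u := True))(v := b)) - f ((\<xi>(u := False))(v := b))\<bar> \<le> c u"
      using insert.prems[of u "\<xi>(v := b)"] u unfolding eq by blast
  qed
  have "\<bar>g True - g False\<bar> = \<bar>?E (\<lambda>\<xi>. f (\<xi>(v := True)) - f (\<xi>(v := False)))\<bar>"
    unfolding g_def by (subst Bochner_Integration.integral_diff) (auto intro: int)
  also have "\<dots> \<le> ?E (\<lambda>\<xi>. \<bar>f (\<xi>(v := True)) - f (\<xi>(v := False))\<bar>)"
    by (rule integral_abs_bound)
  also have "\<dots> \<le> ?E (\<lambda>\<xi>. c v)"
    by (intro integral_mono int insert.prems) auto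
  finally have gc: "\<bar>g True - g False\<bar> \<le> c v" by simp
  have "measure_pmf.expectation (Pi_pmf (insert v A) dflt P) (\<lambda>\<xi>. exp (s * (f \<xi> - \<mu>))) =
     measure_pmf.expectation (P v) (\<lambda>b. ?E (\<lambda>\<xi>. exp (s * (f (\<xi>(v := b)) - \<mu>))))"
    by (rule expectation_Pi_pmf_insert[OF insert.hyps])
  also have "\<dots> = measure_pmf.expectation (P v)
       (\<lambda>b. exp (s * (g b - \<mu>)) * ?E (\<lambda>\<xi>. exp (s * (f (\<xi>(v := b)) - g b))))"
    by (subst Bochner_Integration.integral_mult_right[symmetric])
       (auto intro: int simp flip: exp_add simp: algebra_simps)
  also have "\<dots> \<le> measure_pmf.expectation (P v) (\<lambda>b. exp (s * (g b - \<mu>)) * exp ?S)"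
    by (intro integral_mono fin mult_left_mono IH) auto
  also have "\<dots> = measure_pmf.expectation (P v) (\<lambda>b. exp (s * (g b - \<mu>))) * exp ?S"
    by simp
  also have "\<dots> \<le> exp (s\<^sup>2 * (c v)\<^sup>2 / 8) * exp ?S"
    unfolding \<mu>_def by (intro mult_right_mono Hoeffding_lemma_two_point assms gc) auto
  also have "\<dots> = exp (s\<^sup>2 * (\<Sum>v\<in>insert v A. (c v)\<^sup>2) / 8)"
    using insert.hyps by (simp add: exp_add [symmetric] field_simps)
  finally show ?case
    unfolding \<mu>_def g_def by (subst (2) expectation_Pi_pmf_insert[OF insert.hyps])
qed

lemma bounded_differences_tail:
  fixes P :: "'a \<Rightarrow> bool pmf" and f :: "('a \<Rightarrow> bool) \<Rightarrow> real"
  assumes A: "finite A" and t: "t > 0"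
    and c: "\<And>v \<xi>. v \<in> A \<Longrightarrow> \<bar>f (\<xi>(v := True)) - f (\<xi>(v := False))\<bar> \<le> c v"
    and S: "(\<Sum>v\<in>A. (c v)\<^sup>2) \<le> S" "S > 0"
    and \<mu>: "\<mu> \<le> measure_pmf.expectation (Pi_pmf A dflt P) f"
  shows "measure_pmf.prob (Pi_pmf A dflt P) {\<xi>. f \<xi> \<le> \<mu> - t} \<le> exp (- (2 * t\<^sup>2 / S))"
proof -
  let ?M = "Pi_pmf A dflt P"
  let ?E = "measure_pmf.expectation ?M"
  \<comment> \<open>The minimiser of \<open>s\<^sup>2 * S / 8 - s * t\<close>, whose minimum is
    \<open>- 2 * t\<^sup>2 / S\<close>. The moment bound is applied to \<open>- f\<close>, which
    yields the lower tail.\<close>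
  define s where "s = 4 * t / S"
  have s: "s > 0" using t S by (simp add: s_def)
  have "measure_pmf.prob ?M {\<xi>. f \<xi> \<le> \<mu> - t} \<le>
        measure_pmf.prob ?M {\<xi> \<in> space (measure_pmf ?M). exp (s * t) \<le> exp (s * ((- f \<xi>) - ?E (\<lambda>\<xi>. - f \<xi>)))}"
    using s \<mu> by (intro measure_pmf.finite_measure_mono) auto
  also have "\<dots> \<le> ?E (\<lambda>\<xi>. exp (s * ((- f \<xi>) - ?E (\<lambda>\<xi>. - f \<xi>)))) / exp (s * t)"
    by (rule integral_Markov_inequality_measure[where A = "{}"]) (auto intro: integrable_Pi_pmf A)
  also have "\<dots> \<le> exp (s\<^sup>2 * (\<Sum>v\<in>A. (c v)\<^sup>2) / 8) / exp (s * t)"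
    by (intro divide_right_mono bounded_differences_mgf A s)
       (use c in \<open>auto simp: abs_minus_commute\<close>)
  also have "\<dots> \<le> exp (s\<^sup>2 * S / 8) / exp (s * t)"
    using S by (intro divide_right_mono) (auto intro!: mult_left_mono divide_right_mono)
  also have "\<dots> = exp (- (2 * t\<^sup>2 / S))"
    using S by (simp add: exp_diff [symmetric] s_def field_simps power2_eq_square)
  finally show ?thesis .
qed

text \<open>Flipping the bit \<open>v\<close> changes the count by at most the number of
  \<open>j\<close> with \<open>v \<in> B j\<close>. By double counting these numbers sum to at most
  \<open>card J * m\<close>; each is at most \<open>c\<close>, so their squares sum to at most
  \<open>card J * m * c\<close>. All concentration bounds below except
  \<open>prob_few_nonneighbours\<close> are instances, and their strength depends on
  \<open>c\<close> being small compared with \<open>card J\<close>.\<close>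

lemma counting_lower_tail:
  fixes P :: "'a \<Rightarrow> bool pmf" and \<phi> :: "'j \<Rightarrow> ('a \<Rightarrow> bool) \<Rightarrow> bool"
  assumes A: "finite A" and J: "finite J" "J \<noteq> {}" and t: "t > 0"
    and dep: "\<And>j \<xi> v b. j \<in> J \<Longrightarrow> v \<notin> B j \<Longrightarrow> \<phi> j (\<xi>(v := b)) = \<phi> j \<xi>"
    and m: "\<And>j. j \<in> J \<Longrightarrow> finite (B j) \<and> real (card (B j)) \<le> m" "m > 0"
    and c: "\<And>v. real (card {j \<in> J. v \<in> B j}) \<le> c" "c > 0"
    and r: "\<And>j. j \<in> J \<Longrightarrow> r \<le> measure_pmf.prob (Pi_pmf A dflt P) {\<xi>. \<phi> j \<xi>}"
  shows "measure_pmf.prob (Pi_pmf A dflt P) {\<xi>. real (card {j \<in> J. \<phi> j \<xi>}) \<le> r * real (card J) - t}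
         \<le> exp (- (2 * t\<^sup>2 / (real (card J) * m * c)))"
proof (rule bounded_differences_tail[OF A t])
  let ?c = "\<lambda>v. real (card {j \<in> J. v \<in> B j})"
  show "\<bar>real (card {j \<in> J. \<phi> j (\<xi>(v := True))}) - real (card {j \<in> J. \<phi> j (\<xi>(v := False))})\<bar> \<le> ?c v"
    for v \<xi>
  proof -
    have "card {j \<in> J. \<phi> j (\<xi>(v := b))} \<le> card {j \<in> J. \<phi> j (\<xi>(v := b'))} + card {j \<in> J. v \<in> B j}" for b b'
    proof -
      have "\<phi> j (\<xi>(v := b'))" if "j \<in> J" "\<phi> j (\<xi>(v := b))" "v \<notin> B j" for j
        using dep[of j v "\<xi>(v := b)" b'] that by simp
      hence "{j \<in> J. \<phi> j (\<xi>(v := b))} \<subseteq> {j \<in> J. \<phi> j (\<xi>(v := b'))} \<union> {j \<in> J. v \<in> B j}"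
        by blast
      hence "card {j \<in> J. \<phi> j (\<xi>(v := b))} \<le> card ({j \<in> J. \<phi> j (\<xi>(v := b'))} \<union> {j \<in> J. v \<in> B j})"
        using J by (intro card_mono) auto
      also have "\<dots> \<le> card {j \<in> J. \<phi> j (\<xi>(v := b'))} + card {j \<in> J. v \<in> B j}"
        by (rule card_Un_le)
      finally show ?thesis .
    qed
    from this[of True False] this[of False True] show ?thesis by linarith
  qed
  have "(\<Sum>v\<in>A. ?c v) = (\<Sum>v\<in>A. \<Sum>j\<in>J. of_bool (v \<in> B j))"
    using J by (simp add: Int_def)
  also have "\<dots> = (\<Sum>j\<in>J. \<Sum>v\<in>A. of_bool (v \<in> B j))"
    by (rule sum.swap)
  also have "\<dots> \<le> (\<Sum>j\<in>J. m)"
  proof (rule sum_mono)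
    fix j assume j: "j \<in> J"
    have "(\<Sum>v\<in>A. of_bool (v \<in> B j)) = real (card (A \<inter> B j))"
      using A by simp
    also have "\<dots> \<le> m"
      using m(1)[OF j] card_mono[of "B j" "A \<inter> B j"] by force
    finally show "(\<Sum>v\<in>A. of_bool (v \<in> B j)) \<le> m" .
  qed
  also have "\<dots> = real (card J) * m" by simp
  finally have *: "(\<Sum>v\<in>A. ?c v) \<le> real (card J) * m" .
  have "(\<Sum>v\<in>A. (?c v)\<^sup>2) \<le> (\<Sum>v\<in>A. ?c v * c)"
    unfolding power2_eq_square by (intro sum_mono mult_left_mono c) auto
  also have "\<dots> = (\<Sum>v\<in>A. ?c v) * c" by (simp add: sum_distrib_right)
  also have "\<dots> \<le> real (card J) * m * c"
    using * c by (intro mult_right_mono) auto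
  finally show "(\<Sum>v\<in>A. (?c v)\<^sup>2) \<le> real (card J) * m * c" .
  show "real (card J) * m * c > 0"
    using J m c by (simp add: card_gt_0_iff)
  have "measure_pmf.expectation (Pi_pmf A dflt P) (\<lambda>\<xi>. real (card {j \<in> J. \<phi> j \<xi>})) =
        measure_pmf.expectation (Pi_pmf A dflt P) (\<lambda>\<xi>. \<Sum>j\<in>J. indicator {\<xi>. \<phi> j \<xi>} \<xi>)"
    using J by (intro Bochner_Integration.integral_cong) (auto simp: indicator_def Int_def)
  also have "\<dots> = (\<Sum>j\<in>J. measure_pmf.expectation (Pi_pmf A dflt P) (indicator {\<xi>. \<phi> j \<xi>}))"
    by (rule Bochner_Integration.integral_sum) (auto intro: integrable_Pi_pmf A)
  also have "\<dots> = (\<Sum>j\<in>J. measure_pmf.prob (Pi_pmf A dflt P) {\<xi>. \<phi> j \<xi>})"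
    by simp
  also have "\<dots> \<ge> (\<Sum>j\<in>J. r)"
    by (rule sum_mono) (rule r)
  finally show "r * real (card J) \<le> measure_pmf.expectation (Pi_pmf A dflt P) (\<lambda>\<xi>. real (card {j \<in> J. \<phi> j \<xi>}))"
    by (simp add: mult.commute)
qed

section \<open>Correlations on the cube\<close>

definition xor :: "'a set \<Rightarrow> 'a set \<Rightarrow> 'a set"  (infixl \<open>\<oplus>\<close> 65)
  where "x \<oplus> y = (x - y) \<union> (y - x)"

lemma xor_assoc: "(x \<oplus> y) \<oplus> z = x \<oplus> (y \<oplus> z)"
  and xor_commute: "x \<oplus> y = y \<oplus> x"
  and xor_left_commute: "x \<oplus> (y \<oplus> z) = y \<oplus> (x \<oplus> z)"
  by (auto simp: xor_def)

lemmas xor_ac = xor_assoc xor_commute xor_left_commute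

lemma xor_cancel [simp]: "x \<oplus> x = {}" "x \<oplus> {} = x" "{} \<oplus> x = x" "x \<oplus> (x \<oplus> y) = y"
  by (auto simp: xor_def)

lemma xor_cancel_right [simp]: "x \<oplus> y \<oplus> y = x"
  by (auto simp: xor_def)

lemma xor_left_eq_iff [simp]: "x \<oplus> y = x \<oplus> z \<longleftrightarrow> y = z"
  and xor_right_eq_iff [simp]: "y \<oplus> x = z \<oplus> x \<longleftrightarrow> y = z"
  by (auto simp: xor_def)

lemma xor_image: "inj_on f (x \<union> y) \<Longrightarrow> f ` (x \<oplus> y) = f ` x \<oplus> f ` y"
  by (auto simp: xor_def inj_on_def)

definition cube :: "nat \<Rightarrow> nat set set"
  where "cube n = Pow {..<n}"

definition slice :: "nat \<Rightarrow> nat \<Rightarrow> nat set set"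
  where "slice n d = {S. S \<subseteq> {..<n} \<and> card S = d}"

lemma finite_cube [simp]: "finite (cube n)"
  by (simp add: cube_def)

lemma card_cube: "card (cube n) = 2 ^ n"
  by (simp add: cube_def card_Pow)

lemma slice_subset_cube: "slice n d \<subseteq> cube n"
  by (auto simp: slice_def cube_def)

lemma slice_cubeD: "S \<in> slice n d \<Longrightarrow> S \<in> cube n"
  using slice_subset_cube by blast

lemma finite_slice [simp]: "finite (slice n d)"
  by (rule finite_subset[OF slice_subset_cube]) simp

lemma card_slice: "card (slice n d) = n choose d"
  unfolding slice_def using n_subsets[of "{..<n}" d] by simp

lemma xor_in_cube: "x \<in> cube n \<Longrightarrow> y \<in> cube n \<Longrightarrow> x \<oplus> y \<in> cube n"
  by (auto simp: cube_def xor_def)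

lemma bij_betw_xor_cube: "x \<in> cube n \<Longrightarrow> bij_betw (\<lambda>y. x \<oplus> y) (cube n) (cube n)"
  by (rule bij_betwI[where g = "\<lambda>y. x \<oplus> y"]) (auto intro: xor_in_cube)

lemma sum_xor_cube:
  fixes g :: "nat set \<Rightarrow> 'b::comm_monoid_add"
  shows "x \<in> cube n \<Longrightarrow> (\<Sum>y\<in>cube n. g (y \<oplus> x)) = (\<Sum>y\<in>cube n. g y)"
  using sum.reindex_bij_betw[OF bij_betw_xor_cube, of x n g] by (simp add: xor_commute)

section \<open>Symmetrisation over coordinate permutations\<close>

lemma ex_permutes_image:
  assumes "finite X" "S \<subseteq> X" "T \<subseteq> X" "card S = card T"
  obtains \<pi> where "\<pi> permutes X" "\<pi> ` S = T"
proof -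
  have fin: "finite S" "finite T" using assms finite_subset by blast+
  obtain f where f: "bij_betw f S T"
    using finite_same_card_bij[OF fin assms(4)] by blast
  have "card (X - S) = card (X - T)"
    using assms fin by (simp add: card_Diff_subset)
  then obtain g where g: "bij_betw g (X - S) (X - T)"
    using finite_same_card_bij[of "X - S" "X - T"] assms(1) by blast
  define \<pi> where "\<pi> = (\<lambda>x. if x \<in> S then f x else if x \<in> X then g x else x)"
  have 1: "bij_betw \<pi> S T"
    using f by (rule bij_betw_cong[THEN iffD1, rotated]) (simp add: \<pi>_def)
  have 2: "bij_betw \<pi> (X - S) (X - T)"
    using g by (rule bij_betw_cong[THEN iffD1, rotated]) (simp add: \<pi>_def)
  have "bij_betw \<pi> (S \<union> (X - S)) (T \<union> (X - T))"
    by (rule bij_betw_combine[OF 1 2]) auto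
  moreover have "S \<union> (X - S) = X" "T \<union> (X - T) = X" using assms by auto
  ultimately have "\<pi> permutes X"
    using assms(2) by (intro bij_imp_permutes) (auto simp: \<pi>_def)
  moreover have "\<pi> ` S = T" using 1 by (simp add: bij_betw_def)
  ultimately show ?thesis using that by blast
qed

text \<open>The image of \<open>S\<close> under a uniformly random permutation is uniform on the
  slice; the identity says this with denominators cleared. By transitivity the inner sum is the same
  for every \<open>T\<close> of the slice, so it may be averaged over \<open>T\<close>.\<close>

lemma sum_permutations_image:
  fixes k :: "nat set \<Rightarrow> real"
  assumes S: "S \<in> slice n d"
  shows "real (n choose d) * (\<Sum>\<pi> | \<pi> permutes {..<n}. k (\<pi> ` S)) = fact n * (\<Sum>T\<in>slice n d. k T)"
proof -
  let ?P = "{\<pi>. \<pi> permutes {..<n}}"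
  let ?\<Phi> = "\<lambda>T. \<Sum>\<pi>\<in>?P. k (\<pi> ` T)"
  have inv: "?\<Phi> T = ?\<Phi> S" if T: "T \<in> slice n d" for T
  proof -
    obtain \<sigma> where \<sigma>: "\<sigma> permutes {..<n}" "\<sigma> ` S = T"
      using ex_permutes_image[of "{..<n}" S T] S T by (auto simp: slice_def)
    have "?\<Phi> S = (\<Sum>\<pi>\<in>?P. k ((\<pi> \<circ> \<sigma>) ` S))"
      by (rule sum_permutations_compose_right[OF \<sigma>(1)])
    also have "\<dots> = ?\<Phi> T"
      by (simp only: \<sigma>(2)[symmetric] image_comp)
    finally show ?thesis by simp
  qed
  have "real (n choose d) * ?\<Phi> S = (\<Sum>T\<in>slice n d. ?\<Phi> T)"
    using inv by (simp add: card_slice)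
  also have "\<dots> = (\<Sum>\<pi>\<in>?P. \<Sum>T\<in>slice n d. k (\<pi> ` T))"
    by (rule sum.swap)
  also have "\<dots> = (\<Sum>\<pi>\<in>?P. \<Sum>T\<in>slice n d. k T)"
  proof (rule sum.cong[OF refl])
    fix \<pi> assume "\<pi> \<in> ?P"
    hence \<pi>: "\<pi> permutes {..<n}" by simp
    have *: "\<rho> ` T \<in> slice n d" if "T \<in> slice n d" "\<rho> permutes {..<n}" for T \<rho>
      using that permutes_image[OF that(2)] card_image[OF inj_on_subset[OF permutes_inj[OF that(2)]], of T]
      by (auto simp: slice_def)
    have "bij_betw (\<lambda>T. \<pi> ` T) (slice n d) (slice n d)"
    proof (rule bij_betwI[where g = "\<lambda>T. inv \<pi> ` T"])
      show "(\<lambda>T. \<pi> ` T) \<in> slice n d \<rightarrow> slice n d" using * \<pi> by auto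
      show "(\<lambda>T. inv \<pi> ` T) \<in> slice n d \<rightarrow> slice n d" using * permutes_inv[OF \<pi>] by auto
    qed (auto simp: image_comp permutes_inv_o[OF \<pi>])
    thus "(\<Sum>T\<in>slice n d. k (\<pi> ` T)) = (\<Sum>T\<in>slice n d. k T)"
      by (rule sum.reindex_bij_betw)
  qed
  also have "\<dots> = fact n * (\<Sum>T\<in>slice n d. k T)"
    by (simp add: card_permutations)
  finally show ?thesis .
qed

text \<open>For odd \<open>d\<close> a singleton is the xor of three \<open>d\<close>-sets.
  Subadditivity on these three, averaged over all permutations, bounds the mean of \<open>k\<close>
  over singletons by three times its mean over the slice.\<close>

lemma subadditive_singletons_le_slice:
  fixes k :: "nat set \<Rightarrow> real"
  assumes sub: "\<And>S T. S \<in> cube n \<Longrightarrow> T \<in> cube n \<Longrightarrow> k (S \<oplus> T) \<le> k S + k T"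
    and d: "odd d" and n: "2 * d \<le> n"
  shows "real (n choose d) * (\<Sum>i<n. k {i}) \<le> 3 * real n * (\<Sum>S\<in>slice n d. k S)"
proof -
  obtain m where m: "d = 2 * m + 1" using d by (elim oddE)
  \<comment> \<open>Every point other than 0 lies in none or in exactly two of the sets:
    \<open>{1..m}\<close> in the first two, \<open>{m + 1..2 * m}\<close> in the first and third,
    the rest in the last two. All points are at most \<open>3 * m + 1\<close>, which is below
    \<open>n\<close> by \<open>2 * d \<le> n\<close>.\<close>
  define S1 S2 S3 where "S1 = {..2 * m}" and "S2 = {1..m} \<union> {2 * m + 1..3 * m + 1}"
    and "S3 = {m + 1..3 * m + 1}"
  have S: "S1 \<in> slice n d" "S2 \<in> slice n d" "S3 \<in> slice n d"
    using n unfolding S1_def S2_def S3_def slice_def m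
    by (auto simp: card_Un_disjoint)
  have eq: "{0} = S1 \<oplus> (S2 \<oplus> S3)"
    by (auto simp: S1_def S2_def S3_def xor_def)
  let ?P = "{\<pi>. \<pi> permutes {..<n}}"
  have 0: "{0} \<in> slice n 1" using n m by (auto simp: slice_def)
  have "slice n 1 = (\<lambda>i. {i}) ` {..<n}"
    by (auto simp: slice_def card_1_singleton_iff)
  hence sing: "(\<Sum>T\<in>slice n 1. k T) = (\<Sum>i<n. k {i})"
    by (simp add: sum.reindex)
  have "(\<Sum>\<pi>\<in>?P. k (\<pi> ` {0})) \<le> (\<Sum>\<pi>\<in>?P. k (\<pi> ` S1) + (k (\<pi> ` S2) + k (\<pi> ` S3)))"
  proof (rule sum_mono)
    fix \<pi> assume "\<pi> \<in> ?P"
    hence \<pi>: "\<pi> permutes {..<n}" by simp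
    have inj: "inj_on \<pi> X" for X using permutes_inj[OF \<pi>] inj_on_subset by blast
    have cu: "\<pi> ` T \<in> cube n" if "T \<in> slice n d" for T
      using that permutes_image[OF \<pi>] by (auto simp: slice_def cube_def)
    have "\<pi> ` {0} = \<pi> ` S1 \<oplus> (\<pi> ` S2 \<oplus> \<pi> ` S3)"
      by (simp only: eq xor_image[OF inj])
    thus "k (\<pi> ` {0}) \<le> k (\<pi> ` S1) + (k (\<pi> ` S2) + k (\<pi> ` S3))"
      using sub[of "\<pi> ` S1" "\<pi> ` S2 \<oplus> \<pi> ` S3"] sub[of "\<pi> ` S2" "\<pi> ` S3"] cu S xor_in_cube
      by fastforce
  qed
  hence "real (n choose d) * real n * (\<Sum>\<pi>\<in>?P. k (\<pi> ` {0})) \<le>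
     real (n choose d) * real n * (\<Sum>\<pi>\<in>?P. k (\<pi> ` S1) + (k (\<pi> ` S2) + k (\<pi> ` S3)))"
    by (intro mult_left_mono) auto
  also have "\<dots> = 3 * real n * fact n * (\<Sum>T\<in>slice n d. k T)"
    using S[THEN sum_permutations_image, of k] by (simp add: sum.distrib algebra_simps)
  also have "real (n choose d) * real n * (\<Sum>\<pi>\<in>?P. k (\<pi> ` {0})) =
      fact n * (real (n choose d) * (\<Sum>i<n. k {i}))"
    using sum_permutations_image[OF 0, of k] unfolding sing by simp
  finally have "fact n * (real (n choose d) * (\<Sum>i<n. k {i})) \<le>
      fact n * (3 * real n * (\<Sum>T\<in>slice n d. k T))"
    by (simp only: mult_ac)
  thus ?thesis by simp
qed

text \<open>For \<open>F\<close> with values 0 and 1, \<open>k T\<close> counts the points that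
  translation by \<open>T\<close> moves out of the set. All values of \<open>k\<close> are
  controlled by its values at singletons and thereby by the slice, while the sum of \<open>k\<close>
  over the whole cube factors into the product on the left. The constant 6 is 2 for reaching all
  \<open>T\<close> from singletons times 3 for reaching singletons from the slice.\<close>

lemma correlation_le_slice:
  fixes F :: "nat set \<Rightarrow> real"
  assumes F: "\<And>z. z \<in> cube n \<Longrightarrow> 0 \<le> F z \<and> F z \<le> 1"
    and d: "odd d" and n: "2 * d \<le> n"
  shows "real (n choose d) * ((\<Sum>z\<in>cube n. F z) * (\<Sum>z\<in>cube n. 1 - F z))
         \<le> 6 * real n * 2 ^ n * (\<Sum>S\<in>slice n d. \<Sum>z\<in>cube n. F z * (1 - F (z \<oplus> S)))"
proof -
  define k where "k = (\<lambda>T. \<Sum>z\<in>cube n. F z * (1 - F (z \<oplus> T)))"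
  have k0: "k T \<ge> 0" if "T \<in> cube n" for T
    unfolding k_def using that F by (intro sum_nonneg mult_nonneg_nonneg) (auto intro: xor_in_cube)
  have sub: "k (S \<oplus> T) \<le> k S + k T" if ST: "S \<in> cube n" "T \<in> cube n" for S T
  proof -
    have "k (S \<oplus> T) \<le> (\<Sum>z\<in>cube n. F z * (1 - F (z \<oplus> S)) + F (z \<oplus> S) * (1 - F (z \<oplus> S \<oplus> T)))"
      unfolding k_def
    proof (rule sum_mono)
      fix z assume z: "z \<in> cube n"
      define a b c where "a = F z" and "b = F (z \<oplus> S)" and "c = F (z \<oplus> S \<oplus> T)"
      have "0 \<le> a" "a \<le> 1" "0 \<le> b" "b \<le> 1" "0 \<le> c" "c \<le> 1"
        using z ST F by (auto simp: a_def b_def c_def intro: xor_in_cube)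
      \<comment> \<open>This expression equals
        \<open>a * (1 - b) + b * (1 - c) - a * (1 - c)\<close>, written so that its sign is
        visible.\<close>
      hence "0 \<le> b * ((1 - a) * (1 - c)) + (1 - b) * (a * c)"
        by (intro add_nonneg_nonneg mult_nonneg_nonneg) auto
      hence "a * (1 - c) \<le> a * (1 - b) + b * (1 - c)"
        by (simp add: algebra_simps)
      thus "F z * (1 - F (z \<oplus> (S \<oplus> T))) \<le> F z * (1 - F (z \<oplus> S)) + F (z \<oplus> S) * (1 - F (z \<oplus> S \<oplus> T))"
        by (simp add: a_def b_def c_def xor_assoc)
    qed
    also have "\<dots> = k S + (\<Sum>z\<in>cube n. (\<lambda>z. F z * (1 - F (z \<oplus> T))) (z \<oplus> S))"
      by (simp add: sum.distrib k_def)
    also have "\<dots> = k S + k T"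
      by (subst sum_xor_cube[OF ST(1)]) (simp add: k_def)
    finally show ?thesis .
  qed
  define s where "s = (\<Sum>i<n. k {i})"
  have sing: "{i} \<in> cube n" if "i < n" for i using that by (simp add: cube_def)
  have pos: "0 < n" using d n by (auto elim: oddE)
  have single: "k {i} \<le> s" if "i < n" for i
    unfolding s_def using that by (intro member_le_sum) (auto intro: k0 sing)
  \<comment> \<open>The factor 2 is for \<open>T = {}\<close>: \<open>k {}\<close> is the sum of
    \<open>F z * (1 - F z)\<close>, which can be positive, and it is reached as
    \<open>{0} \<oplus> {0}\<close>. A nonempty \<open>T\<close> costs only
    \<open>s\<close>.\<close>
  have le: "k T \<le> 2 * s" if T: "T \<in> cube n" for T
  proof (cases "T = {}")
    case True
    have "k ({0} \<oplus> {0}) \<le> k {0} + k {0}"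
      using pos by (intro sub sing) auto
    thus ?thesis using single[OF pos] True by simp
  next
    case False
    have "finite T" "T \<subseteq> {..<n}" using T finite_subset by (auto simp: cube_def)
    from this(1) False this(2) have "k T \<le> (\<Sum>i\<in>T. k {i})"
    proof (induction T rule: finite_ne_induct)
      case (insert i T)
      have "insert i T = {i} \<oplus> T" using insert by (auto simp: xor_def)
      hence "k (insert i T) \<le> k {i} + k T"
        using sub[of "{i}" T] insert by (auto simp: cube_def)
      thus ?case using insert by auto
    qed simp
    also have "\<dots> \<le> s"
      unfolding s_def using T by (intro sum_mono2) (auto simp: cube_def intro!: k0)
    also have "s \<le> 2 * s"
      using k0[OF sing[OF pos]] single[OF pos] by simp
    finally show ?thesis .
  qed
  have "(\<Sum>T\<in>cube n. k T) = (\<Sum>z\<in>cube n. \<Sum>T\<in>cube n. F z * (1 - F (z \<oplus> T)))"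
    unfolding k_def by (rule sum.swap)
  also have "\<dots> = (\<Sum>z\<in>cube n. F z * (\<Sum>T\<in>cube n. 1 - F (T \<oplus> z)))"
    by (simp add: sum_distrib_left xor_commute)
  also have "\<dots> = (\<Sum>z\<in>cube n. F z * (\<Sum>T\<in>cube n. 1 - F T))"
    using sum_xor_cube[where g = "\<lambda>T. 1 - F T"] by (intro sum.cong refl) simp
  finally have "(\<Sum>z\<in>cube n. F z) * (\<Sum>z\<in>cube n. 1 - F z) = (\<Sum>T\<in>cube n. k T)"
    by (simp add: sum_distrib_right)
  also have "\<dots> \<le> (\<Sum>T\<in>cube n. 2 * s)"
    by (rule sum_mono) (rule le)
  also have "\<dots> = 2 * 2 ^ n * s"
    by (simp add: card_cube)
  finally have "real (n choose d) * ((\<Sum>z\<in>cube n. F z) * (\<Sum>z\<in>cube n. 1 - F z)) \<le>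
       real (n choose d) * (2 * 2 ^ n * s)"
    by (rule mult_left_mono) simp
  also have "\<dots> = 2 * 2 ^ n * (real (n choose d) * s)"
    by simp
  also have "\<dots> \<le> 2 * 2 ^ n * (3 * real n * (\<Sum>S\<in>slice n d. k S))"
    unfolding s_def by (intro mult_left_mono subadditive_singletons_le_slice sub d n) auto
  finally show ?thesis
    by (simp add: k_def mult_ac)
qed

section \<open>Path counting\<close>

text \<open>An edge is recorded as its end inside \<open>U\<close> together with its direction, so
  each boundary edge is counted once. The relation is a parameter because good pairs and the edges
  of the graphs both take its place.\<close>

definition boundary_steps ::
    "nat \<Rightarrow> nat \<Rightarrow> (nat set \<Rightarrow> nat set \<Rightarrow> bool) \<Rightarrow> nat set set \<Rightarrow> nat set set \<Rightarrow> (nat set \<times> nat set) set"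
  where "boundary_steps n d r V U = {(e, R). R \<in> slice n d \<and> e \<in> U \<and> e \<oplus> R \<in> V - U \<and> r e (e \<oplus> R)}"

lemma finite_boundary_steps: "finite U \<Longrightarrow> finite (boundary_steps n d r V U)"
  by (rule finite_subset[of _ "U \<times> slice n d"]) (auto simp: boundary_steps_def)

lemma card_vimage_times_le:
  assumes "inj_on f X" "finite E" "finite Y"
  shows "card {t \<in> X. f t \<in> E \<times> Y} \<le> card E * card Y"
proof -
  have "card {t \<in> X. f t \<in> E \<times> Y} \<le> card (E \<times> Y)"
    using assms by (intro card_inj_on_le[of f]) (auto intro: inj_on_subset)
  thus ?thesis by (simp add: card_cartesian_product)
qed

lemma sum_card_translates:
  assumes X: "X \<subseteq> cube n"
  shows "(\<Sum>z\<in>cube n. real (card {A \<in> slice n d. z \<oplus> A \<in> X})) = real (n choose d) * real (card X)"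
proof -
  have "(\<Sum>z\<in>cube n. real (card {A \<in> slice n d. z \<oplus> A \<in> X})) =
      (\<Sum>z\<in>cube n. \<Sum>A\<in>slice n d. of_bool (z \<oplus> A \<in> X))"
    by (simp add: Int_def)
  also have "\<dots> = (\<Sum>A\<in>slice n d. \<Sum>z\<in>cube n. of_bool (z \<oplus> A \<in> X))" by (rule sum.swap)
  also have "\<dots> = (\<Sum>A\<in>slice n d. \<Sum>z\<in>cube n. of_bool (z \<in> X))"
    by (intro sum.cong refl sum_xor_cube slice_cubeD)
  also have "\<dots> = (\<Sum>A\<in>slice n d. real (card X))"
    using X by (simp add: Int_absorb1)
  finally show ?thesis by (simp add: card_slice)
qed

text \<open>A path from \<open>x\<close> to \<open>y\<close> with steps \<open>J, B, S, A, J\<close> visits vertices that are spread out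
  as \<open>J\<close> varies, so that it survives in a random vertex set for many \<open>J\<close>; conversely, given
  its position on the path, a step determines the path up to three of \<open>A, B, S, J\<close>.\<close>

lemma boundary_steps_lower_bound:
  fixes V U L :: "nat set set" and r :: "nat set \<Rightarrow> nat set \<Rightarrow> bool"
  assumes V: "V \<subseteq> cube n" and U: "U \<subseteq> V" and L: "L \<subseteq> V"
    and dense: "\<And>z. z \<in> cube n \<Longrightarrow> \<beta> \<le> real (card {A \<in> slice n d. z \<oplus> A \<in> L})" "\<beta> > 0"
    and paths: "\<And>x y B S. x \<in> L \<Longrightarrow> y \<in> L \<Longrightarrow> B \<in> slice n d \<Longrightarrow> S \<in> slice n d \<Longrightarrow>
       \<gamma> \<le> real (card {J \<in> slice n d. r x (x \<oplus> J) \<and> r (x \<oplus> J) (x \<oplus> J \<oplus> B) \<and>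
             r (x \<oplus> J \<oplus> B) (x \<oplus> J \<oplus> B \<oplus> S) \<and> r (x \<oplus> J \<oplus> B \<oplus> S) (y \<oplus> J) \<and> r (y \<oplus> J) y})"
      "\<gamma> \<ge> 0"
    and rV: "\<And>u v. r u v \<Longrightarrow> u \<in> V \<and> v \<in> V"
    and d: "odd d" and n: "2 * d \<le> n"
  shows "\<gamma> * \<beta>\<^sup>2 * (real (card (L \<inter> U)) * real (card (L - U))) \<le>
         30 * real n * 2 ^ n * (real (n choose d))\<^sup>2 * real (card (boundary_steps n d r V U))"
proof -
  let ?D = "real (n choose d)"
  let ?Q = "slice n d"
  have D: "?D > 0" using n by simp
  have fin: "finite V" "finite U" "finite L"
    using V U L finite_subset[OF _ finite_cube] by blast+
  define u w b where "u = (\<lambda>z. real (card {A \<in> ?Q. z \<oplus> A \<in> L \<inter> U}))"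
    and "w = (\<lambda>z. real (card {A \<in> ?Q. z \<oplus> A \<in> L - U}))"
    and "b = (\<lambda>z. real (card {A \<in> ?Q. z \<oplus> A \<in> L}))"
  have uwb: "u z + w z = b z" for z
  proof -
    have "{A \<in> ?Q. z \<oplus> A \<in> L} = {A \<in> ?Q. z \<oplus> A \<in> L \<inter> U} \<union> {A \<in> ?Q. z \<oplus> A \<in> L - U}" by auto
    moreover have "card \<dots> = card {A \<in> ?Q. z \<oplus> A \<in> L \<inter> U} + card {A \<in> ?Q. z \<oplus> A \<in> L - U}"
      by (rule card_Un_disjoint) auto
    ultimately show ?thesis by (simp add: u_def w_def b_def)
  qed
  have nonneg: "u z \<ge> 0" "w z \<ge> 0" for z by (auto simp: u_def w_def)
  have b\<beta>: "\<beta> \<le> b z" if "z \<in> cube n" for z using dense(1)[OF that] by (simp add: b_def)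
  have bD: "b z \<le> ?D" for z
    using card_mono[of ?Q "{A \<in> ?Q. z \<oplus> A \<in> L}"] by (simp add: b_def card_slice)
  \<comment> \<open>The share of \<open>U\<close> among the live points of the sphere about
    \<open>z\<close>, not among all its points; this way \<open>1 - F z\<close> is the share of live
    points outside \<open>U\<close>. The bound \<open>\<beta> \<le> b z\<close> keeps the
    denominator positive.\<close>
  define F where "F = (\<lambda>z. u z / b z)"
  have F1: "1 - F z = w z / b z" if "z \<in> cube n" for z
    using uwb[of z] b\<beta>[OF that] dense(2) by (simp add: F_def field_simps)
  have F01: "0 \<le> F z \<and> F z \<le> 1" if "z \<in> cube n" for z
    using uwb[of z] b\<beta>[OF that] dense(2) nonneg[of z] by (simp add: F_def field_simps)
  \<comment> \<open>Since \<open>b z\<close> is at most \<open>?D\<close>, dividing by it can only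
    enlarge the sum, so nothing is lost by passing to shares.\<close>
  have le: "real (card X) \<le> (\<Sum>z\<in>cube n. real (card {A \<in> ?Q. z \<oplus> A \<in> X}) / b z)"
    if X: "X \<subseteq> cube n" for X
  proof -
    have "real (card X) = (\<Sum>z\<in>cube n. real (card {A \<in> ?Q. z \<oplus> A \<in> X}) / ?D)"
      using sum_card_translates[OF X, of d] D by (simp flip: sum_divide_distrib)
    also have "\<dots> \<le> (\<Sum>z\<in>cube n. real (card {A \<in> ?Q. z \<oplus> A \<in> X}) / b z)"
    proof (intro sum_mono divide_left_mono)
      fix z assume "z \<in> cube n"
      with b\<beta>[of z] dense(2) D show "?D * b z > 0" by simp
    qed (auto simp: bD D)
    finally show ?thesis .
  qed
  have sumF: "real (card (L \<inter> U)) \<le> (\<Sum>z\<in>cube n. F z)"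
    unfolding F_def u_def using L V by (intro le) auto
  have "real (card (L - U)) \<le> (\<Sum>z\<in>cube n. w z / b z)"
    unfolding w_def using L V by (intro le) auto
  also have "\<dots> = (\<Sum>z\<in>cube n. 1 - F z)" by (simp add: F1)
  finally have sumF1: "real (card (L - U)) \<le> (\<Sum>z\<in>cube n. 1 - F z)" .

  \<comment> \<open>Pairs of path ends: \<open>z \<oplus> A\<close> live in \<open>U\<close> and
    \<open>z \<oplus> S \<oplus> B\<close> live outside. For given \<open>S\<close> and
    \<open>z\<close> there are \<open>u z * w (z \<oplus> S)\<close> of them, at least
    \<open>\<beta>\<^sup>2\<close> times the correlation term.\<close>
  define T where "T = (SIGMA (S, z) : ?Q \<times> cube n.
      {A \<in> ?Q. z \<oplus> A \<in> L \<inter> U} \<times> {B \<in> ?Q. z \<oplus> S \<oplus> B \<in> L - U})"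
  have finT: "finite T" unfolding T_def by (rule finite_SigmaI) auto
  have cardT: "real (card T) = (\<Sum>S\<in>?Q. \<Sum>z\<in>cube n. u z * w (z \<oplus> S))"
    unfolding T_def u_def w_def
    by (subst card_SigmaI) (auto simp: card_cartesian_product sum.cartesian_product split_def)
  have "\<beta>\<^sup>2 * (\<Sum>S\<in>?Q. \<Sum>z\<in>cube n. F z * (1 - F (z \<oplus> S))) \<le> real (card T)"
    unfolding cardT sum_distrib_left
  proof (intro sum_mono)
    fix S z assume S: "S \<in> ?Q" and z: "z \<in> cube n"
    have zS: "z \<oplus> S \<in> cube n" by (rule xor_in_cube[OF z slice_cubeD[OF S]])
    have "\<beta>\<^sup>2 \<le> b z * b (z \<oplus> S)"
      unfolding power2_eq_square using b\<beta>[OF z] b\<beta>[OF zS] dense(2) by (intro mult_mono) auto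
    hence "\<beta>\<^sup>2 * (F z * (1 - F (z \<oplus> S))) \<le> (b z * b (z \<oplus> S)) * (F z * (1 - F (z \<oplus> S)))"
      using F01[OF z] F01[OF zS] by (intro mult_right_mono) auto
    also have "\<dots> = u z * w (z \<oplus> S)"
      unfolding F1[OF zS] using b\<beta>[OF z] b\<beta>[OF zS] dense(2) by (simp add: F_def)
    finally show "\<beta>\<^sup>2 * (F z * (1 - F (z \<oplus> S))) \<le> u z * w (z \<oplus> S)" .
  qed
  moreover have "?D * (real (card (L \<inter> U)) * real (card (L - U))) \<le>
      6 * real n * 2 ^ n * (\<Sum>S\<in>?Q. \<Sum>z\<in>cube n. F z * (1 - F (z \<oplus> S)))"
  proof -
    have "?D * (real (card (L \<inter> U)) * real (card (L - U))) \<le>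
       ?D * ((\<Sum>z\<in>cube n. F z) * (\<Sum>z\<in>cube n. 1 - F z))"
      using sumF sumF1 F01 by (intro mult_left_mono mult_mono) (auto intro!: sum_nonneg)
    also have "\<dots> \<le> 6 * real n * 2 ^ n * (\<Sum>S\<in>?Q. \<Sum>z\<in>cube n. F z * (1 - F (z \<oplus> S)))"
      by (rule correlation_le_slice[OF F01 d n])
    finally show ?thesis .
  qed
  ultimately have T: "\<beta>\<^sup>2 * (?D * (real (card (L \<inter> U)) * real (card (L - U)))) \<le> 6 * real n * 2 ^ n * real (card T)"
    using mult_left_mono[of "?D * (real (card (L \<inter> U)) * real (card (L - U)))" _ "\<beta>\<^sup>2"]
      mult_left_mono[of _ "real (card T)" "6 * real n * 2 ^ n"]
    by (smt (verit, ccfv_SIG) mult.left_commute mult_nonneg_nonneg of_nat_0_le_iff zero_le_power zero_le_power2)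

  define E where "E = boundary_steps n d r V U"
  have finE: "finite E" unfolding E_def by (rule finite_boundary_steps[OF fin(2)])
  define Y where "Y = ?Q \<times> ?Q \<times> ?Q"
  have Y: "finite Y" "card Y = (n choose d) ^ 3"
    by (auto simp: Y_def card_cartesian_product card_slice power3_eq_cube)
  define G where "G = (\<lambda>((S, z), (A, B)).
    let x = z \<oplus> A; y = z \<oplus> S \<oplus> B in {J \<in> ?Q. r x (x \<oplus> J) \<and> r (x \<oplus> J) (x \<oplus> J \<oplus> B) \<and>
             r (x \<oplus> J \<oplus> B) (x \<oplus> J \<oplus> B \<oplus> S) \<and> r (x \<oplus> J \<oplus> B \<oplus> S) (y \<oplus> J) \<and> r (y \<oplus> J) y})"
  define X where "X = Sigma T G"
  define f1 f2 f3 f4 f5 :: "((nat set \<times> nat set) \<times> (nat set \<times> nat set)) \<times> nat set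
      \<Rightarrow> (nat set \<times> nat set) \<times> (nat set \<times> nat set \<times> nat set)"
    where "f1 = (\<lambda>(((S, z), (A, B)), J). ((z \<oplus> A, J), (A, S, B)))"
      and "f2 = (\<lambda>(((S, z), (A, B)), J). ((z \<oplus> A \<oplus> J, B), (A, J, S)))"
      and "f3 = (\<lambda>(((S, z), (A, B)), J). ((z \<oplus> A \<oplus> J \<oplus> B, S), (A, J, B)))"
      and "f4 = (\<lambda>(((S, z), (A, B)), J). ((z \<oplus> A \<oplus> J \<oplus> B \<oplus> S, A), (J, B, S)))"
      and "f5 = (\<lambda>(((S, z), (A, B)), J). ((z \<oplus> S \<oplus> B \<oplus> J, J), (A, B, S)))"
  note f_defs = f1_def f2_def f3_def f4_def f5_def
  have inj: "inj_on f1 X" "inj_on f2 X" "inj_on f3 X" "inj_on f4 X" "inj_on f5 X"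
    unfolding f_defs by (auto intro!: inj_onI)
  have finX: "finite X" unfolding X_def by (rule finite_SigmaI[OF finT]) (auto simp: G_def Let_def)
  have "X \<subseteq> {t \<in> X. f1 t \<in> E \<times> Y} \<union> {t \<in> X. f2 t \<in> E \<times> Y} \<union> {t \<in> X. f3 t \<in> E \<times> Y}
            \<union> {t \<in> X. f4 t \<in> E \<times> Y} \<union> {t \<in> X. f5 t \<in> E \<times> Y}" (is "_ \<subseteq> ?R")
  proof
    fix t assume t: "t \<in> X"
    obtain S z A B J where t_eq: "t = (((S, z), (A, B)), J)" by (metis surj_pair)
    define x y where "x = z \<oplus> A" and "y = z \<oplus> S \<oplus> B"
    have mem: "S \<in> ?Q" "A \<in> ?Q" "B \<in> ?Q" "J \<in> ?Q" "x \<in> U" "y \<in> V - U"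
      and rs: "r x (x \<oplus> J)" "r (x \<oplus> J) (x \<oplus> J \<oplus> B)"
             "r (x \<oplus> J \<oplus> B) (x \<oplus> J \<oplus> B \<oplus> S)" "r (x \<oplus> J \<oplus> B \<oplus> S) (y \<oplus> J)" "r (y \<oplus> J) y"
      using t L unfolding t_eq X_def T_def G_def x_def y_def by (auto simp: Let_def)
    have e4: "x \<oplus> J \<oplus> B \<oplus> S \<oplus> A = y \<oplus> J" by (simp add: x_def y_def xor_ac)
    have e5: "y \<oplus> J \<oplus> J = y" by simp
    consider "x \<oplus> J \<notin> U" | "x \<oplus> J \<in> U" "x \<oplus> J \<oplus> B \<notin> U" | "x \<oplus> J \<oplus> B \<in> U" "x \<oplus> J \<oplus> B \<oplus> S \<notin> U"
      | "x \<oplus> J \<oplus> B \<oplus> S \<in> U" "y \<oplus> J \<notin> U" | "y \<oplus> J \<in> U"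
      by blast
    thus "t \<in> ?R"
    proof cases
      case 1
      hence "f1 t \<in> E \<times> Y"
        using mem rs rV[OF rs(1)] by (auto simp: t_eq f1_def E_def Y_def boundary_steps_def x_def)
      thus ?thesis using t by simp
    next
      case 2
      hence "f2 t \<in> E \<times> Y"
        using mem rs rV[OF rs(2)] by (auto simp: t_eq f2_def E_def Y_def boundary_steps_def x_def)
      thus ?thesis using t by simp
    next
      case 3
      hence "f3 t \<in> E \<times> Y"
        using mem rs rV[OF rs(3)] by (auto simp: t_eq f3_def E_def Y_def boundary_steps_def x_def)
      thus ?thesis using t by simp
    next
      case 4
      hence "(x \<oplus> J \<oplus> B \<oplus> S, A) \<in> E"
        using mem rs rV[OF rs(4)] unfolding E_def boundary_steps_def by (simp add: e4)
      hence "f4 t \<in> E \<times> Y"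
        using mem by (simp add: t_eq f4_def Y_def x_def)
      thus ?thesis using t by simp
    next
      case 5
      hence "(y \<oplus> J, J) \<in> E"
        using mem rs unfolding E_def boundary_steps_def by simp
      hence "f5 t \<in> E \<times> Y"
        using mem by (simp add: t_eq f5_def Y_def y_def)
      thus ?thesis using t by simp
    qed
  qed
  hence "card X \<le> card ?R" using finX by (intro card_mono) auto
  also have "\<dots> \<le> card E * card Y + card E * card Y + card E * card Y + card E * card Y + card E * card Y"
    by (intro order.trans[OF card_Un_le] add_mono card_vimage_times_le inj finE Y)
  finally have "real (card X) \<le> real (5 * (card E * card Y))"
    unfolding of_nat_le_iff by simp
  hence X5: "real (card X) \<le> 5 * ?D ^ 3 * real (card E)"
    by (simp add: Y mult_ac)
  have "\<gamma> * real (card T) = (\<Sum>t\<in>T. \<gamma>)" by simp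
  also have "\<dots> \<le> (\<Sum>t\<in>T. real (card (G t)))"
  proof (rule sum_mono)
    fix t assume "t \<in> T"
    then obtain S z A B where "t = ((S, z), (A, B))" "S \<in> ?Q" "B \<in> ?Q" "z \<oplus> A \<in> L" "z \<oplus> S \<oplus> B \<in> L"
      by (auto simp: T_def)
    thus "\<gamma> \<le> real (card (G t))"
      using paths(1)[of "z \<oplus> A" "z \<oplus> S \<oplus> B" B S] by (simp add: G_def Let_def)
  qed
  also have "\<dots> = real (card X)"
    unfolding X_def using finT by (subst card_SigmaI) (auto simp: G_def Let_def)
  finally have \<gamma>T: "\<gamma> * real (card T) \<le> 5 * ?D ^ 3 * real (card E)" using X5 by linarith
  have "?D * (\<gamma> * \<beta>\<^sup>2 * (real (card (L \<inter> U)) * real (card (L - U)))) =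
        \<gamma> * (\<beta>\<^sup>2 * (?D * (real (card (L \<inter> U)) * real (card (L - U)))))" by simp
  also have "\<dots> \<le> \<gamma> * (6 * real n * 2 ^ n * real (card T))"
    by (rule mult_left_mono[OF T paths(2)])
  also have "\<dots> = 6 * real n * 2 ^ n * (\<gamma> * real (card T))" by simp
  also have "\<dots> \<le> 6 * real n * 2 ^ n * (5 * ?D ^ 3 * real (card E))"
    by (rule mult_left_mono[OF \<gamma>T]) simp
  also have "\<dots> = ?D * (30 * real n * 2 ^ n * ?D\<^sup>2 * real (card E))"
    by (simp add: power2_eq_square power3_eq_cube)
  finally show ?thesis using D by (simp add: E_def)
qed

text \<open>A path with steps \<open>I, R, I\<close> from \<open>e\<close> in \<open>U\<close> to
  \<open>e \<oplus> R\<close> outside must cross the boundary. A boundary step of \<open>r'\<close>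
  in a given position fixes one of \<open>I\<close>, \<open>R\<close> and the start, so it lies on
  at most \<open>n choose d\<close> of these paths; there are three positions.\<close>

lemma boundary_steps_comparison:
  fixes V U :: "nat set set" and r r' :: "nat set \<Rightarrow> nat set \<Rightarrow> bool"
  assumes fin: "finite U"
    and paths: "\<And>e R. R \<in> slice n d \<Longrightarrow> r e (e \<oplus> R) \<Longrightarrow>
       \<zeta> \<le> real (card {I \<in> slice n d. r' e (e \<oplus> I) \<and> r' (e \<oplus> I) (e \<oplus> I \<oplus> R) \<and> r' (e \<oplus> I \<oplus> R) (e \<oplus> R)})"
    and rV: "\<And>u v. r' u v \<Longrightarrow> u \<in> V \<and> v \<in> V"
  shows "\<zeta> * real (card (boundary_steps n d r V U)) \<le>
         3 * real (n choose d) * real (card (boundary_steps n d r' V U))"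
proof -
  let ?Q = "slice n d"
  define E E' where "E = boundary_steps n d r V U" and "E' = boundary_steps n d r' V U"
  have finE: "finite E" "finite E'" unfolding E_def E'_def by (rule finite_boundary_steps[OF fin])+
  define G where "G = (\<lambda>(e, R). {I \<in> ?Q. r' e (e \<oplus> I) \<and> r' (e \<oplus> I) (e \<oplus> I \<oplus> R) \<and> r' (e \<oplus> I \<oplus> R) (e \<oplus> R)})"
  define X where "X = Sigma E G"
  define f1 f2 f3 :: "(nat set \<times> nat set) \<times> nat set \<Rightarrow> (nat set \<times> nat set) \<times> nat set"
    where "f1 = (\<lambda>((e, R), I). ((e, I), R))"
      and "f2 = (\<lambda>((e, R), I). ((e \<oplus> I, R), I))"
      and "f3 = (\<lambda>((e, R), I). ((e \<oplus> I \<oplus> R, I), R))"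
  have inj: "inj_on f1 X" "inj_on f2 X" "inj_on f3 X"
    unfolding f1_def f2_def f3_def by (auto intro!: inj_onI)
  have finX: "finite X" unfolding X_def by (rule finite_SigmaI[OF finE(1)]) (auto simp: G_def)
  have "X \<subseteq> {t \<in> X. f1 t \<in> E' \<times> ?Q} \<union> {t \<in> X. f2 t \<in> E' \<times> ?Q} \<union> {t \<in> X. f3 t \<in> E' \<times> ?Q}"
    (is "_ \<subseteq> ?R")
  proof
    fix t assume t: "t \<in> X"
    obtain e R I where t_eq: "t = ((e, R), I)" by (metis surj_pair)
    have mem: "R \<in> ?Q" "I \<in> ?Q" "e \<in> U" "e \<oplus> R \<in> V - U"
      and rs: "r' e (e \<oplus> I)" "r' (e \<oplus> I) (e \<oplus> I \<oplus> R)" "r' (e \<oplus> I \<oplus> R) (e \<oplus> R)"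
      using t unfolding t_eq X_def E_def G_def boundary_steps_def by auto
    have e3: "e \<oplus> I \<oplus> R \<oplus> I = e \<oplus> R" by (simp add: xor_ac)
    consider "e \<oplus> I \<notin> U" | "e \<oplus> I \<in> U" "e \<oplus> I \<oplus> R \<notin> U" | "e \<oplus> I \<oplus> R \<in> U"
      by blast
    thus "t \<in> ?R"
    proof cases
      case 1
      hence "f1 t \<in> E' \<times> ?Q"
        using mem rs rV[OF rs(1)] by (auto simp: t_eq f1_def E'_def boundary_steps_def)
      thus ?thesis using t by simp
    next
      case 2
      hence "f2 t \<in> E' \<times> ?Q"
        using mem rs rV[OF rs(2)] by (auto simp: t_eq f2_def E'_def boundary_steps_def)
      thus ?thesis using t by simp
    next
      case 3
      hence "f3 t \<in> E' \<times> ?Q"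
        using mem rs by (simp add: t_eq f3_def E'_def boundary_steps_def e3)
      thus ?thesis using t by simp
    qed
  qed
  hence "card X \<le> card ?R" using finX by (intro card_mono) auto
  also have "\<dots> \<le> card E' * card ?Q + card E' * card ?Q + card E' * card ?Q"
    by (intro order.trans[OF card_Un_le] add_mono card_vimage_times_le inj finE finite_slice)
  finally have "real (card X) \<le> real (3 * (card E' * card ?Q))"
    unfolding of_nat_le_iff by simp
  hence X3: "real (card X) \<le> 3 * real (n choose d) * real (card E')"
    by (simp add: card_slice mult_ac)
  have "\<zeta> * real (card E) = (\<Sum>t\<in>E. \<zeta>)" by simp
  also have "\<dots> \<le> (\<Sum>t\<in>E. real (card (G t)))"
    by (rule sum_mono) (auto simp: E_def boundary_steps_def G_def intro!: paths)
  also have "\<dots> = real (card X)"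
    unfolding X_def using finE by (subst card_SigmaI) (auto simp: G_def)
  finally show ?thesis using X3 by (simp add: E_def E'_def)
qed

section \<open>Random vertex sets\<close>

definition random_bits :: "nat \<Rightarrow> real \<Rightarrow> (nat set \<Rightarrow> bool) pmf"
  where "random_bits n p = Pi_pmf (cube n) False (\<lambda>_. bernoulli_pmf p)"

lemma prob_random_bits_pattern:
  assumes p: "0 \<le> p" "p \<le> 1" and sub: "Pos \<subseteq> cube n" "Neg \<subseteq> cube n" and disj: "Pos \<inter> Neg = {}"
  shows "measure_pmf.prob (random_bits n p) {\<xi>. (\<forall>x\<in>Pos. \<xi> x) \<and> (\<forall>x\<in>Neg. \<not> \<xi> x)} =
         p ^ card Pos * (1 - p) ^ card Neg"
proof -
  define B where "B = (\<lambda>x. if x \<in> Pos then {True} else if x \<in> Neg then {False} else UNIV)"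
  have eq: "{\<xi>. (\<forall>x\<in>Pos. \<xi> x) \<and> (\<forall>x\<in>Neg. \<not> \<xi> x)} = Pi (cube n) B"
  proof (intro set_eqI iffI)
    fix \<xi> assume "\<xi> \<in> Pi (cube n) B"
    hence *: "\<xi> x \<in> B x" if "x \<in> cube n" for x using that by auto
    have "\<xi> x" if "x \<in> Pos" for x
      using *[of x] that sub by (auto simp: B_def)
    moreover have "\<not> \<xi> x" if "x \<in> Neg" for x
    proof -
      have "x \<in> cube n" "x \<notin> Pos" using that sub disj by auto
      thus ?thesis using *[of x] that by (simp add: B_def)
    qed
    ultimately show "\<xi> \<in> {\<xi>. (\<forall>x\<in>Pos. \<xi> x) \<and> (\<forall>x\<in>Neg. \<not> \<xi> x)}" by blast
  qed (auto simp: B_def)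
  have "measure_pmf.prob (random_bits n p) (Pi (cube n) B) =
        (\<Prod>x\<in>cube n. measure_pmf.prob (bernoulli_pmf p) (B x))"
    unfolding random_bits_def by (rule measure_Pi_pmf_Pi) simp
  also have "\<dots> = (\<Prod>x\<in>cube n. (if x \<in> Pos then p else 1) * (if x \<in> Neg then 1 - p else 1))"
    using p disj by (intro prod.cong) (auto simp: B_def measure_pmf_single)
  also have "\<dots> = p ^ card Pos * (1 - p) ^ card Neg"
    using sub by (simp add: prod.distrib prod.If_cases Int_absorb1 Int_absorb2 Int_def[symmetric])
  finally show ?thesis by (simp add: eq)
qed

lemma card_fiber_le_1:
  assumes "inj_on f X"
  shows "card {i \<in> X. f i = v} \<le> 1"
proof -
  have "i = j" if "i \<in> {i \<in> X. f i = v}" "j \<in> {i \<in> X. f i = v}" for i j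
    using that assms by (auto simp: inj_on_def)
  moreover have "card {i \<in> X. f i = v} \<le> 1" if "infinite {i \<in> X. f i = v}"
    unfolding card.infinite[OF that] by simp
  ultimately show ?thesis
    using card_le_Suc0_iff_eq[of "{i \<in> X. f i = v}"] unfolding One_nat_def by blast
qed

text \<open>For counting the \<open>d\<close>-sets \<open>I\<close> whose subcube contains a given
  bit at level at least 2. Retaining two elements of \<open>Z\<close> already gives the gain of
  order d^2/n^2 over \<open>n choose d\<close>.\<close>

lemma card_supersets_le:
  assumes "2 \<le> card Z"
  shows "card {I \<in> slice n d. Z \<subseteq> I} \<le> (n - 2) choose (d - 2)"
proof (cases "Z \<subseteq> {..<n}")
  case True
  obtain Y where Y: "Y \<subseteq> Z" "card Y = 2" "finite Y"
    using obtain_subset_with_card_n[OF assms] by blast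
  have "card {I \<in> slice n d. Z \<subseteq> I} \<le> card {I. I \<subseteq> {..<n} - Y \<and> card I = d - 2}"
  proof (rule card_inj_on_le[where f = "\<lambda>I. I - Y"])
    show "inj_on (\<lambda>I. I - Y) {I \<in> slice n d. Z \<subseteq> I}"
      using Y by (intro inj_onI) auto
    show "(\<lambda>I. I - Y) ` {I \<in> slice n d. Z \<subseteq> I} \<subseteq> {I. I \<subseteq> {..<n} - Y \<and> card I = d - 2}"
      using Y by (auto simp: slice_def card_Diff_subset)
  qed auto
  also have "\<dots> = card ({..<n} - Y) choose (d - 2)"
    by (rule n_subsets) simp
  also have "card ({..<n} - Y) = n - 2"
    using Y True by (subst card_Diff_subset) auto
  finally show ?thesis .
next
  case False
  hence "{I \<in> slice n d. Z \<subseteq> I} = {}" by (auto simp: slice_def)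
  thus ?thesis by (simp only: card.empty)
qed

lemma inj_on_xor_singleton: "inj_on (\<lambda>i. x \<oplus> {i}) X"
  by (auto simp: inj_on_def)

lemma singleton_in_cube: "i < n \<Longrightarrow> {i} \<in> cube n"
  by (simp add: cube_def)

text \<open>Given a bit \<open>v\<close>, the equation \<open>v = w \<oplus> J\<close> has one
  solution \<open>J\<close> for each \<open>w\<close>, so a bit affects at most four translates and
  the exponent is of the order of \<open>n choose d\<close>. Four is the number of inner vertices of
  a five-step path.\<close>

lemma prob_few_translates:
  assumes p: "0 < p" "p \<le> 1" and W: "W \<subseteq> cube n" "card W \<le> 4" and d: "d \<le> n"
  shows "measure_pmf.prob (random_bits n p)
           {\<xi>. real (card {J \<in> slice n d. \<forall>w\<in>W. \<xi> (w \<oplus> J)}) \<le> 3 / 4 * p ^ 4 * real (n choose d)}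
         \<le> exp (- (p ^ 8 * real (n choose d) / 128))"
proof -
  let ?D = "real (n choose d)"
  have finW: "finite W" using W finite_subset finite_cube by blast
  have D: "?D > 0" using d by simp
  define t where "t = p ^ 4 * ?D / 4"
  have "measure_pmf.prob (random_bits n p)
     {\<xi>. real (card {J \<in> slice n d. \<forall>w\<in>W. \<xi> (w \<oplus> J)}) \<le> p ^ 4 * real (card (slice n d)) - t}
    \<le> exp (- (2 * t\<^sup>2 / (real (card (slice n d)) * 4 * 4)))"
    unfolding random_bits_def
  proof (rule counting_lower_tail[where B = "\<lambda>J. (\<lambda>w. w \<oplus> J) ` W"])
    show "slice n d \<noteq> {}" using D card_slice[of n d] by auto
    show "t > 0" using D p by (simp add: t_def)
    show "finite ((\<lambda>w. w \<oplus> J) ` W) \<and> real (card ((\<lambda>w. w \<oplus> J) ` W)) \<le> 4" for J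
      using card_image_le[OF finW, of "\<lambda>w. w \<oplus> J"] W finW by auto
    show "real (card {J \<in> slice n d. v \<in> (\<lambda>w. w \<oplus> J) ` W}) \<le> 4" for v
    proof -
      have "{J \<in> slice n d. v \<in> (\<lambda>w. w \<oplus> J) ` W} \<subseteq> (\<lambda>w. w \<oplus> v) ` W"
      proof
        fix J assume "J \<in> {J \<in> slice n d. v \<in> (\<lambda>w. w \<oplus> J) ` W}"
        then obtain w where "w \<in> W" "J = w \<oplus> v" by auto
        thus "J \<in> (\<lambda>w. w \<oplus> v) ` W" by blast
      qed
      hence "card {J \<in> slice n d. v \<in> (\<lambda>w. w \<oplus> J) ` W} \<le> card W"
        using finW by (meson card_image_le card_mono finite_imageI le_trans)
      thus ?thesis using W by linarith
    qed
    fix J assume J: "J \<in> slice n d"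
    have "p ^ 4 \<le> p ^ card W" using p W by (intro power_decreasing) auto
    also have "card W = card ((\<lambda>w. w \<oplus> J) ` W)"
      by (rule card_image[symmetric]) (auto simp: inj_on_def)
    also have "p ^ card ((\<lambda>w. w \<oplus> J) ` W) =
      measure_pmf.prob (random_bits n p) {\<xi>. (\<forall>x\<in>(\<lambda>w. w \<oplus> J) ` W. \<xi> x) \<and> (\<forall>x\<in>{}. \<not> \<xi> x)}"
      using p W J by (subst prob_random_bits_pattern) (auto intro!: xor_in_cube slice_cubeD[OF J])
    finally show "p ^ 4 \<le> measure_pmf.prob (Pi_pmf (cube n) False (\<lambda>_. bernoulli_pmf p)) {\<xi>. \<forall>w\<in>W. \<xi> (w \<oplus> J)}"
      by (simp add: random_bits_def)
  qed auto
  also have "p ^ 4 * real (card (slice n d)) - t = 3 / 4 * p ^ 4 * ?D"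
    by (simp add: t_def card_slice)
  also have "2 * t\<^sup>2 / (real (card (slice n d)) * 4 * 4) = p ^ 8 * ?D / 128"
    using D by (simp add: t_def card_slice field_simps power2_eq_square flip: power_add)
  finally show ?thesis .
qed

text \<open>At least half of \<open>N\<close> lies outside \<open>J\<close>, and each direction
  there is missing at both points with probability at least
  \<open>\<epsilon>\<^sup>2 \<ge> 4 * \<eta>\<close>. The mean is therefore at least
  \<open>2 * \<eta> * card N\<close>, twice the threshold. The points \<open>w\<close> and
  \<open>w'\<close> may coincide.\<close>

lemma prob_few_common_nonneighbours:
  assumes p: "0 \<le> p" "p \<le> 1 - \<epsilon>" and \<epsilon>: "0 < \<epsilon>" and \<eta>: "0 < \<eta>" "\<eta> \<le> \<epsilon>\<^sup>2 / 4"
    and w: "w \<in> cube n" "w' \<in> cube n" and N: "N \<subseteq> {..<n}" "\<eta> * real n \<le> real (card N)"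
    and d: "2 * real d \<le> \<eta> * real n" and J: "J \<in> slice n d" and n: "0 < n"
  shows "measure_pmf.prob (random_bits n p)
           {\<xi>. real (card {i \<in> N - J. \<not> \<xi> (w \<oplus> J \<oplus> {i}) \<and> \<not> \<xi> (w' \<oplus> J \<oplus> {i})}) < \<eta> * real (card N)}
         \<le> exp (- (\<eta> ^ 3 * real n / 2))"
proof -
  have finN: "finite N" using N finite_subset by blast
  have finJ: "finite J" "card J = d" using J finite_subset by (auto simp: slice_def)
  define M where "M = real (card (N - J))"
  have cN: "real (card N) > 0" using N \<eta> n by (smt (verit) mult_pos_pos of_nat_0_less_iff)
  have "real (card N) - real d \<le> M"
    unfolding M_def using diff_card_le_card_Diff[OF finJ(1), of N] finJ by linarith
  hence M: "M \<ge> real (card N) / 2" using d N by linarith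
  have M': "M \<le> real (card N)" unfolding M_def using finN by (simp add: card_mono)
  have M0: "M > 0" using M cN by linarith
  have p1: "p \<le> 1" using p \<epsilon> by linarith
  define t where "t = \<eta> * real (card N)"
  have t: "t > 0" using cN \<eta> by (simp add: t_def)
  have "measure_pmf.prob (random_bits n p)
     {\<xi>. real (card {i \<in> N - J. \<not> \<xi> (w \<oplus> J \<oplus> {i}) \<and> \<not> \<xi> (w' \<oplus> J \<oplus> {i})}) \<le> (1 - p)\<^sup>2 * real (card (N - J)) - t}
    \<le> exp (- (2 * t\<^sup>2 / (real (card (N - J)) * 2 * 2)))"
    unfolding random_bits_def
  proof (rule counting_lower_tail[where B = "\<lambda>i. {w \<oplus> J \<oplus> {i}, w' \<oplus> J \<oplus> {i}}"])
    show "N - J \<noteq> {}" using M0 unfolding M_def by (metis card.empty less_irrefl of_nat_0)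
    show "real (card {i \<in> N - J. v \<in> {w \<oplus> J \<oplus> {i}, w' \<oplus> J \<oplus> {i}}}) \<le> 2" for v
    proof -
      have "{i \<in> N - J. v \<in> {w \<oplus> J \<oplus> {i}, w' \<oplus> J \<oplus> {i}}} =
         {i \<in> N - J. w \<oplus> J \<oplus> {i} = v} \<union> {i \<in> N - J. w' \<oplus> J \<oplus> {i} = v}" by auto
      also have "card \<dots> \<le> 1 + 1"
        by (intro order.trans[OF card_Un_le] add_mono card_fiber_le_1 inj_on_xor_singleton)
      finally show ?thesis by simp
    qed
    show "finite {w \<oplus> J \<oplus> {i}, w' \<oplus> J \<oplus> {i}} \<and> real (card {w \<oplus> J \<oplus> {i}, w' \<oplus> J \<oplus> {i}}) \<le> 2" for i
      by (auto simp: card_insert_if)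
    fix i assume i: "i \<in> N - J"
    let ?W = "{w \<oplus> J \<oplus> {i}, w' \<oplus> J \<oplus> {i}}"
    have "(1 - p)\<^sup>2 \<le> (1 - p) ^ card ?W"
      using p p1 by (intro power_decreasing) (auto simp: card_insert_if)
    also have "\<dots> = measure_pmf.prob (random_bits n p) {\<xi>. (\<forall>x\<in>{}. \<xi> x) \<and> (\<forall>x\<in>?W. \<not> \<xi> x)}"
      using p p1 w J i N by (subst prob_random_bits_pattern) (auto intro!: xor_in_cube slice_cubeD[OF J] singleton_in_cube)
    finally show "(1 - p)\<^sup>2 \<le> measure_pmf.prob (Pi_pmf (cube n) False (\<lambda>_. bernoulli_pmf p))
        {\<xi>. \<not> \<xi> (w \<oplus> J \<oplus> {i}) \<and> \<not> \<xi> (w' \<oplus> J \<oplus> {i})}"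
      by (simp add: random_bits_def)
  qed (use finN t in auto)
  also have "\<dots> \<le> exp (- (\<eta> ^ 3 * real n / 2))"
  proof -
    have "\<eta> ^ 3 * real n / 2 = \<eta>\<^sup>2 * (\<eta> * real n) / 2" by (simp add: power2_eq_square power3_eq_cube)
    also have "\<dots> \<le> \<eta>\<^sup>2 * real (card N) / 2"
      using N by (intro divide_right_mono mult_left_mono) auto
    also have "\<dots> = \<eta>\<^sup>2 * real (card N) * (real (card N) / M) * (M / real (card N)) / 2"
      using M0 cN by simp
    also have "\<dots> \<le> \<eta>\<^sup>2 * real (card N) * (real (card N) / M) * 1 / 2"
      using M0 cN M' by (intro divide_right_mono mult_left_mono) auto
    also have "\<dots> = 2 * t\<^sup>2 / (real (card (N - J)) * 2 * 2)"
      by (simp add: t_def M_def power2_eq_square field_simps)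
    finally show ?thesis by simp
  qed
  finally have *: "measure_pmf.prob (random_bits n p)
     {\<xi>. real (card {i \<in> N - J. \<not> \<xi> (w \<oplus> J \<oplus> {i}) \<and> \<not> \<xi> (w' \<oplus> J \<oplus> {i})}) \<le> (1 - p)\<^sup>2 * real (card (N - J)) - t}
    \<le> exp (- (\<eta> ^ 3 * real n / 2))" .
  have "\<epsilon>\<^sup>2 \<le> (1 - p)\<^sup>2" using p \<epsilon> by (intro power_mono) auto
  hence "4 * \<eta> \<le> (1 - p)\<^sup>2" using \<eta> by linarith
  hence "4 * \<eta> * (real (card N) / 2) \<le> (1 - p)\<^sup>2 * M"
    using M \<eta> by (intro mult_mono) auto
  hence le: "\<eta> * real (card N) \<le> (1 - p)\<^sup>2 * real (card (N - J)) - t"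
    by (simp add: t_def M_def)
  show ?thesis
    by (rule order.trans[OF measure_pmf.finite_measure_mono *]) (use le in auto)
qed

text \<open>Two concentrations are nested. A single \<open>J\<close> fails with probability
  exponentially small in \<open>\<eta> ^ 3 * n\<close>, which cannot beat a union over points and
  sets \<open>N\<close>. So a share \<open>\<delta>\<close> of failing \<open>J\<close> is
  tolerated, and the number of failures is concentrated once more, now with an exponent governed by
  \<open>n choose d\<close>.\<close>

lemma prob_many_exceptional_translates:
  assumes p: "0 \<le> p" "p \<le> 1 - \<epsilon>" and \<epsilon>: "0 < \<epsilon>" and \<eta>: "0 < \<eta>" "\<eta> \<le> \<epsilon>\<^sup>2 / 4"
    and w: "w \<in> cube n" "w' \<in> cube n" and N: "N \<subseteq> {..<n}" "\<eta> * real n \<le> real (card N)"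
    and d: "2 * real d \<le> \<eta> * real n" "d \<le> n" and n: "0 < n"
    and \<delta>: "\<delta> > 0" "exp (- (\<eta> ^ 3 * real n / 2)) \<le> \<delta> / 2"
  shows "measure_pmf.prob (random_bits n p)
           {\<xi>. real (card {J \<in> slice n d. \<eta> * real (card N) \<le>
                  real (card {i \<in> N - J. \<not> \<xi> (w \<oplus> J \<oplus> {i}) \<and> \<not> \<xi> (w' \<oplus> J \<oplus> {i})})})
                \<le> (1 - \<delta>) * real (n choose d)}
         \<le> exp (- (\<delta>\<^sup>2 * real (n choose d) / (8 * real n * real (d + 1))))"
proof -
  let ?D = "real (n choose d)"
  let ?\<phi> = "\<lambda>J \<xi>. \<eta> * real (card N) \<le> real (card {i \<in> N - J. \<not> \<xi> (w \<oplus> J \<oplus> {i}) \<and> \<not> \<xi> (w' \<oplus> J \<oplus> {i})})"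
  have finN: "finite N" using N finite_subset by blast
  have D: "?D > 0" using d by simp
  define t where "t = \<delta> * ?D / 2"
  define m c where "m = 2 * real n" and "c = 2 * real (d + 1)"
  define B where "B = (\<lambda>J. (\<lambda>i. w \<oplus> J \<oplus> {i}) ` (N - J) \<union> (\<lambda>i. w' \<oplus> J \<oplus> {i}) ` (N - J))"
  have cN: "card N \<le> n" using N card_mono[of "{..<n}" N] by simp
  have "measure_pmf.prob (random_bits n p)
     {\<xi>. real (card {J \<in> slice n d. ?\<phi> J \<xi>}) \<le> (1 - \<delta> / 2) * real (card (slice n d)) - t}
    \<le> exp (- (2 * t\<^sup>2 / (real (card (slice n d)) * m * c)))"
    unfolding random_bits_def
  proof (rule counting_lower_tail[where B = B])
    show "slice n d \<noteq> {}" using D card_slice[of n d] by auto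
    show "t > 0" using D \<delta> by (simp add: t_def)
    show "m > 0" "c > 0" using n by (auto simp: m_def c_def)
    show "finite (B J) \<and> real (card (B J)) \<le> m" for J
    proof -
      have "card (B J) \<le> card (N - J) + card (N - J)"
        unfolding B_def using finN by (intro order.trans[OF card_Un_le] add_mono card_image_le) auto
      also have "card (N - J) \<le> card N" using finN by (intro card_mono) auto
      finally have "card (B J) \<le> 2 * n" using cN \<open>card (N - J) \<le> card N\<close> by linarith
      thus ?thesis using finN by (simp add: B_def m_def)
    qed
    show "real (card {J \<in> slice n d. v \<in> B J}) \<le> c" for v
    proof -
      have *: "card {J \<in> slice n d. v \<in> (\<lambda>i. x \<oplus> J \<oplus> {i}) ` (N - J)} \<le> d + 1" for x
      proof (cases "{J \<in> slice n d. v \<in> (\<lambda>i. x \<oplus> J \<oplus> {i}) ` (N - J)} = {}")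
        case False
        \<comment> \<open>Because \<open>i\<close> avoids \<open>J\<close>, the bit \<open>v\<close>
          determines the set \<open>insert i J\<close> of size \<open>d + 1\<close>, and
          \<open>J\<close> arises from it by deleting one element: at most \<open>d + 1\<close>
          choices for each of \<open>w\<close> and \<open>w'\<close>.\<close>
        have eq: "v \<oplus> x = insert i J" if "i \<notin> J" "v = x \<oplus> J \<oplus> {i}" for i J
        proof -
          have "v \<oplus> x = J \<oplus> {i}" by (simp add: that(2) xor_ac)
          also have "\<dots> = insert i J" using that(1) by (auto simp: xor_def)
          finally show ?thesis .
        qed
        obtain J i where J: "J \<in> slice n d" "i \<notin> J" "v = x \<oplus> J \<oplus> {i}" using False by blast
        have fin: "finite (v \<oplus> x)" "card (v \<oplus> x) = d + 1"
          using eq[OF J(2,3)] J finite_subset[of J "{..<n}"] by (auto simp: slice_def)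
        have "{J \<in> slice n d. v \<in> (\<lambda>i. x \<oplus> J \<oplus> {i}) ` (N - J)} \<subseteq> (\<lambda>i. (v \<oplus> x) - {i}) ` (v \<oplus> x)"
        proof
          fix J assume "J \<in> {J \<in> slice n d. v \<in> (\<lambda>i. x \<oplus> J \<oplus> {i}) ` (N - J)}"
          then obtain i where "i \<notin> J" "v = x \<oplus> J \<oplus> {i}" by blast
          from eq[OF this] this(1) have "J = (v \<oplus> x) - {i}" "i \<in> v \<oplus> x" by auto
          thus "J \<in> (\<lambda>i. (v \<oplus> x) - {i}) ` (v \<oplus> x)" by blast
        qed
        from card_mono[OF finite_imageI[OF fin(1)] this] show ?thesis
          using card_image_le[OF fin(1), of "\<lambda>i. (v \<oplus> x) - {i}"] fin(2) by linarith
      qed (simp only: card.empty)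
      have "{J \<in> slice n d. v \<in> B J} = {J \<in> slice n d. v \<in> (\<lambda>i. w \<oplus> J \<oplus> {i}) ` (N - J)} \<union>
          {J \<in> slice n d. v \<in> (\<lambda>i. w' \<oplus> J \<oplus> {i}) ` (N - J)}" by (auto simp: B_def)
      also have "card \<dots> \<le> (d + 1) + (d + 1)"
        by (intro order.trans[OF card_Un_le] add_mono *)
      finally show ?thesis by (simp add: c_def)
    qed
    fix J assume J: "J \<in> slice n d"
    show "?\<phi> J (\<xi>(v := b)) = ?\<phi> J \<xi>" if v: "v \<notin> B J" for \<xi> v b
    proof -
      have "{i \<in> N - J. \<not> (\<xi>(v := b)) (w \<oplus> J \<oplus> {i}) \<and> \<not> (\<xi>(v := b)) (w' \<oplus> J \<oplus> {i})} =
            {i \<in> N - J. \<not> \<xi> (w \<oplus> J \<oplus> {i}) \<and> \<not> \<xi> (w' \<oplus> J \<oplus> {i})}"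
        using v by (auto simp: B_def)
      thus ?thesis by simp
    qed
    have "measure_pmf.prob (random_bits n p) {\<xi>. \<not> ?\<phi> J \<xi>} \<le> \<delta> / 2"
      using prob_few_common_nonneighbours[OF p \<epsilon> \<eta> w N d(1) J n] \<delta> by (simp add: not_le)
    moreover have "measure_pmf.prob (random_bits n p) {\<xi>. \<not> ?\<phi> J \<xi>} =
        1 - measure_pmf.prob (random_bits n p) {\<xi>. ?\<phi> J \<xi>}"
      using measure_pmf.prob_compl[of "{\<xi>. ?\<phi> J \<xi>}" "random_bits n p"]
      by (simp add: Compl_eq_Diff_UNIV[symmetric] Collect_neg_eq)
    ultimately show "1 - \<delta> / 2 \<le> measure_pmf.prob (Pi_pmf (cube n) False (\<lambda>_. bernoulli_pmf p)) {\<xi>. ?\<phi> J \<xi>}"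
      by (simp add: random_bits_def)
  qed auto
  also have "(1 - \<delta> / 2) * real (card (slice n d)) - t = (1 - \<delta>) * ?D"
    by (simp add: t_def card_slice algebra_simps)
  also have "2 * t\<^sup>2 / (real (card (slice n d)) * m * c) = \<delta>\<^sup>2 * ?D / (8 * real n * real (d + 1))"
  proof -
    have "2 * t\<^sup>2 / (?D * (2 * real n) * (2 * e)) = \<delta>\<^sup>2 * ?D / (8 * real n * e)" if "e > 0" for e
      using D n that by (simp add: t_def field_simps power2_eq_square)
    thus ?thesis by (simp only: m_def c_def card_slice of_nat_0_less_iff add_gr_0 zero_less_one simp_thms)
  qed
  finally show ?thesis .
qed

text \<open>\<open>square_pattern\<close> lists what the levels \<open>\<ge> 2\<close> above \<open>x\<close> and above \<open>x \<oplus> R\<close> must satisfy for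
  \<open>x, x \<oplus> I, x \<oplus> R \<oplus> I, x \<oplus> R\<close> to be a path of empty subcubes. Level 1 is left out: it is
  controlled by choosing \<open>I\<close> among the common non-neighbours.\<close>

definition square_interior :: "nat set \<Rightarrow> nat set \<Rightarrow> nat set \<Rightarrow> nat set set"
  where "square_interior x R I =
    (\<lambda>I'. x \<oplus> I') ` {I'. I' \<subset> I \<and> 2 \<le> card I'} \<union> (\<lambda>I'. x \<oplus> (R \<union> I')) ` {I'. I' \<subset> I \<and> 2 \<le> card I'}
    \<union> (\<lambda>R'. x \<oplus> (R' \<union> I)) ` {R'. R' \<subset> R \<and> R' \<noteq> {}}"

definition square_pattern :: "nat set \<Rightarrow> nat set \<Rightarrow> nat set \<Rightarrow> (nat set \<Rightarrow> bool) \<Rightarrow> bool"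
  where "square_pattern x R I \<xi> \<longleftrightarrow>
    \<xi> (x \<oplus> I) \<and> \<xi> (x \<oplus> (R \<union> I)) \<and> (\<forall>v\<in>square_interior x R I. \<not> \<xi> v)"

lemma card_proper_subsets:
  assumes "finite I" "card I = d" "d > 0"
  shows "card {I'. I' \<subset> I \<and> I' \<noteq> {}} = 2 ^ d - 2" "finite {I'. I' \<subset> I \<and> I' \<noteq> {}}"
proof -
  have eq: "{I'. I' \<subset> I \<and> I' \<noteq> {}} = Pow I - {I, {}}" by auto
  have "I \<noteq> {}" using assms by auto
  hence "card {I, {}} = 2" by simp
  thus "card {I'. I' \<subset> I \<and> I' \<noteq> {}} = 2 ^ d - 2"
    unfolding eq using assms by (subst card_Diff_subset) (auto simp: card_Pow)
  show "finite {I'. I' \<subset> I \<and> I' \<noteq> {}}"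
    unfolding eq using assms by simp
qed

lemma square_interior_bounds:
  assumes "finite I" "card I = d" "finite R" "card R = d" "d > 0"
  shows "finite (square_interior x R I)" "card (square_interior x R I) \<le> 3 * (2 ^ d - 2)"
proof -
  have sub: "{I'. I' \<subset> I \<and> 2 \<le> card I'} \<subseteq> {I'. I' \<subset> I \<and> I' \<noteq> {}}" by auto
  note I = card_proper_subsets[OF assms(1,2,5)]
  note R = card_proper_subsets[OF assms(3-5)]
  have fin: "finite {I'. I' \<subset> I \<and> 2 \<le> card I'}" by (rule finite_subset[OF sub I(2)])
  show "finite (square_interior x R I)"
    unfolding square_interior_def using fin R(2) by auto
  have 1: "card {I'. I' \<subset> I \<and> 2 \<le> card I'} \<le> 2 ^ d - 2"
    using card_mono[OF I(2) sub] I(1) by simp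
  have "card (square_interior x R I) \<le> (2 ^ d - 2) + (2 ^ d - 2) + (2 ^ d - 2)"
    unfolding square_interior_def
    by (intro order.trans[OF card_Un_le] add_mono order.trans[OF card_image_le] fin 1 R(2) eq_refl R(1))
  thus "card (square_interior x R I) \<le> 3 * (2 ^ d - 2)" by simp
qed

lemma square_interior_subset_cube:
  assumes "x \<in> cube n" "R \<in> slice n d" "I \<in> slice n d"
  shows "square_interior x R I \<subseteq> cube n"
proof -
  have "I' \<in> cube n" "R \<union> I' \<in> cube n" if "I' \<subset> I" for I'
    using that assms by (auto simp: cube_def slice_def)
  moreover have "R' \<union> I \<in> cube n" if "R' \<subset> R" for R'
    using that assms by (auto simp: cube_def slice_def)
  ultimately show ?thesis
    using assms(1) by (auto simp: square_interior_def intro!: xor_in_cube)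
qed

text \<open>Disjointness of \<open>R\<close> and \<open>I\<close> separates the points required in
  \<open>V\<close> from those required outside. Two bits have to be present and at most
  \<open>3 * (2 ^ d - 2)\<close> absent; \<open>p\<^sup>2\<close> is relaxed to \<open>p ^ 3\<close>
  to reach a pure power of the edge probability.\<close>

lemma prob_square_pattern:
  assumes p: "0 \<le> p" "p \<le> 1" and x: "x \<in> cube n" and R: "R \<in> slice n d" and I: "I \<in> slice n d"
    and disj: "R \<inter> I = {}" and d: "d > 0"
  shows "(p * (1 - p) ^ (2 ^ d - 2)) ^ 3 \<le> measure_pmf.prob (random_bits n p) {\<xi>. square_pattern x R I \<xi>}"
proof -
  have fin: "finite I" "card I = d" "finite R" "card R = d" "R \<subseteq> {..<n}" "I \<subseteq> {..<n}"
    using R I finite_subset by (auto simp: slice_def)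
  have R0: "R \<noteq> {}" "I \<noteq> {}" using fin d by auto
  let ?Pos = "{x \<oplus> I, x \<oplus> (R \<union> I)}" and ?Neg = "square_interior x R I"
  have "x \<oplus> I \<notin> ?Neg"
  proof
    assume "x \<oplus> I \<in> ?Neg"
    hence "(\<exists>I'. I' \<subset> I \<and> I = I') \<or> (\<exists>I'. I = R \<union> I') \<or> (\<exists>R'. R' \<subseteq> R \<and> R' \<noteq> {} \<and> I = R' \<union> I)"
      by (simp add: square_interior_def image_iff) blast
    thus False using disj R0 by blast
  qed
  moreover have "x \<oplus> (R \<union> I) \<notin> ?Neg"
  proof
    assume "x \<oplus> (R \<union> I) \<in> ?Neg"
    hence "(\<exists>I'. I' \<subset> I \<and> R \<union> I = I') \<or> (\<exists>I'. I' \<subset> I \<and> R \<union> I = R \<union> I') \<or> (\<exists>R'. R' \<subset> R \<and> R \<union> I = R' \<union> I)"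
      by (simp add: square_interior_def image_iff) blast
    thus False using disj R0 by blast
  qed
  ultimately have disj': "?Pos \<inter> ?Neg = {}" by blast
  have sub: "?Pos \<subseteq> cube n" "?Neg \<subseteq> cube n"
    using square_interior_subset_cube[OF x R I] xor_in_cube[OF x, of I] xor_in_cube[OF x, of "R \<union> I"] fin
    by (auto simp: cube_def)
  have "(p * (1 - p) ^ (2 ^ d - 2)) ^ 3 = p ^ 3 * (1 - p) ^ (3 * (2 ^ d - 2))"
    by (simp add: power_mult_distrib power_mult [symmetric] mult.commute)
  also have "\<dots> \<le> p ^ card ?Pos * (1 - p) ^ card ?Neg"
    using p square_interior_bounds[OF fin(1-4) d, of x]
    by (intro mult_mono power_decreasing) (auto simp: card_insert_if)
  also have "\<dots> = measure_pmf.prob (random_bits n p) {\<xi>. (\<forall>x\<in>?Pos. \<xi> x) \<and> (\<forall>x\<in>?Neg. \<not> \<xi> x)}"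
    by (rule prob_random_bits_pattern[OF p sub disj', symmetric])
  also have "{\<xi>. (\<forall>x\<in>?Pos. \<xi> x) \<and> (\<forall>x\<in>?Neg. \<not> \<xi> x)} = {\<xi>. square_pattern x R I \<xi>}"
    by (auto simp: square_pattern_def)
  finally show ?thesis .
qed

text \<open>A bit \<open>v\<close> can affect the pattern of \<open>I\<close> only if
  \<open>I\<close> contains \<open>v \<oplus> x\<close> or \<open>(v \<oplus> x) - R\<close>, of
  size at least 2, or equals \<open>(v \<oplus> x) - R\<close>. This leaves at most
  \<open>2 * ((n - 2) choose (d - 2)) + 1\<close> sets \<open>I\<close>; level 1 would have
  contributed a larger term of order \<open>(n - 1) choose (d - 1)\<close>.\<close>

lemma prob_few_squares:
  assumes p: "0 < p" "p < 1" and x: "x \<in> cube n" and R: "R \<in> slice n d"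
    and N: "N \<subseteq> {..<n} - R" "d \<le> card N" and d: "2 \<le> d"
  defines "q \<equiv> p * (1 - p) ^ (2 ^ d - 2)"
  shows "measure_pmf.prob (random_bits n p)
           {\<xi>. real (card {I. I \<subseteq> N \<and> card I = d \<and> square_pattern x R I \<xi>}) \<le> q ^ 3 / 2 * real (card N choose d)}
         \<le> exp (- (q ^ 6 * real (card N choose d) / (18 * 2 ^ d * real ((n - 2) choose (d - 2)))))"
proof -
  define \<J> where "\<J> = {I. I \<subseteq> N \<and> card I = d}"
  have finN: "finite N" using N finite_subset by blast
  have \<J>: "finite \<J>" "card \<J> = card N choose d"
    unfolding \<J>_def using finN by (auto simp: n_subsets)
  have sub: "\<J> \<subseteq> slice n d" using N by (auto simp: \<J>_def slice_def)
  have finR: "finite R" "card R = d" "R \<subseteq> {..<n}" using R finite_subset by (auto simp: slice_def)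
  have dn: "d \<le> n" using finR card_mono[of "{..<n}" R] by simp
  let ?M = "real (card N choose d)"
  have M: "?M > 0" using N by simp
  define C where "C = real ((n - 2) choose (d - 2))"
  have C: "C \<ge> 1"
  proof -
    have "(n - 2) choose (d - 2) > 0" using dn by simp
    thus ?thesis unfolding C_def by linarith
  qed
  have q: "q > 0" using p by (simp add: q_def)
  define t where "t = q ^ 3 * ?M / 2"
  define B where "B = (\<lambda>I. {x \<oplus> I, x \<oplus> (R \<union> I)} \<union> square_interior x R I)"
  have "measure_pmf.prob (random_bits n p)
     {\<xi>. real (card {I \<in> \<J>. square_pattern x R I \<xi>}) \<le> q ^ 3 * real (card \<J>) - t}
    \<le> exp (- (2 * t\<^sup>2 / (real (card \<J>) * (3 * 2 ^ d) * (3 * C))))"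
    unfolding random_bits_def
  proof (rule counting_lower_tail[where B = B])
    show "\<J> \<noteq> {}" using M \<J> by auto
    show "t > 0" using M q by (simp add: t_def)
    show "3 * C > 0" using C by simp
    show "square_pattern x R I (\<xi>(v := b)) = square_pattern x R I \<xi>" if "v \<notin> B I" for I \<xi> v b
      using that by (auto simp: square_pattern_def B_def)
    fix I assume I: "I \<in> \<J>"
    have finI: "finite I" "card I = d" "I \<subseteq> {..<n} - R"
      using I N finN finite_subset by (auto simp: \<J>_def)
    note bd = square_interior_bounds[OF finI(1,2) finR(1,2), of x]
    have "card (B I) \<le> card {x \<oplus> I, x \<oplus> (R \<union> I)} + card (square_interior x R I)"
      unfolding B_def by (rule card_Un_le)
    also have "\<dots> \<le> 2 + 3 * (2 ^ d - 2)"
      using bd d by (intro add_mono) (auto simp: card_insert_if)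
    also have "\<dots> \<le> 3 * 2 ^ d"
      using power_increasing[of 1 d "2::nat"] d by simp
    finally have "real (card (B I)) \<le> real (3 * 2 ^ d)" by (simp only: of_nat_le_iff)
    thus "finite (B I) \<and> real (card (B I)) \<le> 3 * 2 ^ d"
      using bd d by (simp add: B_def)
    show "q ^ 3 \<le> measure_pmf.prob (Pi_pmf (cube n) False (\<lambda>_. bernoulli_pmf p)) {\<xi>. square_pattern x R I \<xi>}"
      using prob_square_pattern[OF _ _ x R, of p I] p I sub finI d
      by (auto simp: q_def random_bits_def)
  next
    fix v
    let ?A1 = "{I \<in> slice n d. 2 \<le> card (v \<oplus> x) \<and> v \<oplus> x \<subseteq> I}"
    let ?A2 = "{I \<in> slice n d. 2 \<le> card ((v \<oplus> x) - R) \<and> (v \<oplus> x) - R \<subseteq> I}"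
    have "{I \<in> \<J>. v \<in> B I} \<subseteq> ?A1 \<union> ?A2 \<union> {(v \<oplus> x) - R}"
    proof
      fix I assume "I \<in> {I \<in> \<J>. v \<in> B I}"
      hence I: "I \<in> \<J>" "v \<in> B I" by auto
      have IR: "I \<inter> R = {}" "card I = d" "I \<in> slice n d" using I N sub by (auto simp: \<J>_def)
      have eq: "v \<oplus> x = X" if "v = x \<oplus> X" for X using that by (simp add: xor_ac)
      from I(2) consider (a) I' where "v = x \<oplus> I'" "I' \<subseteq> I" "2 \<le> card I'"
        | (b) I' where "v = x \<oplus> (R \<union> I')" "I' \<subseteq> I" "2 \<le> card I'"
        | (c) R' where "v = x \<oplus> (R' \<union> I)" "R' \<subseteq> R"
        using IR d by (auto simp: B_def square_interior_def)
      thus "I \<in> ?A1 \<union> ?A2 \<union> {(v \<oplus> x) - R}"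
      proof cases
        case a
        thus ?thesis using eq[OF a(1)] IR by simp
      next
        case b
        have "(v \<oplus> x) - R = I'" using eq[OF b(1)] b(2) IR by auto
        thus ?thesis using b IR by simp
      next
        case c
        have "(v \<oplus> x) - R = I" using eq[OF c(1)] c(2) IR by auto
        thus ?thesis by simp
      qed
    qed
    hence "card {I \<in> \<J>. v \<in> B I} \<le> card (?A1 \<union> ?A2 \<union> {(v \<oplus> x) - R})"
      by (intro card_mono) auto
    also have "\<dots> \<le> ((n - 2) choose (d - 2)) + ((n - 2) choose (d - 2)) + 1"
    proof (intro order.trans[OF card_Un_le] add_mono)
      show "card ?A1 \<le> (n - 2) choose (d - 2)"
        by (cases "2 \<le> card (v \<oplus> x)") (auto intro: card_supersets_le)
      show "card ?A2 \<le> (n - 2) choose (d - 2)"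
        by (cases "2 \<le> card ((v \<oplus> x) - R)") (auto intro: card_supersets_le)
    qed auto
    finally show "real (card {I \<in> \<J>. v \<in> B I}) \<le> 3 * C"
      using C by (simp add: C_def)
  qed (auto simp: \<J>)
  also have "q ^ 3 * real (card \<J>) - t = q ^ 3 / 2 * ?M"
    by (simp add: t_def \<J>)
  also have "2 * t\<^sup>2 / (real (card \<J>) * (3 * 2 ^ d) * (3 * C)) = q ^ 6 * ?M / (18 * 2 ^ d * C)"
    using M C by (simp add: t_def \<J> field_simps power2_eq_square flip: power_add)
  finally show ?thesis by (simp add: C_def \<J>_def conj_assoc)
qed

text \<open>Taking \<open>i\<close> outside \<open>Y\<close> makes the points
  \<open>x \<oplus> {j, i}\<close> distinct, so their bits are independent. The exponent grows like
  \<open>card Y * n\<close>, hence a constant size of \<open>Y\<close> suffices against an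
  exponential union bound.\<close>

lemma prob_clustered_dead:
  assumes p: "0 \<le> p" "p \<le> 1 - \<epsilon>" and \<epsilon>: "0 < \<epsilon>" and x: "x \<in> cube n"
    and Y: "Y \<subseteq> {..<n}" "Y \<noteq> {}" "2 * card Y \<le> n"
  shows "measure_pmf.prob (random_bits n p)
           {\<xi>. real (card {(j, i) \<in> Y \<times> ({..<n} - Y). \<not> \<xi> (x \<oplus> {j, i})}) \<le> \<epsilon> * real (card Y) * real n / 4}
         \<le> exp (- (\<epsilon>\<^sup>2 * real (card Y) * real n / 4))"
proof -
  define \<J> where "\<J> = Y \<times> ({..<n} - Y)"
  have finY: "finite Y" using Y finite_subset by blast
  have fin: "finite \<J>" using finY by (simp add: \<J>_def)
  have cY: "card Y > 0" using finY Y by (simp add: card_gt_0_iff)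
  have "card \<J> = card Y * (n - card Y)"
    using Y finY by (simp add: \<J>_def card_cartesian_product card_Diff_subset)
  hence c: "real (card \<J>) = real (card Y) * (real n - real (card Y))"
    using Y by (simp add: of_nat_diff)
  have M: "real (card \<J>) \<ge> real (card Y) * (real n / 2)"
    unfolding c using Y by (intro mult_left_mono) linarith+
  have "0 < real (card Y) * (real n / 2)" using cY Y by simp
  hence M0: "real (card \<J>) > 0" using M by linarith
  define t where "t = \<epsilon> * real (card \<J>) / 2"
  have "measure_pmf.prob (random_bits n p)
     {\<xi>. real (card {k \<in> \<J>. (\<lambda>(j, i). \<not> \<xi> (x \<oplus> {j, i})) k}) \<le> \<epsilon> * real (card \<J>) - t}
    \<le> exp (- (2 * t\<^sup>2 / (real (card \<J>) * 1 * 1)))"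
    unfolding random_bits_def
  proof (rule counting_lower_tail[where B = "\<lambda>(j, i). {x \<oplus> {j, i}}"])
    show "\<J> \<noteq> {}" using M0 by auto
    show "t > 0" using M0 \<epsilon> by (simp add: t_def)
    show "real (card {k \<in> \<J>. v \<in> (case k of (j, i) \<Rightarrow> {x \<oplus> {j, i}})}) \<le> 1" for v
    proof -
      have "inj_on (\<lambda>(j, i). x \<oplus> {j, i}) \<J>"
        by (auto simp: inj_on_def \<J>_def doubleton_eq_iff)
      from card_fiber_le_1[OF this, of v] show ?thesis
        by (simp add: split_def eq_commute[of v])
    qed
    fix k assume "k \<in> \<J>"
    then obtain j i where k: "k = (j, i)" "j < n" "i < n" using Y by (auto simp: \<J>_def)
    have ji: "{j, i} \<in> cube n" using k by (simp add: cube_def)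
    have "\<epsilon> \<le> (1 - p) ^ card {x \<oplus> {j, i}}" using p by simp
    also have "\<dots> = measure_pmf.prob (random_bits n p) {\<xi>. (\<forall>v\<in>{}. \<xi> v) \<and> (\<forall>v\<in>{x \<oplus> {j, i}}. \<not> \<xi> v)}"
      using p \<epsilon> xor_in_cube[OF x ji] by (subst prob_random_bits_pattern) auto
    finally show "\<epsilon> \<le> measure_pmf.prob (Pi_pmf (cube n) False (\<lambda>_. bernoulli_pmf p))
        {\<xi>. (\<lambda>(j, i). \<not> \<xi> (x \<oplus> {j, i})) k}"
      by (simp add: random_bits_def k)
  qed (auto simp: fin)
  also have "2 * t\<^sup>2 / (real (card \<J>) * 1 * 1) = \<epsilon>\<^sup>2 * real (card \<J>) / 2"
    using M0 by (simp add: t_def field_simps power2_eq_square)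
  also have "exp (- (\<epsilon>\<^sup>2 * real (card \<J>) / 2)) \<le> exp (- (\<epsilon>\<^sup>2 * real (card Y) * real n / 4))"
    using mult_left_mono[OF M, of "\<epsilon>\<^sup>2"] by (simp add: mult_ac)
  finally have *: "measure_pmf.prob (random_bits n p)
     {\<xi>. real (card {k \<in> \<J>. (\<lambda>(j, i). \<not> \<xi> (x \<oplus> {j, i})) k}) \<le> \<epsilon> * real (card \<J>) - t}
    \<le> exp (- (\<epsilon>\<^sup>2 * real (card Y) * real n / 4))" .
  have le: "\<epsilon> * real (card Y) * real n / 4 \<le> \<epsilon> * real (card \<J>) - t"
    using mult_left_mono[OF M, of \<epsilon>] \<epsilon> by (simp add: t_def mult_ac)
  have "{k \<in> \<J>. (\<lambda>(j, i). \<not> \<xi> (x \<oplus> {j, i})) k} = {(j, i) \<in> Y \<times> ({..<n} - Y). \<not> \<xi> (x \<oplus> {j, i})}" for \<xi>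
    by (auto simp: \<J>_def)
  thus ?thesis
    using le by (intro order.trans[OF measure_pmf.finite_measure_mono *]) auto
qed

text \<open>Exponential Markov inequality for \<open>a\<close> to the number of missing neighbours,
  whose mean factors over the directions. Bounded differences would be too weak here: the bound has
  to beat \<open>2 ^ n\<close> for p just below 1/2, and the base \<open>p + (1 - p) * a\<close>
  comes as close to p as desired when \<open>a\<close> is small.\<close>

lemma prob_few_nonneighbours:
  assumes p: "0 \<le> p" "p \<le> 1" and a: "0 < a" "a < 1" and x: "x \<in> cube n"
  shows "measure_pmf.prob (random_bits n p) {\<xi>. real (card {i. i < n \<and> \<not> \<xi> (x \<oplus> {i})}) < h}
         \<le> (p + (1 - p) * a) ^ n * a powr (- h)"
proof -
  let ?S = "(\<lambda>i. x \<oplus> {i}) ` {..<n}"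
  have sub: "?S \<subseteq> cube n" using x by (auto intro!: xor_in_cube singleton_in_cube)
  define f where "f = (\<lambda>v b. if v \<in> ?S \<and> \<not> b then a else (1 :: real))"
  define g where "g = (\<lambda>\<xi>. \<Prod>v\<in>cube n. f v (\<xi> v))"
  have g: "g \<xi> = a ^ card {i. i < n \<and> \<not> \<xi> (x \<oplus> {i})}" for \<xi>
  proof -
    have "g \<xi> = (\<Prod>v\<in>{v \<in> cube n. v \<in> ?S \<and> \<not> \<xi> v}. a)"
      unfolding g_def f_def by (subst prod.inter_filter) auto
    also have "\<dots> = a ^ card {v \<in> cube n. v \<in> ?S \<and> \<not> \<xi> v}" by simp
    also have "{v \<in> cube n. v \<in> ?S \<and> \<not> \<xi> v} = (\<lambda>i. x \<oplus> {i}) ` {i. i < n \<and> \<not> \<xi> (x \<oplus> {i})}"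
      using sub by auto
    also have "card \<dots> = card {i. i < n \<and> \<not> \<xi> (x \<oplus> {i})}"
      by (rule card_image[OF inj_on_xor_singleton])
    finally show ?thesis .
  qed
  have int: "integrable (measure_pmf (bernoulli_pmf p)) k" for k :: "bool \<Rightarrow> real"
    by (rule integrable_measure_pmf_finite) (rule finite_subset[OF subset_UNIV], simp)
  have "measure_pmf.expectation (random_bits n p) g =
     (\<Prod>v\<in>cube n. measure_pmf.expectation (bernoulli_pmf p) (f v))"
    unfolding random_bits_def g_def
    by (rule expectation_prod_Pi_pmf) (use a in \<open>auto simp: f_def intro: int\<close>)
  also have "\<dots> = (\<Prod>v\<in>cube n. if v \<in> ?S then p + (1 - p) * a else 1)"
    using p by (intro prod.cong refl) (auto simp: f_def)
  also have "\<dots> = (p + (1 - p) * a) ^ card ?S"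
    using sub by (simp add: prod.If_cases Int_absorb1 flip: Int_def)
  also have "card ?S = n" by (subst card_image[OF inj_on_xor_singleton]) simp
  finally have E: "measure_pmf.expectation (random_bits n p) g = (p + (1 - p) * a) ^ n" .
  have "measure_pmf.prob (random_bits n p) {\<xi>. real (card {i. i < n \<and> \<not> \<xi> (x \<oplus> {i})}) < h} \<le>
      measure_pmf.prob (random_bits n p) {\<xi> \<in> space (measure_pmf (random_bits n p)). a powr h \<le> g \<xi>}"
    using a by (intro measure_pmf.finite_measure_mono)
      (auto simp: g powr_realpow [symmetric] intro: powr_mono')
  also have "\<dots> \<le> measure_pmf.expectation (random_bits n p) g / a powr h"
    by (rule integral_Markov_inequality_measure[where A = "{}"])
       (use a in \<open>auto simp: g random_bits_def intro: integrable_Pi_pmf\<close>)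
  finally show ?thesis by (simp add: E powr_minus field_simps)
qed

section \<open>The boundary of a set of live vertices\<close>

text \<open>Directions instead of points, so that the sets at different vertices can be
  intersected.\<close>

definition nonneighbours :: "nat \<Rightarrow> nat set set \<Rightarrow> nat set \<Rightarrow> nat set"
  where "nonneighbours n V x = {i. i < n \<and> x \<oplus> {i} \<notin> V}"

text \<open>The points of the subcube spanned by \<open>x\<close> and \<open>y\<close> are the
  \<open>x \<oplus> I\<close> with \<open>I \<subseteq> x \<oplus> y\<close>; proper nonempty
  \<open>I\<close> give its points other than \<open>x\<close> and \<open>y\<close>.\<close>

definition adjacent :: "nat \<Rightarrow> nat set set \<Rightarrow> nat set \<Rightarrow> nat set \<Rightarrow> bool"
  where "adjacent d V x y \<longleftrightarrow> x \<in> V \<and> y \<in> V \<and> card (x \<oplus> y) = d \<and>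
    (\<forall>I. I \<subset> x \<oplus> y \<and> I \<noteq> {} \<longrightarrow> x \<oplus> I \<notin> V)"

text \<open>The four points stand for the inner vertices of a path with steps
  \<open>J, B, S, A, J\<close>, all of which move with \<open>J\<close>.\<close>

definition many_translates :: "nat \<Rightarrow> nat \<Rightarrow> real \<Rightarrow> (nat set \<Rightarrow> bool) \<Rightarrow> bool"
  where "many_translates n d p \<xi> \<longleftrightarrow> (\<forall>a\<in>cube n. \<forall>b\<in>cube n. \<forall>c\<in>cube n. \<forall>e\<in>cube n.
    3 / 4 * p ^ 4 * real (n choose d) < real (card {J \<in> slice n d. \<forall>w\<in>{a, b, c, e}. \<xi> (w \<oplus> J)}))"

text \<open>At the end of a path \<open>N\<close> will be the set of missing directions there, which
  is itself random; quantifying over all large \<open>N\<close> avoids conditioning on it. For an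
  inner step \<open>N\<close> is \<open>{..<n}\<close>.\<close>

definition few_exceptional_translates :: "nat \<Rightarrow> nat \<Rightarrow> real \<Rightarrow> real \<Rightarrow> (nat set \<Rightarrow> bool) \<Rightarrow> bool"
  where "few_exceptional_translates n d \<eta> \<delta> \<xi> \<longleftrightarrow> (\<forall>w\<in>cube n. \<forall>w'\<in>cube n. \<forall>N\<in>cube n.
    \<eta> * real n \<le> real (card N) \<longrightarrow>
    (1 - \<delta>) * real (n choose d) < real (card {J \<in> slice n d. \<eta> * real (card N) \<le>
       real (card {i \<in> N - J. \<not> \<xi> (w \<oplus> J \<oplus> {i}) \<and> \<not> \<xi> (w' \<oplus> J \<oplus> {i})})}))"

text \<open>\<open>N\<close> will be the set of common missing directions at \<open>x\<close> and
  \<open>x \<oplus> R\<close>, outside \<open>R\<close>. Choosing \<open>I\<close> inside it clears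
  level 1 of both subcubes, and the pattern clears the rest.\<close>

definition many_squares :: "nat \<Rightarrow> nat \<Rightarrow> real \<Rightarrow> real \<Rightarrow> (nat set \<Rightarrow> bool) \<Rightarrow> bool"
  where "many_squares n d q \<mu> \<xi> \<longleftrightarrow> (\<forall>x\<in>cube n. \<forall>R\<in>slice n d. \<forall>N\<in>cube n.
    N \<inter> R = {} \<and> \<mu> \<le> real (card N) \<longrightarrow>
    q ^ 3 / 2 * real (card N choose d) < real (card {I. I \<subseteq> N \<and> card I = d \<and> square_pattern x R I \<xi>}))"

lemma binomial_ratio_ge:
  assumes "0 \<le> \<kappa>" "\<kappa> * real n + real d \<le> real N" "d \<le> n"
  shows "\<kappa> ^ d * real (n choose d) \<le> real (N choose d)"
proof -
  have d: "d \<le> N" using assms by (smt (verit) mult_nonneg_nonneg of_nat_0_le_iff of_nat_le_iff)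
  have "\<kappa> ^ d * real (n choose d) = (\<Prod>i<d. \<kappa> * (real (n - i) / real (d - i)))"
    by (simp only: binomial_altdef_of_nat[OF assms(3)] prod.distrib prod_constant card_lessThan atLeast0LessThan)
  also have "\<dots> \<le> (\<Prod>i<d. real (N - i) / real (d - i))"
  proof (rule prod_mono)
    fix i assume i: "i \<in> {..<d}"
    have "\<kappa> * real (n - i) \<le> \<kappa> * real n" using assms by (intro mult_left_mono) auto
    also have "\<dots> \<le> real (N - i)" using assms i d by (simp add: of_nat_diff)
    finally have "\<kappa> * real (n - i) / real (d - i) \<le> real (N - i) / real (d - i)"
      by (rule divide_right_mono) simp
    thus "0 \<le> \<kappa> * (real (n - i) / real (d - i)) \<and> \<kappa> * (real (n - i) / real (d - i)) \<le> real (N - i) / real (d - i)"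
      using assms by simp
  qed
  also have "\<dots> = real (N choose d)"
    by (simp only: binomial_altdef_of_nat[OF d] atLeast0LessThan)
  finally show ?thesis .
qed

lemma card_Int_ge:
  assumes "finite Q" "A \<subseteq> Q" "a \<le> real (card A)" "real (card Q) - b \<le> real (card {x \<in> Q. P x})"
  shows "a - b \<le> real (card {x \<in> A. P x})"
proof -
  have fin: "finite A" using assms finite_subset by blast
  have "card A + card {x \<in> Q. P x} = card (A \<union> {x \<in> Q. P x}) + card (A \<inter> {x \<in> Q. P x})"
    using assms fin by (intro card_Un_Int) auto
  moreover have "card (A \<union> {x \<in> Q. P x}) \<le> card Q" using assms by (intro card_mono) auto
  moreover have "A \<inter> {x \<in> Q. P x} = {x \<in> A. P x}" using assms by auto
  ultimately show ?thesis using assms by simp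
qed

text \<open>Singletons \<open>I'\<close> at \<open>e\<close> and at \<open>e \<oplus> R\<close> are
  excluded from \<open>V\<close> by the choice of \<open>I\<close> among missing directions, larger
  proper subsets by the pattern. The subcube of the middle edge is cleared by the pattern
  alone.\<close>

lemma square_pattern_path:
  assumes V: "V = {x \<in> cube n. \<xi> x}" and e: "e \<in> V" "e \<oplus> R \<in> V" and R: "R \<in> slice n d" and I: "I \<in> slice n d"
    and N: "I \<subseteq> nonneighbours n V e" "I \<subseteq> nonneighbours n V (e \<oplus> R)" and disj: "I \<inter> R = {}"
    and pat: "square_pattern e R I \<xi>"
  shows "adjacent d V e (e \<oplus> I)" "adjacent d V (e \<oplus> I) (e \<oplus> I \<oplus> R)" "adjacent d V (e \<oplus> I \<oplus> R) (e \<oplus> R)"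
proof -
  have eq: "a \<oplus> b = a \<union> b" if "a \<inter> b = {}" for a b :: "nat set" using that by (auto simp: xor_def)
  have cu: "R \<in> cube n" "I \<in> cube n" "e \<in> cube n" using R I e V by (auto intro: slice_cubeD)
  have cards: "card R = d" "card I = d" using R I by (auto simp: slice_def)
  have finI: "finite I" using I finite_subset by (auto simp: slice_def)
  have eRI: "e \<oplus> I \<oplus> R = e \<oplus> (R \<union> I)"
    using eq[of R I] disj by (simp add: xor_assoc xor_commute[of I R] Int_commute)
  have IV: "e \<oplus> I \<in> V" using pat cu by (auto simp: V square_pattern_def intro: xor_in_cube)
  have RIV: "e \<oplus> I \<oplus> R \<in> V" unfolding eRI
    using pat cu by (auto simp: V square_pattern_def intro!: xor_in_cube) (auto simp: cube_def)
  have int: "v \<notin> V" if "v \<in> square_interior e R I" for v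
    using pat that by (auto simp: V square_pattern_def)
  have one: "\<exists>i. I' = {i}" if "I' \<subseteq> I" "I' \<noteq> {}" "\<not> 2 \<le> card I'" for I'
  proof -
    have "finite I'" using that finI finite_subset by blast
    hence "card I' > 0" using that(2) by (simp add: card_gt_0_iff)
    hence "card I' = 1" using that(3) by linarith
    thus ?thesis by (simp add: card_1_singleton_iff)
  qed
  have low: "e \<oplus> I' \<notin> V" if "I' \<subset> I" "I' \<noteq> {}" for I'
  proof (cases "2 \<le> card I'")
    case True
    thus ?thesis using that by (intro int) (auto simp: square_interior_def)
  next
    case False
    with one that obtain i where "I' = {i}" by (meson psubset_imp_subset)
    thus ?thesis using that N by (auto simp: nonneighbours_def)
  qed
  have high: "e \<oplus> (R \<union> I') \<notin> V" if "I' \<subset> I" "I' \<noteq> {}" for I'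
  proof (cases "2 \<le> card I'")
    case True
    thus ?thesis using that by (intro int) (auto simp: square_interior_def)
  next
    case False
    with one that obtain i where i: "I' = {i}" by (meson psubset_imp_subset)
    have "e \<oplus> R \<oplus> {i} = e \<oplus> (R \<union> I')"
      using eq[of R "{i}"] that disj by (auto simp: i xor_assoc)
    thus ?thesis using that N i by (auto simp: nonneighbours_def)
  qed
  show "adjacent d V e (e \<oplus> I)"
    unfolding adjacent_def using e IV cards low by simp
  have "e \<oplus> I \<oplus> R' \<notin> V" if "R' \<subset> R" "R' \<noteq> {}" for R'
  proof -
    have "e \<oplus> I \<oplus> R' = e \<oplus> (R' \<union> I)"
      using eq[of R' I] that disj by (auto simp: xor_assoc xor_commute[of I R'])
    thus ?thesis using that by (auto intro!: int simp: square_interior_def)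
  qed
  thus "adjacent d V (e \<oplus> I) (e \<oplus> I \<oplus> R)"
    unfolding adjacent_def using IV RIV cards by simp
  have diff: "e \<oplus> I \<oplus> R \<oplus> (e \<oplus> R) = I" by (simp add: xor_ac)
  \<comment> \<open>The last subcube is read from its other end \<open>e \<oplus> R\<close>:
    complementing \<open>I'\<close> in \<open>I\<close> reduces the claim to
    \<open>high\<close>.\<close>
  have "e \<oplus> I \<oplus> R \<oplus> I' \<notin> V" if "I' \<subset> I" "I' \<noteq> {}" for I'
  proof -
    have "(R \<union> I) \<oplus> I' = R \<union> (I - I')" using that disj by (auto simp: xor_def)
    hence "e \<oplus> I \<oplus> R \<oplus> I' = e \<oplus> (R \<union> (I - I'))" unfolding eRI by (simp add: xor_assoc)
    moreover have "I - I' \<subset> I" "I - I' \<noteq> {}" using that by auto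
    ultimately show ?thesis using high[of "I - I'"] by simp
  qed
  thus "adjacent d V (e \<oplus> I \<oplus> R) (e \<oplus> R)"
    unfolding adjacent_def diff using RIV e cards by simp
qed

text \<open>The relation \<open>r\<close> of good pairs separates two tasks: the five-step paths
  have to secure common missing directions at consecutive vertices only, and empty subcubes enter
  through the squares over each good pair.\<close>

lemma edge_boundary_lower_bound:
  fixes \<xi> :: "nat set \<Rightarrow> bool"
  assumes V: "V = {x \<in> cube n. \<xi> x}" and L: "L = {x \<in> V. \<eta> * real n \<le> real (card (nonneighbours n V x))}"
    and ev: "many_translates n d p \<xi>" "few_exceptional_translates n d \<eta> (p ^ 4 / 20) \<xi>"
      "many_squares n d q (\<eta>\<^sup>2 * real n / 2) \<xi>"
    and p: "0 < p" and q: "0 \<le> q" and \<eta>: "0 < \<eta>" "\<eta> \<le> 1"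
    and d: "odd d" "2 * d \<le> n" "real d \<le> \<eta>\<^sup>2 * real n / 4" and U: "U \<subseteq> V"
  shows "q ^ 3 * p ^ 12 * (\<eta>\<^sup>2 / 4) ^ d * real (n choose d) * (real (card (L \<inter> U)) * real (card (L - U)))
         \<le> 1440 * real n * 2 ^ n * real (card (boundary_steps n d (adjacent d V) V U))"
proof -
  let ?D = "real (n choose d)" and ?Q = "slice n d"
  let ?N = "nonneighbours n V"
  define \<kappa> where "\<kappa> = \<eta>\<^sup>2"
  have D: "?D > 0" using d by simp
  have Vc: "V \<subseteq> cube n" using V by auto
  have finV: "finite V" using Vc finite_subset finite_cube by blast
  have LV: "L \<subseteq> V" using L by auto
  have Nc: "?N x \<in> cube n" for x by (auto simp: nonneighbours_def cube_def)
  have finN: "finite (?N x)" for x using Nc[of x] finite_subset by (auto simp: cube_def)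
  have full: "{..<n} \<in> cube n" by (simp add: cube_def)
  \<comment> \<open>The share is \<open>\<eta>\<^sup>2\<close> because at an end of the path the
    common directions are a share \<open>\<eta>\<close> of the at least \<open>\<eta> * n\<close>
    directions missing there. Inner steps even reach \<open>\<eta> * n\<close>.\<close>
  define r where "r = (\<lambda>u v. u \<in> V \<and> v \<in> V \<and> \<kappa> * real n \<le> real (card (?N u \<inter> ?N v)))"
  have \<kappa>\<eta>: "\<kappa> * real n \<le> \<eta> * real n"
    unfolding \<kappa>_def power2_eq_square using \<eta> by (intro mult_right_mono) (auto simp: mult_left_le)
  \<comment> \<open>The half is 3/4 - 5/20: \<open>p ^ 4 / 20\<close> is the tolerated share of
    exceptional \<open>J\<close>, removed once for each of the five steps.\<close>
  define \<beta> where "\<beta> = p ^ 4 * ?D / 2"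
  have \<beta>: "\<beta> > 0" using p D by (simp add: \<beta>_def)
  define \<phi> where "\<phi> = (\<lambda>w w' N J. \<eta> * real (card N) \<le>
       real (card {i \<in> N - J. \<not> \<xi> (w \<oplus> J \<oplus> {i}) \<and> \<not> \<xi> (w' \<oplus> J \<oplus> {i})}))"
  have \<phi>: "real (card ?Q) - p ^ 4 / 20 * ?D \<le> real (card {J \<in> ?Q. \<phi> w w' N J})"
    if "w \<in> cube n" "w' \<in> cube n" "N \<in> cube n" "\<eta> * real n \<le> real (card N)" for w w' N
    using ev(2) that unfolding few_exceptional_translates_def \<phi>_def
    by (fastforce simp: card_slice algebra_simps)
  have \<phi>D: "\<eta> * real (card N) \<le> real (card (N \<inter> ?N (w \<oplus> J) \<inter> ?N (w' \<oplus> J)))"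
    if "\<phi> w w' N J" "w \<in> cube n" "w' \<in> cube n" "J \<in> ?Q" "N \<in> cube n" for w w' N J
  proof -
    have "w \<oplus> J \<oplus> {i} \<in> cube n" "w' \<oplus> J \<oplus> {i} \<in> cube n" if "i < n" for i
      using that \<open>w \<in> cube n\<close> \<open>w' \<in> cube n\<close> slice_cubeD[OF \<open>J \<in> ?Q\<close>]
      by (auto intro!: xor_in_cube singleton_in_cube)
    hence "{i \<in> N - J. \<not> \<xi> (w \<oplus> J \<oplus> {i}) \<and> \<not> \<xi> (w' \<oplus> J \<oplus> {i})} \<subseteq> N \<inter> ?N (w \<oplus> J) \<inter> ?N (w' \<oplus> J)"
      using \<open>N \<in> cube n\<close> by (auto simp: nonneighbours_def cube_def V)
    hence "card {i \<in> N - J. \<not> \<xi> (w \<oplus> J \<oplus> {i}) \<and> \<not> \<xi> (w' \<oplus> J \<oplus> {i})} \<le> card (N \<inter> ?N (w \<oplus> J) \<inter> ?N (w' \<oplus> J))"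
      using finN by (intro card_mono) auto
    thus ?thesis using that(1) unfolding \<phi>_def by linarith
  qed
  have full_card: "\<eta> * real n \<le> real (card {..<n})" using mult_right_mono[OF \<eta>(2), of "real n"] by simp
  have full_Int: "{..<n} \<inter> ?N x = ?N x" for x by (auto simp: nonneighbours_def)
  have translates: "3 / 4 * p ^ 4 * ?D \<le> real (card {J \<in> ?Q. \<forall>w\<in>{a, b, c, e}. \<xi> (w \<oplus> J)})"
    if "a \<in> cube n" "b \<in> cube n" "c \<in> cube n" "e \<in> cube n" for a b c e
    using ev(1)[unfolded many_translates_def, rule_format, OF that] by (rule less_imp_le)

  have 1: "\<beta> * \<beta>\<^sup>2 * (real (card (L \<inter> U)) * real (card (L - U))) \<le>
         30 * real n * 2 ^ n * ?D\<^sup>2 * real (card (boundary_steps n d r V U))"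
  proof (rule boundary_steps_lower_bound[OF Vc U LV])
    show "\<beta> \<le> real (card {A \<in> ?Q. z \<oplus> A \<in> L})" if z: "z \<in> cube n" for z
    proof -
      have "3 / 4 * p ^ 4 * ?D - p ^ 4 / 20 * ?D \<le> real (card {J \<in> {J \<in> ?Q. \<forall>w\<in>{z, z, z, z}. \<xi> (w \<oplus> J)}. \<phi> z z {..<n} J})"
        by (rule card_Int_ge[OF _ _ translates \<phi>]) (use z full full_card in auto)
      moreover have "{J \<in> {J \<in> ?Q. \<forall>w\<in>{z, z, z, z}. \<xi> (w \<oplus> J)}. \<phi> z z {..<n} J} \<subseteq> {A \<in> ?Q. z \<oplus> A \<in> L}"
      proof
        fix J assume J: "J \<in> {J \<in> {J \<in> ?Q. \<forall>w\<in>{z, z, z, z}. \<xi> (w \<oplus> J)}. \<phi> z z {..<n} J}"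
        hence "z \<oplus> J \<in> V" using z slice_cubeD by (auto simp: V intro: xor_in_cube)
        thus "J \<in> {A \<in> ?Q. z \<oplus> A \<in> L}"
          using J \<phi>D[of z z "{..<n}" J] z full by (auto simp: L full_Int)
      qed
      hence "real (card {J \<in> {J \<in> ?Q. \<forall>w\<in>{z, z, z, z}. \<xi> (w \<oplus> J)}. \<phi> z z {..<n} J}) \<le> real (card {A \<in> ?Q. z \<oplus> A \<in> L})"
        by (intro of_nat_mono card_mono) auto
      moreover have "p ^ 4 * ?D \<ge> 0" using p by simp
      ultimately show ?thesis unfolding \<beta>_def by (simp only: mult.assoc times_divide_eq_left)
    qed
    show "\<beta> \<le> real (card {J \<in> ?Q. r x (x \<oplus> J) \<and> r (x \<oplus> J) (x \<oplus> J \<oplus> B) \<and>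
             r (x \<oplus> J \<oplus> B) (x \<oplus> J \<oplus> B \<oplus> S) \<and> r (x \<oplus> J \<oplus> B \<oplus> S) (y \<oplus> J) \<and> r (y \<oplus> J) y})"
      if x: "x \<in> L" and y: "y \<in> L" and B: "B \<in> ?Q" and S: "S \<in> ?Q" for x y B S
    proof -
      define w2 w3 where "w2 = x \<oplus> B" and "w3 = x \<oplus> B \<oplus> S"
      have cu: "x \<in> cube n" "y \<in> cube n" "w2 \<in> cube n" "w3 \<in> cube n"
        using x y B S LV Vc slice_cubeD by (auto simp: w2_def w3_def intro!: xor_in_cube)
      have xyV: "x \<in> V" "y \<in> V" and xyN: "\<eta> * real n \<le> real (card (?N x))" "\<eta> * real n \<le> real (card (?N y))"
        using x y by (auto simp: L)
      define G0 where "G0 = {J \<in> ?Q. \<forall>w\<in>{x, w2, w3, y}. \<xi> (w \<oplus> J)}"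
      define G1 where "G1 = {J \<in> G0. \<phi> x x (?N x) J}"
      define G2 where "G2 = {J \<in> G1. \<phi> x w2 {..<n} J}"
      define G3 where "G3 = {J \<in> G2. \<phi> w2 w3 {..<n} J}"
      define G4 where "G4 = {J \<in> G3. \<phi> w3 y {..<n} J}"
      define G5 where "G5 = {J \<in> G4. \<phi> y y (?N y) J}"
      let ?\<delta> = "p ^ 4 / 20 * ?D"
      have 0: "3 / 4 * p ^ 4 * ?D \<le> real (card G0)"
        unfolding G0_def using cu by (intro translates)
      have 1: "3 / 4 * p ^ 4 * ?D - ?\<delta> \<le> real (card G1)" unfolding G1_def
        by (rule card_Int_ge[OF _ _ 0 \<phi>]) (use cu xyN Nc G0_def in auto)
      have 2: "3 / 4 * p ^ 4 * ?D - ?\<delta> - ?\<delta> \<le> real (card G2)" unfolding G2_def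
        by (rule card_Int_ge[OF _ _ 1 \<phi>]) (use cu full full_card G0_def G1_def in auto)
      have 3: "3 / 4 * p ^ 4 * ?D - ?\<delta> - ?\<delta> - ?\<delta> \<le> real (card G3)" unfolding G3_def
        by (rule card_Int_ge[OF _ _ 2 \<phi>]) (use cu full full_card G0_def G1_def G2_def in auto)
      have 4: "3 / 4 * p ^ 4 * ?D - ?\<delta> - ?\<delta> - ?\<delta> - ?\<delta> \<le> real (card G4)" unfolding G4_def
        by (rule card_Int_ge[OF _ _ 3 \<phi>]) (use cu full full_card G0_def G1_def G2_def G3_def in auto)
      have 5: "3 / 4 * p ^ 4 * ?D - ?\<delta> - ?\<delta> - ?\<delta> - ?\<delta> - ?\<delta> \<le> real (card G5)" unfolding G5_def
        by (rule card_Int_ge[OF _ _ 4 \<phi>]) (use cu xyN Nc G0_def G1_def G2_def G3_def G4_def in auto)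
      have "G5 \<subseteq> {J \<in> ?Q. r x (x \<oplus> J) \<and> r (x \<oplus> J) (x \<oplus> J \<oplus> B) \<and>
             r (x \<oplus> J \<oplus> B) (x \<oplus> J \<oplus> B \<oplus> S) \<and> r (x \<oplus> J \<oplus> B \<oplus> S) (y \<oplus> J) \<and> r (y \<oplus> J) y}"
      proof
        fix J assume "J \<in> G5"
        hence J: "J \<in> ?Q" and \<xi>: "\<xi> (x \<oplus> J)" "\<xi> (w2 \<oplus> J)" "\<xi> (w3 \<oplus> J)" "\<xi> (y \<oplus> J)"
          and f: "\<phi> x x (?N x) J" "\<phi> x w2 {..<n} J" "\<phi> w2 w3 {..<n} J" "\<phi> w3 y {..<n} J" "\<phi> y y (?N y) J"
          by (auto simp: G5_def G4_def G3_def G2_def G1_def G0_def)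
        have JV: "x \<oplus> J \<in> V" "w2 \<oplus> J \<in> V" "w3 \<oplus> J \<in> V" "y \<oplus> J \<in> V"
          using \<xi> cu slice_cubeD[OF J] by (auto simp: V intro!: xor_in_cube)
        have end_step: "r u (u \<oplus> J)" if "\<phi> u u (?N u) J" "u \<in> cube n" "u \<in> V" "u \<oplus> J \<in> V"
            "\<eta> * real n \<le> real (card (?N u))" for u
        proof -
          have "\<kappa> * real n = \<eta> * (\<eta> * real n)" by (simp add: \<kappa>_def power2_eq_square)
          also have "\<dots> \<le> \<eta> * real (card (?N u))" using that \<eta> by (intro mult_left_mono) auto
          also have "\<dots> \<le> real (card (?N u \<inter> ?N (u \<oplus> J) \<inter> ?N (u \<oplus> J)))"
            using that J Nc by (intro \<phi>D) auto
          finally show ?thesis using that by (simp add: r_def Int_assoc)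
        qed
        have mid_step: "r (u \<oplus> J) (v \<oplus> J)" if "\<phi> u v {..<n} J" "u \<in> cube n" "v \<in> cube n" "u \<oplus> J \<in> V" "v \<oplus> J \<in> V" for u v
        proof -
          have "\<kappa> * real n \<le> \<eta> * real (card {..<n})" using \<kappa>\<eta> by simp
          also have "\<dots> \<le> real (card ({..<n} \<inter> ?N (u \<oplus> J) \<inter> ?N (v \<oplus> J)))"
            using that J full by (intro \<phi>D) auto
          finally show ?thesis using that by (simp add: r_def full_Int)
        qed
        have "r x (x \<oplus> J)" using f cu xyV xyN JV by (intro end_step)
        moreover have "r (x \<oplus> J) (w2 \<oplus> J)" using f cu JV by (intro mid_step)
        moreover have "r (w2 \<oplus> J) (w3 \<oplus> J)" using f cu JV by (intro mid_step)
        moreover have "r (w3 \<oplus> J) (y \<oplus> J)" using f cu JV by (intro mid_step)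
        moreover have "r y (y \<oplus> J)" using f cu xyV xyN JV by (intro end_step)
        hence "r (y \<oplus> J) y" by (auto simp: r_def Int_commute)
        moreover have "w2 \<oplus> J = x \<oplus> J \<oplus> B" "w3 \<oplus> J = x \<oplus> J \<oplus> B \<oplus> S"
          by (auto simp: w2_def w3_def xor_ac)
        ultimately show "J \<in> {J \<in> ?Q. r x (x \<oplus> J) \<and> r (x \<oplus> J) (x \<oplus> J \<oplus> B) \<and>
             r (x \<oplus> J \<oplus> B) (x \<oplus> J \<oplus> B \<oplus> S) \<and> r (x \<oplus> J \<oplus> B \<oplus> S) (y \<oplus> J) \<and> r (y \<oplus> J) y}"
          using J by simp
      qed
      hence "card G5 \<le> card {J \<in> ?Q. r x (x \<oplus> J) \<and> r (x \<oplus> J) (x \<oplus> J \<oplus> B) \<and>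
             r (x \<oplus> J \<oplus> B) (x \<oplus> J \<oplus> B \<oplus> S) \<and> r (x \<oplus> J \<oplus> B \<oplus> S) (y \<oplus> J) \<and> r (y \<oplus> J) y}"
        by (intro card_mono) auto
      moreover have "\<beta> \<le> real (card G5)"
        using 5 by (simp add: \<beta>_def mult.commute)
      ultimately show ?thesis by linarith
    qed
    show "u \<in> V \<and> v \<in> V" if "r u v" for u v using that by (simp add: r_def)
  qed (use \<beta> d in auto)

  \<comment> \<open>Removing \<open>R\<close> leaves at least three quarters of
    \<open>\<eta>\<^sup>2 * n\<close> common directions. The base \<open>\<eta>\<^sup>2 / 4\<close>
    accommodates the extra summand \<open>d\<close> required by
    \<open>binomial_ratio_ge\<close>.\<close>
  define \<zeta> where "\<zeta> = q ^ 3 / 2 * ((\<eta>\<^sup>2 / 4) ^ d * ?D)"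
  have 2: "\<zeta> * real (card (boundary_steps n d r V U)) \<le>
     3 * ?D * real (card (boundary_steps n d (adjacent d V) V U))"
  proof (rule boundary_steps_comparison)
    show "finite U" using U finV finite_subset by blast
    show "u \<in> V \<and> v \<in> V" if "adjacent d V u v" for u v using that by (simp add: adjacent_def)
    fix e R assume R: "R \<in> ?Q" and "r e (e \<oplus> R)"
    hence e: "e \<in> V" "e \<oplus> R \<in> V" and c: "\<kappa> * real n \<le> real (card (?N e \<inter> ?N (e \<oplus> R)))"
      by (auto simp: r_def)
    define N where "N = ?N e \<inter> ?N (e \<oplus> R) - R"
    have finR: "finite R" "card R = d" using R finite_subset by (auto simp: slice_def)
    have N: "N \<in> cube n" "N \<inter> R = {}" using Nc[of e] by (auto simp: N_def cube_def)
    have "card (?N e \<inter> ?N (e \<oplus> R)) - card R \<le> card N"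
      unfolding N_def by (rule diff_card_le_card_Diff[OF finR(1)])
    hence cN: "\<kappa> * real n - real d \<le> real (card N)" using c finR by linarith
    have "\<eta>\<^sup>2 / 4 * real n + real d \<le> real (card N)" using cN d by (simp add: \<kappa>_def)
    hence "(\<eta>\<^sup>2 / 4) ^ d * ?D \<le> real (card N choose d)"
      using d by (intro binomial_ratio_ge) auto
    hence "\<zeta> \<le> q ^ 3 / 2 * real (card N choose d)"
      unfolding \<zeta>_def using q by (intro mult_left_mono) auto
    also have "\<dots> \<le> real (card {I. I \<subseteq> N \<and> card I = d \<and> square_pattern e R I \<xi>})"
    proof -
      have "\<eta>\<^sup>2 * real n / 2 \<le> real (card N)" using cN d unfolding \<kappa>_def by (simp add: field_simps)
      moreover have "e \<in> cube n" using e V by simp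
      ultimately show ?thesis
        using ev(3) R N unfolding many_squares_def by (auto intro: less_imp_le)
    qed
    also have "{I. I \<subseteq> N \<and> card I = d \<and> square_pattern e R I \<xi>} \<subseteq>
       {I \<in> ?Q. adjacent d V e (e \<oplus> I) \<and> adjacent d V (e \<oplus> I) (e \<oplus> I \<oplus> R) \<and> adjacent d V (e \<oplus> I \<oplus> R) (e \<oplus> R)}"
    proof
      fix I assume "I \<in> {I. I \<subseteq> N \<and> card I = d \<and> square_pattern e R I \<xi>}"
      hence I: "I \<subseteq> N" "card I = d" "square_pattern e R I \<xi>" by auto
      have IQ: "I \<in> ?Q" using I N by (auto simp: slice_def cube_def)
      show "I \<in> {I \<in> ?Q. adjacent d V e (e \<oplus> I) \<and> adjacent d V (e \<oplus> I) (e \<oplus> I \<oplus> R) \<and> adjacent d V (e \<oplus> I \<oplus> R) (e \<oplus> R)}"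
        using square_pattern_path[OF V e R IQ _ _ _ I(3)] I(1) N(2) IQ unfolding N_def by blast
    qed
    hence "real (card {I. I \<subseteq> N \<and> card I = d \<and> square_pattern e R I \<xi>}) \<le> real (card
       {I \<in> ?Q. adjacent d V e (e \<oplus> I) \<and> adjacent d V (e \<oplus> I) (e \<oplus> I \<oplus> R) \<and> adjacent d V (e \<oplus> I \<oplus> R) (e \<oplus> R)})"
      by (intro of_nat_mono card_mono) auto
    finally show "\<zeta> \<le> real (card {I \<in> ?Q. adjacent d V e (e \<oplus> I) \<and> adjacent d V (e \<oplus> I) (e \<oplus> I \<oplus> R) \<and>
        adjacent d V (e \<oplus> I \<oplus> R) (e \<oplus> R)})" .
  qed

  have \<zeta>0: "\<zeta> \<ge> 0" using q by (simp add: \<zeta>_def)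
  \<comment> \<open>The 16 collects the halves in \<open>\<zeta>\<close> and in three factors
    \<open>\<beta>\<close>, which also supply \<open>p ^ 12\<close>; then 1440 = 30 * 3 *
    16.\<close>
  have "?D ^ 3 / 16 * (q ^ 3 * p ^ 12 * (\<eta>\<^sup>2 / 4) ^ d * ?D * (real (card (L \<inter> U)) * real (card (L - U)))) =
     \<zeta> * (\<beta> * \<beta>\<^sup>2 * (real (card (L \<inter> U)) * real (card (L - U))))"
    by (simp add: \<zeta>_def \<beta>_def power2_eq_square power3_eq_cube field_simps flip: power_add)
  also have "\<dots> \<le> \<zeta> * (30 * real n * 2 ^ n * ?D\<^sup>2 * real (card (boundary_steps n d r V U)))"
    by (rule mult_left_mono[OF 1 \<zeta>0])
  also have "\<dots> = 30 * real n * 2 ^ n * ?D\<^sup>2 * (\<zeta> * real (card (boundary_steps n d r V U)))"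
    by simp
  also have "\<dots> \<le> 30 * real n * 2 ^ n * ?D\<^sup>2 * (3 * ?D * real (card (boundary_steps n d (adjacent d V) V U)))"
    by (rule mult_left_mono[OF 2]) simp
  also have "\<dots> = ?D ^ 3 / 16 * (1440 * real n * 2 ^ n * real (card (boundary_steps n d (adjacent d V) V U)))"
    by (simp add: power2_eq_square power3_eq_cube)
  finally show ?thesis using D by (simp add: mult_le_cancel_left_pos)
qed

section \<open>Probability of the exceptional events\<close>

lemma prob_union_bound:
  assumes "finite I" "\<And>i. i \<in> I \<Longrightarrow> measure_pmf.prob M {\<xi>. P i \<xi>} \<le> b" "real (card I) \<le> a" "b \<ge> 0"
  shows "measure_pmf.prob M {\<xi>. \<exists>i\<in>I. P i \<xi>} \<le> a * b"
proof -
  have "{\<xi>. \<exists>i\<in>I. P i \<xi>} = (\<Union>i\<in>I. {\<xi>. P i \<xi>})" by auto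
  also have "measure_pmf.prob M \<dots> \<le> (\<Sum>i\<in>I. measure_pmf.prob M {\<xi>. P i \<xi>})"
    using assms(1) by (intro measure_pmf.finite_measure_subadditive_finite) auto
  also have "\<dots> \<le> (\<Sum>i\<in>I. b)" by (intro sum_mono assms)
  also have "\<dots> \<le> a * b" using mult_right_mono[OF assms(3,4)] by simp
  finally show ?thesis .
qed

text \<open>The largest union below is over quadruples of points, of size \<open>16 ^ n\<close>, and
  16 is at most \<open>exp 4\<close>. An exponent of \<open>5 * n\<close> therefore suffices
  throughout.\<close>

lemma power_exp_decay:
  assumes "5 * real n \<le> z" "a \<le> 16" "0 \<le> a"
  shows "a ^ n * exp (- z) \<le> exp (- real n)"
proof -
  have "(2 :: real) \<le> exp 1" using exp_ge_add_one_self[of 1] by simp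
  hence "(2 :: real) ^ 4 \<le> exp 1 ^ 4" by (intro power_mono) auto
  hence "a \<le> exp 4" using assms by (simp flip: exp_of_nat_mult)
  hence "a ^ n \<le> exp 4 ^ n" using assms by (intro power_mono) auto
  also have "\<dots> = exp (4 * real n)" by (simp add: exp_of_nat_mult[symmetric] mult.commute)
  finally have "a ^ n * exp (- z) \<le> exp (4 * real n) * exp (- (5 * real n))"
    using assms by (intro mult_mono) auto
  also have "\<dots> = exp (- real n)" by (simp flip: exp_add)
  finally show ?thesis .
qed

lemma prob_not_many_translates:
  assumes p: "0 < p" "p \<le> 1" and d: "d \<le> n" and large: "5 * real n \<le> p ^ 8 * real (n choose d) / 128"
  shows "measure_pmf.prob (random_bits n p) {\<xi>. \<not> many_translates n d p \<xi>} \<le> exp (- real n)"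
proof -
  let ?I = "cube n \<times> cube n \<times> cube n \<times> cube n"
  have "{\<xi>. \<not> many_translates n d p \<xi>} = {\<xi>. \<exists>i\<in>?I. (\<lambda>(a, b, c, e) \<xi>.
      real (card {J \<in> slice n d. \<forall>w\<in>{a, b, c, e}. \<xi> (w \<oplus> J)}) \<le> 3 / 4 * p ^ 4 * real (n choose d)) i \<xi>}"
    by (auto simp: many_translates_def not_less)
  also have "measure_pmf.prob (random_bits n p) \<dots> \<le> 16 ^ n * exp (- (p ^ 8 * real (n choose d) / 128))"
  proof (rule prob_union_bound)
    have "card ?I = 16 ^ n"
      by (simp add: card_cartesian_product card_cube flip: power_mult_distrib)
    thus "real (card ?I) \<le> 16 ^ n" by simp
    fix i assume "i \<in> ?I"
    then obtain a b c e where i: "i = (a, b, c, e)" and sub: "{a, b, c, e} \<subseteq> cube n" by auto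
    have "card {a, b, c, e} \<le> 4" by (auto simp: card_insert_if)
    from prob_few_translates[OF p sub this d]
    show "measure_pmf.prob (random_bits n p) {\<xi>. (\<lambda>(a, b, c, e) \<xi>.
      real (card {J \<in> slice n d. \<forall>w\<in>{a, b, c, e}. \<xi> (w \<oplus> J)}) \<le> 3 / 4 * p ^ 4 * real (n choose d)) i \<xi>}
      \<le> exp (- (p ^ 8 * real (n choose d) / 128))" unfolding i by simp
  qed auto
  also have "\<dots> \<le> exp (- real n)" by (rule power_exp_decay[OF large]) auto
  finally show ?thesis .
qed

lemma prob_not_few_exceptional_translates:
  assumes p: "0 \<le> p" "p \<le> 1 - \<epsilon>" and \<epsilon>: "0 < \<epsilon>" and \<eta>: "0 < \<eta>" "\<eta> \<le> \<epsilon>\<^sup>2 / 4"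
    and d: "2 * real d \<le> \<eta> * real n" "d \<le> n" and n: "0 < n"
    and \<delta>: "\<delta> > 0" "exp (- (\<eta> ^ 3 * real n / 2)) \<le> \<delta> / 2"
    and large: "5 * real n \<le> \<delta>\<^sup>2 * real (n choose d) / (8 * real n * real (d + 1))"
  shows "measure_pmf.prob (random_bits n p) {\<xi>. \<not> few_exceptional_translates n d \<eta> \<delta> \<xi>} \<le> exp (- real n)"
proof -
  let ?I = "cube n \<times> cube n \<times> {N \<in> cube n. \<eta> * real n \<le> real (card N)}"
  let ?P = "\<lambda>(w, w', N) \<xi>. real (card {J \<in> slice n d. \<eta> * real (card N) \<le>
                  real (card {i \<in> N - J. \<not> \<xi> (w \<oplus> J \<oplus> {i}) \<and> \<not> \<xi> (w' \<oplus> J \<oplus> {i})})})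
                \<le> (1 - \<delta>) * real (n choose d)"
  have "{\<xi>. \<not> few_exceptional_translates n d \<eta> \<delta> \<xi>} = {\<xi>. \<exists>i\<in>?I. ?P i \<xi>}"
    by (auto simp: few_exceptional_translates_def not_less)
  also have "measure_pmf.prob (random_bits n p) \<dots> \<le>
     8 ^ n * exp (- (\<delta>\<^sup>2 * real (n choose d) / (8 * real n * real (d + 1))))"
  proof (rule prob_union_bound)
    have "card ?I \<le> card (cube n \<times> cube n \<times> cube n)" by (intro card_mono) auto
    also have "\<dots> = 8 ^ n"
      by (simp add: card_cartesian_product card_cube flip: power_mult_distrib)
    finally have "card ?I \<le> 8 ^ n" .
    from of_nat_mono[OF this, where 'a = real]
    show "real (card ?I) \<le> 8 ^ n" by (simp only: of_nat_power of_nat_numeral)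
    fix i assume "i \<in> ?I"
    then obtain w w' N where i: "i = (w, w', N)" and w: "w \<in> cube n" "w' \<in> cube n"
      and N: "N \<subseteq> {..<n}" "\<eta> * real n \<le> real (card N)" by (auto simp: cube_def)
    show "measure_pmf.prob (random_bits n p) {\<xi>. ?P i \<xi>} \<le>
       exp (- (\<delta>\<^sup>2 * real (n choose d) / (8 * real n * real (d + 1))))"
      using prob_many_exceptional_translates[OF p \<epsilon> \<eta> w N d n \<delta>] by (simp add: i)
  qed auto
  also have "\<dots> \<le> exp (- real n)" by (rule power_exp_decay[OF large]) auto
  finally show ?thesis .
qed

lemma binomial_minus_two_le:
  assumes "2 \<le> d" "d \<le> n"
  shows "real ((n - 2) choose (d - 2)) \<le> real (n choose d) * (real d)\<^sup>2 / (real n)\<^sup>2"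
proof -
  define m k where "m = n - 2" and "k = d - 2"
  have m: "n = Suc (Suc m)" and k: "d = Suc (Suc k)"
    using assms by (auto simp: m_def k_def)
  define a b c where "a = real (m choose k)" and "b = real (Suc m choose Suc k)"
    and "c = real (Suc (Suc m) choose Suc (Suc k))"
  have 1: "real (Suc m) * a = b * real (Suc k)"
    unfolding a_def b_def of_nat_mult [symmetric] Suc_times_binomial_eq ..
  have 2: "real (Suc (Suc m)) * b = c * real (Suc (Suc k))"
    unfolding b_def c_def of_nat_mult [symmetric] Suc_times_binomial_eq ..
  have "real (Suc (Suc m)) * (real (Suc m) * a) = real (Suc (Suc m)) * b * real (Suc k)"
    by (simp only: 1 mult.assoc)
  also have "\<dots> = c * real (Suc (Suc k)) * real (Suc k)" by (simp only: 2)
  finally have "a = c * (real (Suc (Suc k)) * real (Suc k) / (real (Suc (Suc m)) * real (Suc m)))"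
    by (simp add: nonzero_eq_divide_eq mult_ac)
  hence eq: "real ((n - 2) choose (d - 2)) = real (n choose d) * (real (d * (d - 1)) / real (n * (n - 1)))"
    by (simp add: a_def c_def m k algebra_simps del: binomial_Suc_Suc)
  have "real (d * (d - 1)) / real (n * (n - 1)) \<le> (real d)\<^sup>2 / (real n)\<^sup>2"
  proof -
    have "(d - 1) * n \<le> d * (n - 1)" using assms by (simp add: m k)
    hence "real ((d - 1) * n) \<le> real (d * (n - 1))" by (rule of_nat_mono)
    hence "real (d - 1) / real (n - 1) \<le> real d / real n"
      using assms by (simp add: m field_simps)
    hence "real d / real n * (real (d - 1) / real (n - 1)) \<le> real d / real n * (real d / real n)"
      by (intro mult_left_mono) auto
    thus ?thesis by (simp add: power2_eq_square)
  qed
  hence "real (n choose d) * (real (d * (d - 1)) / real (n * (n - 1))) \<le> real (n choose d) * ((real d)\<^sup>2 / (real n)\<^sup>2)"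
    by (rule mult_left_mono) simp
  thus ?thesis unfolding eq by simp
qed

text \<open>Dividing by \<open>(n - 2) choose (d - 2)\<close> gains n^2/d^2, and the loss in
  \<open>card N choose d\<close> is at most a factor \<open>(\<kappa> / 4) ^ d\<close>. Together
  with the \<open>2 ^ d\<close> from the size of a pattern this gives the base
  \<open>\<kappa> / 8\<close>.\<close>

lemma prob_not_many_squares:
  assumes p: "0 < p" "p < 1" and \<kappa>: "0 < \<kappa>" and d: "2 \<le> d" "d \<le> n" "real d \<le> \<kappa> * real n / 4"
  defines "q \<equiv> p * (1 - p) ^ (2 ^ d - 2)"
  assumes large: "5 * real n \<le> q ^ 6 * (real n)\<^sup>2 * (\<kappa> / 8) ^ d / (18 * (real d)\<^sup>2)"
  shows "measure_pmf.prob (random_bits n p) {\<xi>. \<not> many_squares n d q (\<kappa> * real n / 2) \<xi>} \<le> exp (- real n)"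
proof -
  let ?I = "SIGMA x:cube n. SIGMA R:slice n d. {N \<in> cube n. N \<inter> R = {} \<and> \<kappa> * real n / 2 \<le> real (card N)}"
  let ?P = "\<lambda>(x, R, N) \<xi>. real (card {I. I \<subseteq> N \<and> card I = d \<and> square_pattern x R I \<xi>}) \<le> q ^ 3 / 2 * real (card N choose d)"
  have "{\<xi>. \<not> many_squares n d q (\<kappa> * real n / 2) \<xi>} = {\<xi>. \<exists>i\<in>?I. ?P i \<xi>}"
    by (auto simp: many_squares_def not_less)
  also have "measure_pmf.prob (random_bits n p) \<dots> \<le> 8 ^ n * exp (- (q ^ 6 * (real n)\<^sup>2 * (\<kappa> / 8) ^ d / (18 * (real d)\<^sup>2)))"
  proof (rule prob_union_bound)
    have fin: "finite (cube n \<times> cube n \<times> cube n)" by simp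
    have sub: "?I \<subseteq> cube n \<times> cube n \<times> cube n" using slice_subset_cube by auto
    show "finite ?I" by (rule finite_subset[OF sub fin])
    have "card ?I \<le> card (cube n \<times> cube n \<times> cube n)" by (rule card_mono[OF fin sub])
    also have "\<dots> = 8 ^ n"
      by (simp add: card_cartesian_product card_cube flip: power_mult_distrib)
    finally have "card ?I \<le> 8 ^ n" .
    from of_nat_mono[OF this, where 'a = real]
    show "real (card ?I) \<le> 8 ^ n" by (simp only: of_nat_power of_nat_numeral)
    fix i assume "i \<in> ?I"
    then obtain x R N where i: "i = (x, R, N)" and x: "x \<in> cube n" and R: "R \<in> slice n d"
      and "N \<in> cube n" "N \<inter> R = {}" and cN: "\<kappa> * real n / 2 \<le> real (card N)" by auto
    hence N: "N \<subseteq> {..<n} - R" "\<kappa> * real n / 2 \<le> real (card N)" by (auto simp: cube_def)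
    have dN: "d \<le> card N" using d N by linarith
    have q: "q > 0" using p by (simp add: q_def)
    let ?C = "real ((n - 2) choose (d - 2))" and ?D = "real (n choose d)" and ?M = "real (card N choose d)"
    have D: "?D > 0" using d by simp
    have "(n - 2) choose (d - 2) > 0" using d by simp
    hence C: "?C > 0" by linarith
    have M: "(\<kappa> / 4) ^ d * ?D \<le> ?M"
      using d N \<kappa> by (intro binomial_ratio_ge) auto
    have "q ^ 6 * (real n)\<^sup>2 * (\<kappa> / 8) ^ d / (18 * (real d)\<^sup>2) =
       q ^ 6 * ((\<kappa> / 4) ^ d * ?D) / (18 * 2 ^ d * (?D * (real d)\<^sup>2 / (real n)\<^sup>2))"
    proof -
      have "(\<kappa> / 8) ^ d = (\<kappa> / 4) ^ d / 2 ^ d" by (simp flip: power_divide)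
      thus ?thesis using D d by (auto simp: field_simps)
    qed
    also have "\<dots> \<le> q ^ 6 * ?M / (18 * 2 ^ d * ?C)"
    proof (rule frac_le)
      show "q ^ 6 * ((\<kappa> / 4) ^ d * ?D) \<le> q ^ 6 * ?M" using M q by (intro mult_left_mono) auto
      show "18 * 2 ^ d * ?C \<le> 18 * 2 ^ d * (?D * (real d)\<^sup>2 / (real n)\<^sup>2)"
        using d by (intro mult_left_mono binomial_minus_two_le) auto
    qed (use q C in auto)
    finally have "exp (- (q ^ 6 * ?M / (18 * 2 ^ d * ?C))) \<le> exp (- (q ^ 6 * (real n)\<^sup>2 * (\<kappa> / 8) ^ d / (18 * (real d)\<^sup>2)))"
      by simp
    from order.trans[OF prob_few_squares[OF p x R N(1) dN d(1), folded q_def] this]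
    show "measure_pmf.prob (random_bits n p) {\<xi>. ?P i \<xi>} \<le> exp (- (q ^ 6 * (real n)\<^sup>2 * (\<kappa> / 8) ^ d / (18 * (real d)\<^sup>2)))"
      by (simp add: i)
  qed auto
  also have "\<dots> \<le> exp (- real n)" by (rule power_exp_decay[OF large]) auto
  finally show ?thesis .
qed

section \<open>Asymptotics, uniform in p and d\<close>

lemma powr_neg_tenth_power:
  assumes "x > 0" shows "(x powr (- 0.1 :: real)) ^ k = x powr (- (0.1 * real k))"
proof -
  have "(x powr (- 0.1 :: real)) ^ k = (x powr (- 0.1)) powr real k"
    using assms by (intro powr_realpow[symmetric]) simp
  thus ?thesis by (simp add: powr_powr)
qed

text \<open>The quantifiers over \<open>p\<close>, \<open>d\<close> and \<open>q\<close> stand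
  inside the eventuality, so one threshold for \<open>n\<close> serves arbitrary sequences. Since
  \<open>q \<le> p\<close>, the lower bound on \<open>q\<close> also bounds the powers of
  \<open>p\<close>.\<close>

lemma eventually_expansion_events:
  fixes \<epsilon> \<eta> :: real
  assumes \<epsilon>: "0 < \<epsilon>" "\<epsilon> \<le> 1" and \<eta>: "0 < \<eta>" "\<eta> \<le> \<epsilon>\<^sup>2 / 4"
  obtains c :: real where "c > 0"
    "\<forall>\<^sub>F n in sequentially. \<forall>p d q. 0 < p \<and> p \<le> 1 - \<epsilon> \<and> 3 \<le> d \<and> q = p * (1 - p) ^ (2 ^ d - 2) \<and>
       real n powr (- 0.1) \<le> q \<and> real d \<le> c * ln (real n) \<longrightarrow>
       2 * d \<le> n \<and> real d \<le> \<eta>\<^sup>2 * real n / 4 \<and> 2 \<le> 3 / 4 * p ^ 4 * real (n choose d) \<and>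
       measure_pmf.prob (random_bits n p) {\<xi>. \<not> (many_translates n d p \<xi> \<and>
         few_exceptional_translates n d \<eta> (p ^ 4 / 20) \<xi> \<and> many_squares n d q (\<eta>\<^sup>2 * real n / 2) \<xi>)}
       \<le> 3 * exp (- real n)"
proof -
  define \<kappa> where "\<kappa> = \<eta>\<^sup>2"
  have \<kappa>0: "\<kappa> > 0" using \<eta> by (simp add: \<kappa>_def)
  have "\<epsilon>\<^sup>2 \<le> 1" using \<epsilon> by (simp add: power_le_one)
  hence \<eta>1: "\<eta> \<le> 1 / 4" using \<eta> by simp
  have \<kappa>\<eta>: "\<kappa> \<le> \<eta>" unfolding \<kappa>_def power2_eq_square using \<eta> \<eta>1 by (simp add: mult_left_le)
  have lnpos: "ln (8 / \<kappa>) > 0" using \<kappa>0 \<kappa>\<eta> \<eta>1 by simp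
  \<comment> \<open>Chosen so that \<open>d \<le> c * ln n\<close> implies
    \<open>(\<kappa> / 8) ^ d \<ge> n powr (- 0.1)\<close>; the minimum with 1 also gives
    \<open>d \<le> ln n\<close>.\<close>
  define c where "c = min 1 (0.1 / ln (8 / \<kappa>))"
  have c: "c > 0" "c \<le> 1" "c * ln (8 / \<kappa>) \<le> 0.1"
    using lnpos by (auto simp: c_def field_simps min_def)
  have pos: "\<kappa> / 8 > 0" "\<eta> ^ 3 / 2 > 0" using \<kappa>0 \<eta> by auto
  have E1: "\<forall>\<^sub>F n in sequentially. ln (real n) \<le> \<kappa> / 8 * real n"
    using pos(1) by real_asymp
  \<comment> \<open>The cube comes from \<open>3 \<le> d\<close> and
    \<open>n choose d \<ge> (n / d) ^ d\<close>, and \<open>n powr (- 0.8)\<close> bounds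
    \<open>p ^ 8\<close>. The right side is of order n^1.2 up to logarithms, and 3200 = 8 *
    20^2.\<close>
  have E2: "\<forall>\<^sub>F n in sequentially. 5 * real n \<le>
      real n powr (- 0.8) * (real n / ln (real n)) ^ 3 / (3200 * real n * (ln (real n) + 1))"
    by real_asymp
  \<comment> \<open>The exponent for squares: \<open>q ^ 6\<close> gives -0.6, the level-2 gain
    gives 2 and \<open>(\<kappa> / 8) ^ d\<close> gives -0.1, in total n^1.3 up to
    logarithms.\<close>
  have E3: "\<forall>\<^sub>F n in sequentially. 5 * real n \<le>
      real n powr (- 0.6) * (real n)\<^sup>2 * real n powr (- 0.1) / (18 * (ln (real n))\<^sup>2)"
    by real_asymp
  have E4: "\<forall>\<^sub>F n in sequentially. exp (- (\<eta> ^ 3 / 2 * real n)) \<le> real n powr (- 0.4) / 40"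
    using pos(2) by real_asymp
  have ev: "\<forall>\<^sub>F n in sequentially. \<forall>p d q. 0 < p \<and> p \<le> 1 - \<epsilon> \<and> 3 \<le> d \<and> q = p * (1 - p) ^ (2 ^ d - 2) \<and>
       real n powr (- 0.1) \<le> q \<and> real d \<le> c * ln (real n) \<longrightarrow>
       2 * d \<le> n \<and> real d \<le> \<kappa> * real n / 4 \<and> 2 \<le> 3 / 4 * p ^ 4 * real (n choose d) \<and>
       measure_pmf.prob (random_bits n p) {\<xi>. \<not> (many_translates n d p \<xi> \<and>
         few_exceptional_translates n d \<eta> (p ^ 4 / 20) \<xi> \<and> many_squares n d q (\<kappa> * real n / 2) \<xi>)}
       \<le> 3 * exp (- real n)"
    using E1 E2 E3 E4 eventually_gt_at_top[of 0]
  proof (eventually_elim, intro allI impI, elim conjE)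
    fix n :: nat and p q :: real and d :: nat
    assume e1: "ln (real n) \<le> \<kappa> / 8 * real n"
      and e2: "5 * real n \<le> real n powr (- 0.8) * (real n / ln (real n)) ^ 3 / (3200 * real n * (ln (real n) + 1))"
      and e3: "5 * real n \<le> real n powr (- 0.6) * (real n)\<^sup>2 * real n powr (- 0.1) / (18 * (ln (real n))\<^sup>2)"
      and e4: "exp (- (\<eta> ^ 3 / 2 * real n)) \<le> real n powr (- 0.4) / 40"
      and n: "0 < n" and p: "0 < p" "p \<le> 1 - \<epsilon>" and d3: "3 \<le> d"
      and q: "q = p * (1 - p) ^ (2 ^ d - 2)" and qn: "real n powr (- 0.1) \<le> q"
      and dc: "real d \<le> c * ln (real n)"
    let ?D = "real (n choose d)" and ?l = "ln (real n)"
    have p1: "p < 1" using p \<epsilon> by linarith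
    have l0: "?l \<ge> 0" using n by simp
    have dl: "real d \<le> ?l" using dc mult_right_mono[OF c(2) l0] by simp
    have d\<kappa>: "real d \<le> \<kappa> * real n / 8" using dl e1 by simp
    have "\<kappa> * real n \<le> 1 * real n" using \<kappa>\<eta> \<eta>1 by (intro mult_right_mono) auto
    hence "2 * real d \<le> real n" using d\<kappa> n by linarith
    hence dn: "2 * d \<le> n" by linarith
    hence dn': "d \<le> n" "2 \<le> d" using d3 by auto
    have d4: "real d \<le> \<kappa> * real n / 4" using d\<kappa> by linarith
    have d\<eta>: "2 * real d \<le> \<eta> * real n"
      using d4 mult_right_mono[OF \<kappa>\<eta>, of "real n"] by linarith
    have q0: "q > 0" using p p1 by (simp add: q)
    have qp: "q \<le> p" unfolding q using p p1 by (simp add: mult_left_le power_le_one)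
    have pk: "real n powr (- (0.1 * real k)) \<le> p ^ k" "real n powr (- (0.1 * real k)) \<le> q ^ k" for k
      using powr_neg_tenth_power[of "real n" k] n power_mono[OF qn, of k] power_mono[OF order.trans[OF qn qp], of k]
      by auto
    have p8: "real n powr (- 0.8) \<le> p ^ 8" using pk(1)[of 8] by simp
    have p4: "real n powr (- 0.4) \<le> p ^ 4" using pk(1)[of 4] by simp
    have q6: "real n powr (- 0.6) \<le> q ^ 6" using pk(2)[of 6] by simp
    have l3: "?l \<ge> 3" using dl d3 by linarith
    have "(real n / ?l) ^ 3 \<le> (real n / real d) ^ 3"
      using dl d3 l3 by (intro power_mono divide_left_mono) auto
    also have "\<dots> \<le> (real n / real d) ^ d"
      using d3 dn by (intro power_increasing) (auto simp: field_simps)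
    also have "\<dots> \<le> ?D" by (rule binomial_ge_n_over_k_pow_k[OF dn'(1)])
    finally have D: "(real n / ?l) ^ 3 \<le> ?D" .
    have big: "5 * real n \<le> (p ^ 4 / 20)\<^sup>2 * ?D / (8 * real n * real (d + 1))"
    proof -
      have "5 * real n \<le> real n powr (- 0.8) * (real n / ?l) ^ 3 / (3200 * real n * (?l + 1))" by (rule e2)
      also have "\<dots> \<le> p ^ 8 * ?D / (3200 * real n * (real d + 1))"
      proof (rule frac_le)
        show "real n powr (- 0.8) * (real n / ?l) ^ 3 \<le> p ^ 8 * ?D"
          using p8 D p l3 by (intro mult_mono) auto
        show "3200 * real n * (real d + 1) \<le> 3200 * real n * (?l + 1)"
          using dl by (intro mult_left_mono) auto
      qed (use n p in auto)
      also have "\<dots> = (p ^ 4 / 20)\<^sup>2 * ?D / (8 * real n * real (d + 1))"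
        by (simp add: power_divide add.commute flip: power_mult)
      finally show ?thesis .
    qed
    have big1: "5 * real n \<le> p ^ 8 * ?D / 128"
    proof -
      have "5 * real n \<le> p ^ 8 * ?D / (3200 * real n * (real d + 1))"
        using big by (simp add: power_divide add.commute flip: power_mult)
      also have "\<dots> \<le> p ^ 8 * ?D / 128"
      proof (rule divide_left_mono)
        have "1 * 1 \<le> real n * (real d + 1)" using n by (intro mult_mono) auto
        thus "128 \<le> 3200 * real n * (real d + 1)" by simp
      qed (use n p in auto)
      finally show ?thesis .
    qed
    have \<delta>: "exp (- (\<eta> ^ 3 * real n / 2)) \<le> p ^ 4 / 20 / 2"
      using e4 p4 by simp
    have "real n powr (- 0.1) \<le> (\<kappa> / 8) ^ d"
    proof -
      have "real n powr (- 0.1) = exp (- (0.1 * ?l))" using n by (simp add: powr_def)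
      also have "\<dots> \<le> exp (- (real d * ln (8 / \<kappa>)))"
      proof -
        have "real d * ln (8 / \<kappa>) \<le> c * ?l * ln (8 / \<kappa>)" using dc lnpos by (intro mult_right_mono) auto
        also have "\<dots> = (c * ln (8 / \<kappa>)) * ?l" by simp
        also have "\<dots> \<le> 0.1 * ?l" using c l0 by (intro mult_right_mono) auto
        finally show ?thesis by simp
      qed
      also have "\<dots> = exp (real d * ln (\<kappa> / 8))" using \<kappa>0 by (simp add: ln_div algebra_simps)
      also have "\<dots> = (\<kappa> / 8) ^ d" using \<kappa>0 by (simp add: exp_of_nat_mult)
      finally show ?thesis .
    qed
    note \<kappa>d = this
    have big3: "5 * real n \<le> q ^ 6 * (real n)\<^sup>2 * (\<kappa> / 8) ^ d / (18 * (real d)\<^sup>2)"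
    proof -
      have "5 * real n \<le> real n powr (- 0.6) * (real n)\<^sup>2 * real n powr (- 0.1) / (18 * (ln (real n))\<^sup>2)" by (rule e3)
      also have "\<dots> \<le> q ^ 6 * (real n)\<^sup>2 * (\<kappa> / 8) ^ d / (18 * (real d)\<^sup>2)"
      proof (rule frac_le)
        show "real n powr (- 0.6) * (real n)\<^sup>2 * real n powr (- 0.1) \<le> q ^ 6 * (real n)\<^sup>2 * (\<kappa> / 8) ^ d"
          using q6 \<kappa>d q0 by (intro mult_mono) auto
        show "18 * (real d)\<^sup>2 \<le> 18 * ?l\<^sup>2" using dl by (intro mult_left_mono power_mono) auto
      qed (use q0 \<kappa>0 d3 in auto)
      finally show ?thesis .
    qed
    let ?M = "random_bits n p"
    let ?E1 = "{\<xi>. \<not> many_translates n d p \<xi>}" and ?E2 = "{\<xi>. \<not> few_exceptional_translates n d \<eta> (p ^ 4 / 20) \<xi>}"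
      and ?E3 = "{\<xi>. \<not> many_squares n d q (\<kappa> * real n / 2) \<xi>}"
    have P1: "measure_pmf.prob ?M ?E1 \<le> exp (- real n)"
      using p p1 by (intro prob_not_many_translates dn' big1) auto
    have P2: "measure_pmf.prob ?M ?E2 \<le> exp (- real n)"
      using p by (intro prob_not_few_exceptional_translates[OF _ p(2) \<epsilon>(1) \<eta> d\<eta> dn'(1) n _ \<delta> big]) auto
    have P3: "measure_pmf.prob ?M ?E3 \<le> exp (- real n)"
      unfolding q by (rule prob_not_many_squares[OF p(1) p1 \<kappa>0 dn'(2,1) d4 big3[unfolded q]])
    have split: "{\<xi>. \<not> (many_translates n d p \<xi> \<and> few_exceptional_translates n d \<eta> (p ^ 4 / 20) \<xi> \<and>
        many_squares n d q (\<kappa> * real n / 2) \<xi>)} = ?E1 \<union> ?E2 \<union> ?E3" by auto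
    have "measure_pmf.prob ?M (?E1 \<union> ?E2 \<union> ?E3) \<le> measure_pmf.prob ?M ?E1 + measure_pmf.prob ?M ?E2 + measure_pmf.prob ?M ?E3"
      by (intro order.trans[OF measure_Un_le] add_mono) auto
    hence "measure_pmf.prob ?M (?E1 \<union> ?E2 \<union> ?E3) \<le> 3 * exp (- real n)"
      using P1 P2 P3 by linarith
    \<comment> \<open>Ensures that \<open>V\<close> has at least two vertices, without which the
      minimum defining the expansion is unspecified.\<close>
    moreover have "2 \<le> 3 / 4 * p ^ 4 * ?D"
    proof -
      have "1 \<le> real n" using n by simp
      hence "640 \<le> p ^ 8 * ?D" using big1 by linarith
      also have "\<dots> \<le> p ^ 4 * ?D"
        using p p1 by (intro mult_right_mono power_decreasing) auto
      finally show ?thesis by simp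
    qed
    ultimately show "2 * d \<le> n \<and> real d \<le> \<kappa> * real n / 4 \<and> 2 \<le> 3 / 4 * p ^ 4 * real (n choose d) \<and>
       measure_pmf.prob (random_bits n p) {\<xi>. \<not> (many_translates n d p \<xi> \<and>
         few_exceptional_translates n d \<eta> (p ^ 4 / 20) \<xi> \<and> many_squares n d q (\<kappa> * real n / 2) \<xi>)}
       \<le> 3 * exp (- real n)" using dn d4 unfolding split by blast
  qed
  show ?thesis by (rule that[OF c(1)]) (use ev in \<open>simp add: \<kappa>_def\<close>)
qed

section \<open>Transfer to the graphs\<close>

definition point :: "nat \<Rightarrow> nat set \<Rightarrow> nat \<Rightarrow> nat"
  where "point n S = (\<lambda>i\<in>{..<n}. if i \<in> S then 1 else 0)"

lemma point_apply: "i < n \<Longrightarrow> point n S i = (if i \<in> S then 1 else 0)"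
  by (simp add: point_def)

lemma inj_on_point: "inj_on (point n) (cube n)"
proof (rule inj_onI)
  fix S T assume ST: "S \<in> cube n" "T \<in> cube n" and eq: "point n S = point n T"
  have "i \<in> S \<longleftrightarrow> i \<in> T" if "i < n" for i
    using fun_cong[OF eq, of i] that by (simp add: point_apply split: if_splits)
  thus "S = T" using ST by (auto simp: cube_def)
qed

lemma point_supp:
  assumes "x \<in> hypercube n"
  shows "point n {i. i < n \<and> x i = 1} = x"
proof
  fix i
  show "point n {i. i < n \<and> x i = 1} i = x i"
  proof (cases "i < n")
    case True
    hence "x i \<in> {0, 1}" using assms by (auto simp: hypercube_def)
    thus ?thesis using True by (auto simp: point_apply)
  next
    case False
    thus ?thesis using assms by (auto simp: hypercube_def point_def PiE_def extensional_def)
  qed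
qed

lemma bij_betw_point: "bij_betw (point n) (cube n) (hypercube n)"
  unfolding bij_betw_def
proof (intro conjI inj_on_point equalityI subsetI)
  fix x assume "x \<in> point n ` cube n"
  then obtain S where "x = point n S" by blast
  thus "x \<in> hypercube n" unfolding point_def hypercube_def by (simp only: restrict_PiE_iff) simp
next
  fix x assume "x \<in> hypercube n"
  hence "x = point n {i. i < n \<and> x i = 1}" by (rule point_supp[symmetric])
  moreover have "{i. i < n \<and> x i = 1} \<in> cube n" by (auto simp: cube_def)
  ultimately show "x \<in> point n ` cube n" by blast
qed

lemma random_subset_eq_random_bits:
  "random_subset n p = map_pmf (\<lambda>\<xi>. point n ` {x \<in> cube n. \<xi> x}) (random_bits n p)"
proof -
  \<comment> \<open>Functions outside the hypercube go to \<open>{n}\<close>, which is not in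
    \<open>cube n\<close>: the transport of \<open>Pi_pmf\<close> along \<open>h\<close> has to keep
    the outside outside, where the bits have the default \<open>False\<close>.\<close>
  define h where "h = (\<lambda>x. if x \<in> hypercube n then {i. i < n \<and> x i = 1} else {n})"
  have fin: "finite (hypercube n)" unfolding hypercube_def by (intro finite_PiE) auto
  have h_point: "h (point n S) = S" if "S \<in> cube n" for S
  proof -
    have "point n S \<in> hypercube n" using bij_betw_point that by (auto simp: bij_betw_def)
    thus ?thesis using that by (auto simp: h_def point_apply cube_def split: if_splits)
  qed
  have bij: "bij_betw h (hypercube n) (cube n)"
  proof (rule bij_betwI[where g = "point n"])
    show "h \<in> hypercube n \<rightarrow> cube n" by (auto simp: h_def cube_def)
    show "point n \<in> cube n \<rightarrow> hypercube n" using bij_betw_point by (auto simp: bij_betw_def)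
    show "point n (h x) = x" if "x \<in> hypercube n" for x
      using point_supp[OF that] that by (simp add: h_def)
  qed (rule h_point)
  have "Pi_pmf (hypercube n) False (\<lambda>_. bernoulli_pmf p) = map_pmf (\<lambda>g. g \<circ> h) (random_bits n p)"
    unfolding random_bits_def by (rule Pi_pmf_bij_betw[OF fin bij]) (auto simp: h_def cube_def)
  hence "random_subset n p = map_pmf (\<lambda>\<xi>. {x \<in> hypercube n. \<xi> (h x)}) (random_bits n p)"
    by (simp add: random_subset_def map_pmf_comp)
  moreover have "{x \<in> hypercube n. \<xi> (h x)} = point n ` {x \<in> cube n. \<xi> x}" for \<xi>
  proof -
    have "hypercube n = point n ` cube n" using bij_betw_point by (simp add: bij_betw_def)
    thus ?thesis by (auto simp: h_point)
  qed
  ultimately show ?thesis by simp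
qed

lemma hamming_point:
  assumes "S \<in> cube n" "T \<in> cube n"
  shows "hamming n (point n S) (point n T) = card (S \<oplus> T)"
proof -
  have "{i. i < n \<and> point n S i \<noteq> point n T i} = S \<oplus> T"
    using assms by (auto simp: point_apply xor_def cube_def split: if_splits)
  thus ?thesis by (simp add: hamming_def)
qed

lemma point_in_subcube_iff:
  assumes "S \<in> cube n" "T \<in> cube n" "Z \<in> cube n"
  shows "point n Z \<in> subcube n (point n S) (point n T) \<longleftrightarrow> S \<oplus> Z \<subseteq> S \<oplus> T"
proof -
  have "point n Z \<in> hypercube n" using bij_betw_point assms by (auto simp: bij_betw_def)
  hence "point n Z \<in> subcube n (point n S) (point n T) \<longleftrightarrow>
     (\<forall>i<n. min (point n S i) (point n T i) \<le> point n Z i \<and> point n Z i \<le> max (point n S i) (point n T i))"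
    by (simp add: subcube_def)
  also have "\<dots> \<longleftrightarrow> (\<forall>i<n. (i \<in> S \<longleftrightarrow> i \<in> T) \<longrightarrow> (i \<in> Z \<longleftrightarrow> i \<in> S))"
    by (intro all_cong1 imp_cong refl) (simp add: point_apply)
  also have "\<dots> \<longleftrightarrow> S \<oplus> Z \<subseteq> S \<oplus> T"
    using assms by (auto simp: xor_def cube_def)
  finally show ?thesis .
qed

lemma adjacent_edge:
  assumes V: "V \<subseteq> cube n" and adj: "adjacent d V S T"
  shows "{point n S, point n T} \<in> edges (cube_graph n d (point n ` V))"
proof -
  have ST: "S \<in> V" "T \<in> V" "S \<in> cube n" "T \<in> cube n" using adj V by (auto simp: adjacent_def)
  have "subcube n (point n S) (point n T) \<inter> point n ` V = {point n S, point n T}"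
  proof (intro equalityI subsetI)
    fix z assume z: "z \<in> subcube n (point n S) (point n T) \<inter> point n ` V"
    then obtain Z where Z: "Z \<in> V" "z = point n Z" by auto
    hence sub: "S \<oplus> Z \<subseteq> S \<oplus> T" using z V ST point_in_subcube_iff[of S n T Z] by auto
    have "S \<oplus> (S \<oplus> Z) \<in> V" using Z by simp
    hence "\<not> (S \<oplus> Z \<subset> S \<oplus> T \<and> S \<oplus> Z \<noteq> {})"
      using adj unfolding adjacent_def by metis
    hence "S \<oplus> Z = S \<oplus> T \<or> S \<oplus> Z = S \<oplus> S" using sub by auto
    hence "Z = T \<or> Z = S" by (simp only: xor_left_eq_iff)
    thus "z \<in> {point n S, point n T}" using Z by auto
  next
    fix z assume "z \<in> {point n S, point n T}"
    then obtain Z where Z: "z = point n Z" "Z = S \<or> Z = T" by auto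
    hence "S \<oplus> Z \<subseteq> S \<oplus> T" by auto
    thus "z \<in> subcube n (point n S) (point n T) \<inter> point n ` V"
      using Z ST point_in_subcube_iff[of S n T Z] by auto
  qed
  moreover have "hamming n (point n S) (point n T) = d"
    using hamming_point[OF ST(3,4)] adj by (simp add: adjacent_def)
  ultimately show ?thesis
    using ST unfolding edges_def cube_graph_def by auto
qed

text \<open>The edge determines the step, because \<open>e\<close> is its only end in
  \<open>U\<close>. The relation \<open>r\<close> may cover just some of the edges, so that in the
  union graph the steps of length 1 and of length 3 can be used separately.\<close>

lemma card_edge_boundary_ge:
  assumes V: "V \<subseteq> cube n" and U: "U \<subseteq> V"
    and r: "\<And>S T. r S T \<Longrightarrow> {point n S, point n T} \<in> edges G"
    and G: "edges G \<subseteq> Pow (point n ` V)"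
  shows "card (boundary_steps n d r V U) \<le> card (edge_boundary G (point n ` U))"
proof (rule card_inj_on_le[where f = "\<lambda>(e, R). {point n e, point n (e \<oplus> R)}"])
  have inj: "inj_on (point n) V" using inj_on_point V by (rule inj_on_subset)
  have finV: "finite V" using V finite_subset finite_cube by blast
  have mem: "point n S \<in> point n ` U \<longleftrightarrow> S \<in> U" if "S \<in> V" for S
    using inj_on_image_mem_iff[OF inj that U] .
  show "inj_on (\<lambda>(e, R). {point n e, point n (e \<oplus> R)}) (boundary_steps n d r V U)"
  proof (rule inj_onI, clarify)
    fix e R e' R'
    assume 1: "(e, R) \<in> boundary_steps n d r V U" and 2: "(e', R') \<in> boundary_steps n d r V U"
      and eq: "{point n e, point n (e \<oplus> R)} = {point n e', point n (e' \<oplus> R')}"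
    have in1: "e \<in> U" "e \<in> V" "e \<oplus> R \<in> V" "e \<oplus> R \<notin> U" using 1 U by (auto simp: boundary_steps_def)
    have in2: "e' \<in> U" "e' \<in> V" "e' \<oplus> R' \<in> V" "e' \<oplus> R' \<notin> U" using 2 U by (auto simp: boundary_steps_def)
    have "point n e = point n e' \<and> point n (e \<oplus> R) = point n (e' \<oplus> R')"
      using eq mem in1 in2 by (auto simp: doubleton_eq_iff)
    hence "e = e'" "e \<oplus> R = e' \<oplus> R'" using inj in1 in2 by (auto simp: inj_on_def)
    thus "e = e' \<and> R = R'" by simp
  qed
  show "(\<lambda>(e, R). {point n e, point n (e \<oplus> R)}) ` boundary_steps n d r V U \<subseteq> edge_boundary G (point n ` U)"
  proof (clarify)
    fix e R assume 1: "(e, R) \<in> boundary_steps n d r V U"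
    have in1: "e \<in> U" "e \<in> V" "e \<oplus> R \<in> V" "e \<oplus> R \<notin> U" "r e (e \<oplus> R)" using 1 U by (auto simp: boundary_steps_def)
    have "{point n e, point n (e \<oplus> R)} \<inter> point n ` U = {point n e}"
      using mem in1 by auto
    thus "{point n e, point n (e \<oplus> R)} \<in> edge_boundary G (point n ` U)"
      using r[OF in1(5)] by (simp add: edge_boundary_def)
  qed
  have "edge_boundary G (point n ` U) \<subseteq> Pow (point n ` V)" using G by (auto simp: edge_boundary_def)
  thus "finite (edge_boundary G (point n ` U))" using finV finite_subset by blast
qed

lemma edges_cube_graph_subset: "edges (cube_graph n d V) \<subseteq> Pow V"
  by (auto simp: edges_def cube_graph_def)

lemma edge_expansion_ge:
  assumes V: "V \<subseteq> cube n" "2 \<le> card V" and G: "vertices G = point n ` V"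
    and bd: "\<And>U. U \<subseteq> V \<Longrightarrow> U \<noteq> {} \<Longrightarrow> 2 * card U \<le> card V \<Longrightarrow>
       \<alpha> * real (card U) \<le> real (card (edge_boundary G (point n ` U)))"
  shows "\<alpha> \<le> edge_expansion G"
proof -
  have finV: "finite V" using V finite_subset finite_cube by blast
  have inj: "inj_on (point n) V" using inj_on_point V(1) by (rule inj_on_subset)
  have cardV: "card (vertices G) = card V" unfolding G by (rule card_image[OF inj])
  let ?f = "\<lambda>U. real (card (edge_boundary G U)) / real (card U)"
  let ?S = "{U. U \<subseteq> vertices G \<and> 1 \<le> card U \<and> real (card U) \<le> real (card (vertices G)) / 2}"
  have finS: "finite ?S"
    by (rule finite_subset[of _ "Pow (vertices G)"]) (use finV G in auto)
  obtain v where v: "v \<in> V" using V(2) by (metis card.empty ex_in_conv not_numeral_le_zero)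
  have "{point n v} \<in> ?S" using v V(2) by (auto simp: G cardV[unfolded G])
  hence ne: "?S \<noteq> {}" by blast
  have "\<alpha> \<le> Min (?f ` ?S)"
  proof (rule Min.boundedI)
    show "finite (?f ` ?S)" using finS by simp
    show "?f ` ?S \<noteq> {}" using ne by simp
    fix a assume "a \<in> ?f ` ?S"
    then obtain U0 where "U0 \<in> ?S" "a = ?f U0" by blast
    hence U0: "U0 \<subseteq> point n ` V" "1 \<le> card U0" "real (card U0) \<le> real (card V) / 2" "a = ?f U0"
      using cardV G by auto
    then obtain U where U: "U \<subseteq> V" "U0 = point n ` U" by (auto simp: subset_image_iff)
    have cU: "card U0 = card U" unfolding U(2) by (rule card_image[OF inj_on_subset[OF inj U(1)]])
    have "U \<noteq> {}" using cU U0(2) by auto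
    moreover have "2 * card U \<le> card V" using U0(3) cU by linarith
    ultimately have "\<alpha> * real (card U) \<le> real (card (edge_boundary G U0))"
      using bd[OF U(1)] U(2) by simp
    moreover have "real (card U) > 0" using U0(2) cU by linarith
    ultimately show "\<alpha> \<le> a" using U0(4) cU by (simp add: pos_le_divide_eq)
  qed
  also have "?f ` ?S = {real (card (edge_boundary G U)) / real (card U) | U.
            U \<subseteq> vertices G \<and> 1 \<le> card U \<and> real (card U) \<le> real (card (vertices G)) / 2}" by auto
  finally show ?thesis unfolding edge_expansion_def .
qed

text \<open>The event at four equal points says that every sphere of radius \<open>d\<close>
  contains many vertices; double counting over all centres turns this into a density of
  \<open>V\<close>. The sphere about \<open>{}\<close> gives the second bound.\<close>

lemma card_vertices_ge:
  assumes V: "V = {x \<in> cube n. \<xi> x}" and ev: "many_translates n d p \<xi>" and d: "d \<le> n"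
  shows "3 / 4 * p ^ 4 * 2 ^ n \<le> real (card V)" "3 / 4 * p ^ 4 * real (n choose d) \<le> real (card V)"
proof -
  let ?D = "real (n choose d)"
  have Vc: "V \<subseteq> cube n" using V by auto
  have finV: "finite V" using Vc finite_subset finite_cube by blast
  have *: "3 / 4 * p ^ 4 * ?D \<le> real (card {A \<in> slice n d. z \<oplus> A \<in> V})" if z: "z \<in> cube n" for z
  proof -
    have "3 / 4 * p ^ 4 * ?D \<le> real (card {J \<in> slice n d. \<forall>w\<in>{z, z, z, z}. \<xi> (w \<oplus> J)})"
      using ev[unfolded many_translates_def, rule_format, OF z z z z] by (rule less_imp_le)
    also have "{J \<in> slice n d. \<forall>w\<in>{z, z, z, z}. \<xi> (w \<oplus> J)} = {A \<in> slice n d. z \<oplus> A \<in> V}"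
      using z by (auto simp: V intro: xor_in_cube slice_cubeD)
    finally show ?thesis .
  qed
  have "?D * (3 / 4 * p ^ 4 * 2 ^ n) = (\<Sum>z\<in>cube n. 3 / 4 * p ^ 4 * ?D)"
    by (simp add: card_cube)
  also have "\<dots> \<le> (\<Sum>z\<in>cube n. real (card {A \<in> slice n d. z \<oplus> A \<in> V}))"
    by (rule sum_mono) (rule *)
  also have "\<dots> = ?D * real (card V)" by (rule sum_card_translates[OF Vc])
  finally show "3 / 4 * p ^ 4 * 2 ^ n \<le> real (card V)" using d by simp
  have "{} \<in> cube n" by (simp add: cube_def)
  from *[OF this] have "3 / 4 * p ^ 4 * ?D \<le> real (card {A \<in> slice n d. A \<in> V})" by simp
  also have "\<dots> \<le> real (card V)" using finV by (intro of_nat_mono card_mono) auto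
  finally show "3 / 4 * p ^ 4 * ?D \<le> real (card V)" .
qed

lemma with_high_probability_random_subsetI:
  assumes "f \<longlonglongrightarrow> 0"
    and "\<forall>\<^sub>F n in sequentially.
      measure_pmf.prob (random_bits n (p n)) {\<xi>. \<not> Q n (point n ` {x \<in> cube n. \<xi> x})} \<le> f n"
  shows "with_high_probability (\<lambda>n. random_subset n (p n)) Q"
  unfolding with_high_probability_def
proof (rule tendsto_sandwich)
  show "\<forall>\<^sub>F n in sequentially. 1 - f n \<le> measure_pmf.prob (random_subset n (p n)) {V. Q n V}"
    using assms(2)
  proof eventually_elim
    case (elim n)
    let ?A = "{\<xi>. Q n (point n ` {x \<in> cube n. \<xi> x})}"
    have "measure_pmf.prob (random_bits n (p n)) (- ?A) = 1 - measure_pmf.prob (random_bits n (p n)) ?A"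
      using measure_pmf.prob_compl[of ?A "random_bits n (p n)"] by (simp add: Compl_eq_Diff_UNIV)
    moreover have "measure_pmf.prob (random_subset n (p n)) {V. Q n V} = measure_pmf.prob (random_bits n (p n)) ?A"
      by (simp add: random_subset_eq_random_bits vimage_def)
    ultimately show ?case using elim by (simp add: Collect_neg_eq)
  qed
  show "(\<lambda>n. 1 - f n) \<longlonglongrightarrow> 1" using tendsto_diff[OF tendsto_const assms(1), of 1] by simp
qed auto

text \<open>With every vertex live, \<open>L = V\<close>, and the part of \<open>L\<close> outside
  \<open>U\<close> has at least half the size of \<open>V\<close>, that is at least
  \<open>3 / 8 * p ^ 4 * 2 ^ n\<close>. This cancels the \<open>2 ^ n\<close> in
  \<open>edge_boundary_lower_bound\<close>.\<close>

lemma edge_expansion_cube_graph_ge: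
  assumes V: "V = {x \<in> cube n. \<xi> x}"
    and live: "\<And>x. x \<in> cube n \<Longrightarrow> \<eta> * real n \<le> real (card {i. i < n \<and> \<not> \<xi> (x \<oplus> {i})})"
    and ev: "many_translates n d p \<xi>" "few_exceptional_translates n d \<eta> (p ^ 4 / 20) \<xi>"
      "many_squares n d q (\<eta>\<^sup>2 * real n / 2) \<xi>"
    and p: "0 < p" "p \<le> 1" and q: "0 \<le> q" "q \<le> p" and \<eta>: "0 < \<eta>" "\<eta> \<le> 1"
    and d: "odd d" "2 * d \<le> n" "real d \<le> \<eta>\<^sup>2 * real n / 4" and big: "2 \<le> 3 / 4 * p ^ 4 * real (n choose d)"
    and c: "0 \<le> c" "c \<le> \<eta>\<^sup>2 / 15360"
  shows "c ^ d * q ^ 22 * real (n choose d) / real n \<le> edge_expansion (cube_graph n d (point n ` V))"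
proof (rule edge_expansion_ge)
  let ?G = "cube_graph n d (point n ` V)" and ?D = "real (n choose d)"
  show Vc: "V \<subseteq> cube n" using V by auto
  have finV: "finite V" using Vc finite_subset finite_cube by blast
  have dn: "d \<le> n" using d by simp
  have n0: "n > 0" using d by (auto elim: oddE)
  note cV = card_vertices_ge[OF V ev(1) dn]
  show "2 \<le> card V" using cV(2) big by linarith
  show "vertices ?G = point n ` V" by (simp add: vertices_def cube_graph_def)
  fix U assume U: "U \<subseteq> V" "U \<noteq> {}" "2 * card U \<le> card V"
  define L where "L = {x \<in> V. \<eta> * real n \<le> real (card (nonneighbours n V x))}"
  have "L = V"
  proof -
    have "{i. i < n \<and> \<not> \<xi> (x \<oplus> {i})} = nonneighbours n V x" if "x \<in> cube n" for x
      using that by (auto simp: nonneighbours_def V intro: xor_in_cube singleton_in_cube)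
    thus ?thesis using live Vc by (auto simp: L_def)
  qed
  hence LU: "card (L \<inter> U) = card U" "card (L - U) = card V - card U"
    using U finV finite_subset[OF U(1) finV] by (auto simp: Int_absorb1 card_Diff_subset)
  define b where "b = real (card (boundary_steps n d (adjacent d V) V U))"
  have "b \<le> real (card (edge_boundary ?G (point n ` U)))"
    unfolding b_def of_nat_le_iff
    by (rule card_edge_boundary_ge[OF Vc U(1) adjacent_edge[OF Vc] edges_cube_graph_subset])
  moreover have "c ^ d * q ^ 22 * ?D / real n * real (card U) \<le> b"
  proof -
    define k where "k = \<eta>\<^sup>2 / 4"
    have k0: "k > 0" using \<eta> by (simp add: k_def)
    have "real (card (L - U)) = real (card V) - real (card U)" using LU U by simp
    moreover have "2 * real (card U) \<le> real (card V)" using U(3) by linarith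
    ultimately have W: "3 / 8 * p ^ 4 * 2 ^ n \<le> real (card (L - U))" using cV(1) by linarith
    \<comment> \<open>Since \<open>d \<ge> 1\<close>, the numerical factor 3840 = 1440 * 8 / 3 can
      be absorbed into the base; 15360 = 4 * 3840.\<close>
    have cd: "c ^ d \<le> k ^ d / 3840"
    proof -
      have "c ^ d \<le> (k / 3840) ^ d" using c by (intro power_mono) (auto simp: k_def)
      also have "\<dots> = k ^ d / 3840 ^ d" by (simp add: power_divide)
      also have "\<dots> \<le> k ^ d / 3840 ^ 1"
        using d(1) k0 by (intro divide_left_mono power_increasing) (auto elim: oddE)
      finally show ?thesis by simp
    qed
    \<comment> \<open>Here 16 = 12 + 4, where 12 belongs to the path count and 4 to the size of
      \<open>V\<close>; the remaining \<open>q ^ 3\<close> is bounded by 1.\<close>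
    have q22: "q ^ 22 \<le> q ^ 3 * p ^ 16"
    proof -
      have "q ^ 22 = q ^ 3 * (q ^ 16 * q ^ 3)" by (simp flip: power_add)
      also have "\<dots> \<le> q ^ 3 * (p ^ 16 * 1)"
        using q p by (intro mult_left_mono mult_mono power_mono power_le_one) auto
      finally show ?thesis by simp
    qed
    have "c ^ d * q ^ 22 * ?D * real (card U) \<le> k ^ d / 3840 * (q ^ 3 * p ^ 16) * ?D * real (card U)"
      using cd q22 q p c k0 by (intro mult_right_mono mult_mono) auto
    also have "\<dots> = q ^ 3 * p ^ 12 * k ^ d * ?D * (real (card U) * (3 / 8 * p ^ 4 * 2 ^ n)) / (1440 * 2 ^ n)"
      by (simp add: field_simps flip: power_add)
    also have "\<dots> \<le> q ^ 3 * p ^ 12 * k ^ d * ?D * (real (card U) * real (card (L - U))) / (1440 * 2 ^ n)"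
      using W q p k0 by (intro divide_right_mono mult_left_mono) auto
    also have "\<dots> \<le> 1440 * real n * 2 ^ n * b / (1440 * 2 ^ n)"
      using edge_boundary_lower_bound[OF V L_def ev p(1) q(1) \<eta> d U(1)] LU(1)
      by (intro divide_right_mono) (auto simp: b_def k_def)
    also have "\<dots> = real n * b" by simp
    finally show ?thesis using n0 by (simp add: field_simps)
  qed
  ultimately show "c ^ d * q ^ 22 * ?D / real n * real (card U) \<le> real (card (edge_boundary ?G (point n ` U)))"
    by linarith
qed

text \<open>If \<open>K\<close> of the points \<open>x \<oplus> {j}\<close> had fewer than
  \<open>\<eta> * n\<close> missing neighbours, the missing points \<open>x \<oplus> {j, i}\<close>
  would number at most \<open>K * \<eta> * n \<le> \<epsilon> * K * n / 4\<close>, against the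
  hypothesis for the set \<open>Y\<close> of these \<open>j\<close>.\<close>

lemma dead_neighbours_few:
  fixes \<xi> :: "nat set \<Rightarrow> bool"
  assumes ev: "\<And>Y. Y \<subseteq> {..<n} \<Longrightarrow> card Y = K \<Longrightarrow>
      \<epsilon> * real K * real n / 4 < real (card {(j, i) \<in> Y \<times> ({..<n} - Y). \<not> \<xi> (x \<oplus> {j, i})})"
    and \<eta>: "\<eta> \<le> \<epsilon> / 4"
  shows "card {j. j < n \<and> real (card {i. i < n \<and> \<not> \<xi> (x \<oplus> {j} \<oplus> {i})}) < \<eta> * real n} < K"
    (is "card ?B < K")
proof (rule ccontr)
  assume "\<not> card ?B < K"
  hence "K \<le> card ?B" by simp
  from obtain_subset_with_card_n[OF this]
  obtain Y where Y: "Y \<subseteq> ?B" "card Y = K" "finite Y" .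
  let ?N = "\<lambda>j. {i. i < n \<and> \<not> \<xi> (x \<oplus> {j} \<oplus> {i})}"
  have sub: "{(j, i) \<in> Y \<times> ({..<n} - Y). \<not> \<xi> (x \<oplus> {j, i})} \<subseteq> Sigma Y ?N"
  proof
    fix t assume "t \<in> {(j, i) \<in> Y \<times> ({..<n} - Y). \<not> \<xi> (x \<oplus> {j, i})}"
    then obtain j i where t: "t = (j, i)" and *: "j \<in> Y" "i < n" "i \<notin> Y" "\<not> \<xi> (x \<oplus> {j, i})" by auto
    hence "{j} \<oplus> {i} = {j, i}" by (auto simp: xor_def)
    hence "x \<oplus> {j} \<oplus> {i} = x \<oplus> {j, i}" by (simp only: xor_assoc)
    thus "t \<in> Sigma Y ?N" using * t by simp
  qed
  have "\<epsilon> * real K * real n / 4 < real (card {(j, i) \<in> Y \<times> ({..<n} - Y). \<not> \<xi> (x \<oplus> {j, i})})"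
    using Y by (intro ev) auto
  also have "\<dots> \<le> real (card (Sigma Y ?N))"
    using Y by (intro of_nat_mono card_mono[OF _ sub] finite_SigmaI) auto
  also have "\<dots> = (\<Sum>j\<in>Y. real (card (?N j)))" using Y by simp
  also have "\<dots> \<le> (\<Sum>j\<in>Y. \<eta> * real n)" using Y by (intro sum_mono) (auto intro: less_imp_le)
  also have "\<dots> = real K * (\<eta> * real n)" using Y by simp
  also have "\<dots> \<le> real K * (\<epsilon> / 4 * real n)" using \<eta> by (intro mult_left_mono mult_right_mono) auto
  finally show False by simp
qed

text \<open>If at least half of \<open>U\<close> is dead, edges of length 1 suffice: a dead vertex
  has many live neighbours, a live vertex has at most \<open>K\<close> dead ones, so most of these
  edges leave \<open>U\<close>. Otherwise half of \<open>U\<close> is live and the bound for edges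
  of length 3 applies, once the dead vertices are known to be at most a quarter of
  \<open>V\<close>.\<close>

lemma edge_expansion_union_ge:
  assumes V: "V = {x \<in> cube n. \<xi> x}"
    and dead: "\<And>x. x \<in> cube n \<Longrightarrow>
      card {j. j < n \<and> real (card {i. i < n \<and> \<not> \<xi> (x \<oplus> {j} \<oplus> {i})}) < \<eta> * real n} < K"
    and ev: "many_translates n 3 p \<xi>" "few_exceptional_translates n 3 \<eta> (p ^ 4 / 20) \<xi>"
      "many_squares n 3 q (\<eta>\<^sup>2 * real n / 2) \<xi>"
    and p: "0 < p" "p \<le> 1" and q: "0 \<le> q" and \<eta>: "0 < \<eta>" "\<eta> \<le> 1 / 4"
    and n: "8 * K \<le> n" "8 \<le> n" "3 \<le> \<eta>\<^sup>2 * real n / 4" and big: "2 \<le> 3 / 4 * p ^ 4 * real (n choose 3)"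
    and c: "c \<le> 1 / 8" "c \<le> q ^ 3 * p ^ 16 * (\<eta>\<^sup>2 / 4) ^ 3 / 92160"
  shows "c * real n \<le> edge_expansion (graph_union (cube_graph n 1 (point n ` V)) (cube_graph n 3 (point n ` V)))"
proof (rule edge_expansion_ge)
  let ?G = "graph_union (cube_graph n 1 (point n ` V)) (cube_graph n 3 (point n ` V))" and ?D = "real (n choose 3)"
  show Vc: "V \<subseteq> cube n" using V by auto
  have finV: "finite V" using Vc finite_subset finite_cube by blast
  have n3: "3 \<le> n" "2 * 3 \<le> n" using n by auto
  note cV = card_vertices_ge[OF V ev(1) n3(1)]
  show "2 \<le> card V" using cV(2) big by linarith
  show "vertices ?G = point n ` V" by (simp add: vertices_def cube_graph_def graph_union_def)
  have edges: "edges ?G = edges (cube_graph n 1 (point n ` V)) \<union> edges (cube_graph n 3 (point n ` V))"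
    by (simp add: edges_def graph_union_def)
  define L where "L = {x \<in> V. \<eta> * real n \<le> real (card (nonneighbours n V x))}"
  have nonneigh: "nonneighbours n V x = {i. i < n \<and> \<not> \<xi> (x \<oplus> {i})}" if "x \<in> cube n" for x
    using that by (auto simp: nonneighbours_def V intro: xor_in_cube singleton_in_cube)
  have few: "card {j. j < n \<and> x \<oplus> {j} \<in> V - L} \<le> K" if x: "x \<in> cube n" for x
  proof -
    have "{j. j < n \<and> x \<oplus> {j} \<in> V - L} \<subseteq> {j. j < n \<and> real (card {i. i < n \<and> \<not> \<xi> (x \<oplus> {j} \<oplus> {i})}) < \<eta> * real n}"
      using x nonneigh by (auto simp: L_def xor_in_cube singleton_in_cube)
    hence "card {j. j < n \<and> x \<oplus> {j} \<in> V - L} \<le> card {j. j < n \<and> real (card {i. i < n \<and> \<not> \<xi> (x \<oplus> {j} \<oplus> {i})}) < \<eta> * real n}"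
      by (intro card_mono) auto
    thus ?thesis using dead[OF x] by linarith
  qed
  define B1 where "B1 = (\<lambda>U. boundary_steps n 1 (adjacent 1 V) V U)"
  \<comment> \<open>Double counting of edges from dead vertices of \<open>U\<close> to live
    vertices. Of the \<open>n\<close> directions at a dead vertex at most a quarter are missing and
    at most \<open>K \<le> n / 8\<close> lead to dead vertices, so over half lead to live ones. Such
    an edge either stays in \<open>U\<close>, counted from its live end, or leaves
    \<open>U\<close>.\<close>
  have dead_count: "real n / 2 * real (card (U - L)) \<le> real K * real (card (U \<inter> L)) + real (card (B1 U))"
    if U: "U \<subseteq> V" for U
  proof -
    have finU: "finite U" using U finV finite_subset by blast
    define P where "P = (SIGMA u:U - L. {j. j < n \<and> u \<oplus> {j} \<in> L})"
    define P1 where "P1 = (SIGMA v:U \<inter> L. {j. j < n \<and> v \<oplus> {j} \<in> V - L})"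
    have "real n / 2 \<le> real (card {j. j < n \<and> u \<oplus> {j} \<in> L})" if u: "u \<in> U - L" for u
    proof -
      have uc: "u \<in> cube n" "u \<in> V" using u U Vc by auto
      have "{..<n} \<subseteq> {j. j < n \<and> u \<oplus> {j} \<in> L} \<union> nonneighbours n V u \<union> {j. j < n \<and> u \<oplus> {j} \<in> V - L}"
        by (auto simp: nonneighbours_def)
      hence "card {..<n} \<le> card ({j. j < n \<and> u \<oplus> {j} \<in> L} \<union> nonneighbours n V u \<union> {j. j < n \<and> u \<oplus> {j} \<in> V - L})"
        by (intro card_mono) (auto simp: nonneighbours_def)
      also have "\<dots> \<le> card {j. j < n \<and> u \<oplus> {j} \<in> L} + card (nonneighbours n V u) + K"
        by (intro order.trans[OF card_Un_le] add_mono few[OF uc(1)] order.refl)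
      finally have "real n \<le> real (card {j. j < n \<and> u \<oplus> {j} \<in> L}) + real (card (nonneighbours n V u)) + real K"
        by simp
      moreover have "real (card (nonneighbours n V u)) < \<eta> * real n" using u uc by (auto simp: L_def)
      moreover have "\<eta> * real n \<le> 1 / 4 * real n" using \<eta> by (intro mult_right_mono) auto
      moreover have "8 * real K \<le> real n" using n by linarith
      ultimately show ?thesis by linarith
    qed
    hence "(\<Sum>u\<in>U - L. real n / 2) \<le> (\<Sum>u\<in>U - L. real (card {j. j < n \<and> u \<oplus> {j} \<in> L}))"
      by (rule sum_mono)
    also have "\<dots> = real (card P)" unfolding P_def using finU by simp
    finally have 1: "real n / 2 * real (card (U - L)) \<le> real (card P)" by (simp add: mult.commute)
    have finP: "finite P" "finite P1" unfolding P_def P1_def using finU by auto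
    have "card P1 = (\<Sum>v\<in>U \<inter> L. card {j. j < n \<and> v \<oplus> {j} \<in> V - L})" unfolding P1_def using finU by simp
    also have "\<dots> \<le> (\<Sum>v\<in>U \<inter> L. K)" using U Vc by (intro sum_mono few) auto
    finally have P1: "card P1 \<le> K * card (U \<inter> L)" by (simp add: mult.commute)
    have "card P = card {t \<in> P. fst t \<oplus> {snd t} \<in> U} + card {t \<in> P. fst t \<oplus> {snd t} \<notin> U}"
      using finP by (subst card_Un_disjoint[symmetric]) (auto intro: arg_cong[of _ _ card])
    also have "card {t \<in> P. fst t \<oplus> {snd t} \<in> U} \<le> card P1"
    proof (rule card_inj_on_le[where f = "\<lambda>(u, j). (u \<oplus> {j}, j)"])
      show "inj_on (\<lambda>(u, j). (u \<oplus> {j}, j)) {t \<in> P. fst t \<oplus> {snd t} \<in> U}" by (auto intro!: inj_onI)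
      show "(\<lambda>(u, j). (u \<oplus> {j}, j)) ` {t \<in> P. fst t \<oplus> {snd t} \<in> U} \<subseteq> P1"
        using U by (auto simp: P_def P1_def)
    qed (rule finP)
    also have "card {t \<in> P. fst t \<oplus> {snd t} \<notin> U} \<le> card (B1 U)"
    proof (rule card_inj_on_le[where f = "\<lambda>(u, j). (u, {j})"])
      show "inj_on (\<lambda>(u, j). (u, {j})) {t \<in> P. fst t \<oplus> {snd t} \<notin> U}" by (auto intro!: inj_onI)
      show "(\<lambda>(u, j). (u, {j})) ` {t \<in> P. fst t \<oplus> {snd t} \<notin> U} \<subseteq> B1 U"
        using U by (auto simp: P_def B1_def boundary_steps_def slice_def L_def adjacent_def)
      show "finite (B1 U)" unfolding B1_def by (rule finite_boundary_steps[OF finU])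
    qed
    finally have "card P \<le> K * card (U \<inter> L) + card (B1 U)" using P1 by linarith
    hence "real (card P) \<le> real (K * card (U \<inter> L) + card (B1 U))" by (simp only: of_nat_le_iff)
    thus ?thesis using 1 by simp
  qed
  fix U assume U: "U \<subseteq> V" "U \<noteq> {}" "2 * card U \<le> card V"
  have finU: "finite U" using U finV finite_subset by blast
  have K: "8 * real K \<le> real n" using n by linarith
  have sumU: "real (card U) = real (card (U \<inter> L)) + real (card (U - L))"
    using finU by (simp add: card_Int_Diff flip: of_nat_add)
  let ?b = "real (card (edge_boundary ?G (point n ` U)))"
  have b1: "real (card (B1 U)) \<le> ?b"
    unfolding of_nat_le_iff B1_def
    by (rule card_edge_boundary_ge[OF Vc U(1)])
       (use adjacent_edge[OF Vc] edges_cube_graph_subset edges in auto)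
  have b3: "real (card (boundary_steps n 3 (adjacent 3 V) V U)) \<le> ?b"
    unfolding of_nat_le_iff
    by (rule card_edge_boundary_ge[OF Vc U(1)])
       (use adjacent_edge[OF Vc] edges_cube_graph_subset edges in auto)
  show "c * real n * real (card U) \<le> ?b"
  proof (cases "real (card U) \<le> 2 * real (card (U - L))")
    case True
    have "real n / 2 * (real (card U) / 2) \<le> real n / 2 * real (card (U - L))"
      using True by (intro mult_left_mono) auto
    also have "\<dots> \<le> real K * real (card (U \<inter> L)) + real (card (B1 U))" by (rule dead_count[OF U(1)])
    also have "real K * real (card (U \<inter> L)) \<le> real n / 8 * real (card U)"
      using K sumU by (intro mult_mono) auto
    finally have "real n / 8 * real (card U) \<le> real (card (B1 U))" by simp
    moreover have "c * real n * real (card U) \<le> 1 / 8 * real n * real (card U)"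
      using c by (intro mult_right_mono) auto
    ultimately show ?thesis using b1 by simp
  next
    case False
    \<comment> \<open>All of \<open>V\<close> has empty boundary, so the same inequality with
      \<open>U = V\<close> bounds the total number of dead vertices.\<close>
    have "B1 V = {}" by (auto simp: B1_def boundary_steps_def)
    hence "real n / 2 * real (card (V - L)) \<le> real K * real (card (V \<inter> L))"
      using dead_count[of V] by simp
    also have "\<dots> \<le> real n / 8 * real (card V)"
      using K finV by (intro mult_mono of_nat_mono card_mono) auto
    finally have "real n * (real (card (V - L)) * 4) \<le> real n * real (card V)" by simp
    hence VL: "real (card (V - L)) * 4 \<le> real (card V)" using n by simp
    have "V \<subseteq> (V - L) \<union> U \<union> (L - U)" by auto
    hence "card V \<le> card ((V - L) \<union> U \<union> (L - U))"
      using finV finU by (intro card_mono) (auto simp: L_def)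
    also have "\<dots> \<le> card (V - L) + card U + card (L - U)"
      by (intro order.trans[OF card_Un_le] add_mono order.refl)
    finally have "real (card V) \<le> real (card (V - L)) + real (card U) + real (card (L - U))"
      by simp
    moreover have "2 * real (card U) \<le> real (card V)" using U(3) by linarith
    ultimately have "real (card V) / 4 \<le> real (card (L - U))" using VL by linarith
    hence W: "3 / 16 * p ^ 4 * 2 ^ n \<le> real (card (L - U))" using cV(1) by linarith
    have U': "real (card U) / 2 \<le> real (card (L \<inter> U))" using False sumU by (simp add: Int_commute)
    define A where "A = q ^ 3 * p ^ 12 * (\<eta>\<^sup>2 / 4) ^ 3"
    have A0: "A \<ge> 0" using q p by (simp add: A_def)
    \<comment> \<open>A quadratic bound for the cubic binomial is enough: one factor
      \<open>n\<close> cancels the loss in \<open>edge_boundary_lower_bound\<close>, the other is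
      the expansion claimed.\<close>
    have D: "real n * real n / 6 \<le> ?D"
    proof -
      have "?D = (\<Prod>i = 0..<3. real (n - i) / real (3 - i))"
        by (rule binomial_altdef_of_nat[OF n3(1)])
      also have "\<dots> = real n * ((real n - 1) * (real n - 2)) / 6"
        using n by (simp add: eval_nat_numeral of_nat_diff)
      finally have eq: "?D = real n * ((real n - 1) * (real n - 2)) / 6" .
      have "8 * real n \<le> real n * real n" using n by (intro mult_right_mono) auto
      hence "real n \<le> (real n - 1) * (real n - 2)" by (simp add: algebra_simps)
      thus ?thesis unfolding eq by (intro divide_right_mono mult_left_mono) auto
    qed
    have "A * (real n * real n / 6) * (real (card U) / 2 * (3 / 16 * p ^ 4 * 2 ^ n))
        \<le> A * ?D * (real (card (L \<inter> U)) * real (card (L - U)))"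
      using D U' W A0 p by (intro mult_mono mult_left_mono) auto
    also have "\<dots> \<le> 1440 * real n * 2 ^ n * real (card (boundary_steps n 3 (adjacent 3 V) V U))"
      using edge_boundary_lower_bound[OF V L_def ev p(1) q \<eta>(1) _ _ n3(2) _ U(1)] \<eta> n(3) unfolding A_def by simp
    also have "\<dots> \<le> 1440 * real n * 2 ^ n * ?b" using b3 by (intro mult_left_mono) auto
    \<comment> \<open>92160 = 1440 * 64, where 1/64 is the product of 1/6 from the binomial, 1/2
      from the live half of \<open>U\<close> and 3/16 from the live vertices outside
      \<open>U\<close>.\<close>
    finally have "1440 * real n * 2 ^ n * (A * p ^ 4 / 92160 * real n * real (card U)) \<le> 1440 * real n * 2 ^ n * ?b"
      by (simp add: field_simps)
    hence "A * p ^ 4 / 92160 * real n * real (card U) \<le> ?b"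
      by (rule mult_left_le_imp_le) (use n in simp)
    moreover have "c * real n * real (card U) \<le> A * p ^ 4 / 92160 * real n * real (card U)"
      using c unfolding A_def by (intro mult_right_mono) (auto simp: mult_ac simp flip: power_add)
    ultimately show ?thesis by linarith
  qed
qed

text \<open>With \<open>a = \<epsilon> / 2\<close> the base \<open>2 * (p + (1 - p) * a)\<close> is
  at most \<open>1 - \<epsilon>\<close>; this is where p has to stay below 1/2. The condition on
  \<open>\<eta>\<close> says that \<open>a powr (- \<eta>)\<close> is at most
  \<open>1 + \<epsilon> / 2\<close>, and the product of the two stays below
  \<open>1 - \<epsilon> / 2\<close>.\<close>

lemma prob_exists_few_nonneighbours:
  assumes p: "0 \<le> p" "p < 1 / 2 - \<epsilon>" and \<epsilon>: "0 < \<epsilon>" "\<epsilon> \<le> 1 / 4" and \<eta>: "\<eta> * ln (2 / \<epsilon>) \<le> ln (1 + \<epsilon> / 2)"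
  shows "measure_pmf.prob (random_bits n p)
     {\<xi>. \<exists>x\<in>cube n. real (card {i. i < n \<and> \<not> \<xi> (x \<oplus> {i})}) < \<eta> * real n} \<le> (1 - \<epsilon> / 2) ^ n"
proof -
  define a where "a = \<epsilon> / 2"
  have a: "0 < a" "a < 1" using \<epsilon> by (auto simp: a_def)
  define b where "b = (p + (1 - p) * a) ^ n * a powr (- (\<eta> * real n))"
  have "measure_pmf.prob (random_bits n p)
     {\<xi>. \<exists>x\<in>cube n. real (card {i. i < n \<and> \<not> \<xi> (x \<oplus> {i})}) < \<eta> * real n} \<le> 2 ^ n * b"
  proof (rule prob_union_bound)
    show "measure_pmf.prob (random_bits n p) {\<xi>. real (card {i. i < n \<and> \<not> \<xi> (x \<oplus> {i})}) < \<eta> * real n} \<le> b"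
      if "x \<in> cube n" for x
      unfolding b_def using p \<epsilon> by (intro prob_few_nonneighbours a that) auto
    have "0 \<le> p + (1 - p) * a" using p a \<epsilon> by (intro add_nonneg_nonneg mult_nonneg_nonneg) auto
    thus "b \<ge> 0" by (simp add: b_def)
  qed (auto simp: card_cube)
  also have "2 ^ n * b = (2 * (p + (1 - p) * a) * a powr (- \<eta>)) ^ n"
  proof -
    have "a powr (- (\<eta> * real n)) = (a powr (- \<eta>)) ^ n"
      using a by (simp add: powr_realpow[symmetric] powr_powr)
    thus ?thesis by (simp only: b_def power_mult_distrib mult.assoc)
  qed
  also have "\<dots> \<le> (1 - \<epsilon> / 2) ^ n"
  proof (rule power_mono)
    have "a powr (- \<eta>) = exp (\<eta> * ln (2 / \<epsilon>))"
      using \<epsilon> by (simp add: powr_def a_def ln_div algebra_simps)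
    also have "\<dots> \<le> exp (ln (1 + \<epsilon> / 2))" using \<eta> by simp
    also have "\<dots> = 1 + \<epsilon> / 2" using \<epsilon> by simp
    finally have 1: "a powr (- \<eta>) \<le> 1 + \<epsilon> / 2" .
    have "(1 - p) * a \<le> 1 * a" using p a by (intro mult_right_mono) auto
    hence 2: "2 * (p + (1 - p) * a) \<le> 1 - \<epsilon>" using p by (simp add: a_def)
    have 0: "0 \<le> p + (1 - p) * a" using p a \<epsilon> by (intro add_nonneg_nonneg mult_nonneg_nonneg) auto
    have "2 * (p + (1 - p) * a) * a powr (- \<eta>) \<le> (1 - \<epsilon>) * (1 + \<epsilon> / 2)"
      using 0 1 2 \<epsilon> by (intro mult_mono) auto
    also have "\<dots> \<le> 1 - \<epsilon> / 2" by (simp add: algebra_simps)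
    finally show "2 * (p + (1 - p) * a) * a powr (- \<eta>) \<le> 1 - \<epsilon> / 2" .
    show "0 \<le> 2 * (p + (1 - p) * a) * a powr (- \<eta>)" using 0 by simp
  qed
  finally show ?thesis .
qed

text \<open>The bound on \<open>K\<close> makes the exponent
  \<open>\<epsilon>\<^sup>2 * K * n / 4\<close> at least \<open>5 * n\<close>, against at most
  \<open>4 ^ n\<close> pairs of a point and a \<open>K\<close>-set.\<close>

lemma prob_exists_clustered_dead:
  assumes p: "0 \<le> p" "p \<le> 1 - \<epsilon>" and \<epsilon>: "0 < \<epsilon>" and K: "20 / \<epsilon>\<^sup>2 \<le> real K" "2 * K \<le> n"
  shows "measure_pmf.prob (random_bits n p)
     {\<xi>. \<exists>k\<in>cube n \<times> slice n K. (\<lambda>(x, Y). real (card {(j, i) \<in> Y \<times> ({..<n} - Y). \<not> \<xi> (x \<oplus> {j, i})})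
        \<le> \<epsilon> * real K * real n / 4) k} \<le> exp (- real n)"
proof -
  have "0 < 20 / \<epsilon>\<^sup>2" using \<epsilon> by simp
  hence K0: "K > 0" using K by linarith
  have "measure_pmf.prob (random_bits n p)
     {\<xi>. \<exists>k\<in>cube n \<times> slice n K. (\<lambda>(x, Y). real (card {(j, i) \<in> Y \<times> ({..<n} - Y). \<not> \<xi> (x \<oplus> {j, i})})
        \<le> \<epsilon> * real K * real n / 4) k} \<le> 4 ^ n * exp (- (\<epsilon>\<^sup>2 * real K * real n / 4))"
  proof (rule prob_union_bound)
    have "card (cube n \<times> slice n K) \<le> card (cube n \<times> cube n)"
      using slice_subset_cube by (intro card_mono) auto
    also have "\<dots> = 4 ^ n" by (simp add: card_cartesian_product card_cube flip: power_mult_distrib)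
    finally have "card (cube n \<times> slice n K) \<le> 4 ^ n" .
    from of_nat_mono[OF this, where 'a = real]
    show "real (card (cube n \<times> slice n K)) \<le> 4 ^ n" by (simp only: of_nat_power of_nat_numeral)
    fix k assume "k \<in> cube n \<times> slice n K"
    then obtain x Y where k: "k = (x, Y)" and x: "x \<in> cube n" and Y: "Y \<subseteq> {..<n}" "card Y = K"
      by (auto simp: slice_def)
    have "Y \<noteq> {}" using Y K0 by auto
    from prob_clustered_dead[OF p \<epsilon> x Y(1) this] K(2) Y(2)
    show "measure_pmf.prob (random_bits n p) {\<xi>. (\<lambda>(x, Y). real (card {(j, i) \<in> Y \<times> ({..<n} - Y). \<not> \<xi> (x \<oplus> {j, i})})
        \<le> \<epsilon> * real K * real n / 4) k} \<le> exp (- (\<epsilon>\<^sup>2 * real K * real n / 4))"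
      by (simp add: k)
  qed auto
  also have "\<dots> \<le> exp (- real n)"
  proof (rule power_exp_decay)
    have "20 \<le> \<epsilon>\<^sup>2 * real K" using K \<epsilon> by (simp add: field_simps)
    hence "20 * real n \<le> \<epsilon>\<^sup>2 * real K * real n" by (rule mult_right_mono) simp
    thus "5 * real n \<le> \<epsilon>\<^sup>2 * real K * real n / 4" by simp
  qed auto
  finally show ?thesis .
qed

theorem theorem3p7:
  fixes \<epsilon> :: real
  assumes "\<epsilon> > 0"
  shows
    "(\<exists>c\<^sub>0::real. c\<^sub>0 > 0 \<and>
        (\<forall>p :: nat \<Rightarrow> real.
           (\<forall>\<^sub>F n in sequentially. \<epsilon> < p n \<and> p n < 1 - \<epsilon>) \<longrightarrow>
           with_high_probability (\<lambda>n. random_subset n (p n))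
             (\<lambda>n V. edge_expansion (graph_union (cube_graph n 1 V) (cube_graph n 3 V))
                      \<ge> c\<^sub>0 * real n)))
     \<and>
     (\<exists>c\<^sub>0::real. c\<^sub>0 > 0 \<and>
        (\<forall>(p :: nat \<Rightarrow> real) (d :: nat \<Rightarrow> nat) (q :: nat \<Rightarrow> real).
           (\<forall>n. q n = p n * (1 - p n) ^ (2 ^ d n - 2)) \<longrightarrow>
           (\<forall>\<^sub>F n in sequentially.
              0 < p n \<and> p n < 1 / 2 - \<epsilon> \<and>
              3 \<le> d n \<and> odd (d n) \<and>
              q n \<ge> real n powr (- 0.1) \<and>
              real (d n) \<le> c\<^sub>0 * ln (real n)) \<longrightarrow>
           with_high_probability (\<lambda>n. random_subset n (p n))
             (\<lambda>n V. edge_expansion (cube_graph n (d n) V)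
                      \<ge> c\<^sub>0 ^ d n * q n ^ 22 * real (n choose d n) / real n)))"
proof -
  \<comment> \<open>Shrinking \<epsilon> only weakens the hypotheses on \<open>p\<close>, so it may
    be capped; the cap gives \<open>ln (2 / e) > 0\<close> and
    \<open>\<eta> \<le> 1 / 4\<close>.\<close>
  define e where "e = min \<epsilon> (1 / 4)"
  have e: "0 < e" "e \<le> 1 / 4" "e \<le> \<epsilon>" "e \<le> 1" using assms by (auto simp: e_def)
  \<comment> \<open>The first bound provides common missing directions for typical pairs, and the
    second makes all points live when p is below \<open>1 / 2 - e\<close>.\<close>
  define \<eta> where "\<eta> = min (e\<^sup>2 / 4) (ln (1 + e / 2) / ln (2 / e))"
  have ln2: "ln (2 / e) > 0" using e by simp
  have "0 < ln (1 + e / 2) / ln (2 / e)" using e by (intro divide_pos_pos ln2) simp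
  hence \<eta>: "0 < \<eta>" "\<eta> \<le> e\<^sup>2 / 4"
    using e by (simp_all only: \<eta>_def min_less_iff_conj min.cobounded1) simp
  have \<eta>ln: "\<eta> * ln (2 / e) \<le> ln (1 + e / 2)"
    using ln2 by (simp add: \<eta>_def min_def field_simps)
  have "e\<^sup>2 \<le> e" using e by (simp add: power2_eq_square mult_left_le)
  hence \<eta>e: "\<eta> \<le> e / 4" using \<eta> by simp
  hence \<eta>4: "\<eta> \<le> 1 / 4" using e by linarith
  obtain c where c: "c > 0" and ev:
    "\<forall>\<^sub>F n in sequentially. \<forall>p d q. 0 < p \<and> p \<le> 1 - e \<and> 3 \<le> d \<and> q = p * (1 - p) ^ (2 ^ d - 2) \<and>
       real n powr (- 0.1) \<le> q \<and> real d \<le> c * ln (real n) \<longrightarrow>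
       2 * d \<le> n \<and> real d \<le> \<eta>\<^sup>2 * real n / 4 \<and> 2 \<le> 3 / 4 * p ^ 4 * real (n choose d) \<and>
       measure_pmf.prob (random_bits n p) {\<xi>. \<not> (many_translates n d p \<xi> \<and>
         few_exceptional_translates n d \<eta> (p ^ 4 / 20) \<xi> \<and> many_squares n d q (\<eta>\<^sup>2 * real n / 2) \<xi>)}
       \<le> 3 * exp (- real n)"
    using eventually_expansion_events[OF e(1,4) \<eta>] by blast

  have a: "\<exists>c\<^sub>0::real. c\<^sub>0 > 0 \<and> (\<forall>p :: nat \<Rightarrow> real.
     (\<forall>\<^sub>F n in sequentially. \<epsilon> < p n \<and> p n < 1 - \<epsilon>) \<longrightarrow>
     with_high_probability (\<lambda>n. random_subset n (p n))
       (\<lambda>n V. edge_expansion (graph_union (cube_graph n 1 V) (cube_graph n 3 V)) \<ge> c\<^sub>0 * real n))"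
  proof -
    \<comment> \<open>For \<open>d = 3\<close> the exponent \<open>2 ^ d - 2\<close> is 6, hence
      \<open>q \<ge> e ^ 7\<close>. The second term is the bound of
      \<open>edge_expansion_union_ge\<close> with \<open>q\<close> and \<open>p\<close> at their
      lower bounds, and 1/8 is the expansion found for mostly dead sets.\<close>
    define c0 where "c0 = min (1 / 8) ((e ^ 7) ^ 3 * e ^ 16 * (\<eta>\<^sup>2 / 4) ^ 3 / 92160)"
    define K where "K = nat \<lceil>20 / e\<^sup>2\<rceil>"
    have K: "20 / e\<^sup>2 \<le> real K" unfolding K_def by linarith
    have c0: "c0 > 0" using e \<eta> by (simp add: c0_def)
    have e7: "e ^ 7 > 0" "c > 0" using e c by auto
    \<comment> \<open>With \<open>d = 3\<close> and \<open>q\<close> bounded below by a constant,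
      the conditions on \<open>q\<close> and \<open>d\<close> in terms of \<open>n\<close> hold
      eventually.\<close>
    have E1: "\<forall>\<^sub>F n in sequentially. real n powr (- 0.1) \<le> e ^ 7"
      using e7(1) by real_asymp
    have E2: "\<forall>\<^sub>F n in sequentially. 3 \<le> c * ln (real n)"
      using e7(2) by real_asymp
    have "with_high_probability (\<lambda>n. random_subset n (p n))
       (\<lambda>n V. edge_expansion (graph_union (cube_graph n 1 V) (cube_graph n 3 V)) \<ge> c0 * real n)"
      if p: "\<forall>\<^sub>F n in sequentially. \<epsilon> < p n \<and> p n < 1 - \<epsilon>" for p
    proof (rule with_high_probability_random_subsetI)
      show "(\<lambda>n. 3 * exp (- real n) + exp (- real n)) \<longlonglongrightarrow> 0" by real_asymp
      show "\<forall>\<^sub>F n in sequentially. measure_pmf.prob (random_bits n (p n))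
          {\<xi>. \<not> c0 * real n \<le> edge_expansion (graph_union (cube_graph n 1 (point n ` {x \<in> cube n. \<xi> x}))
             (cube_graph n 3 (point n ` {x \<in> cube n. \<xi> x})))} \<le> 3 * exp (- real n) + exp (- real n)"
        using p ev E1 E2 eventually_ge_at_top[of "8 * K"] eventually_ge_at_top[of 8]
      proof eventually_elim
        case (elim n)
        define r q where "r = p n" and "q = r * (1 - r) ^ (2 ^ 3 - 2)"
        have r: "e \<le> r" "r \<le> 1 - e" "e \<le> 1 - r" "0 < r" "r \<le> 1" using elim(1) e by (auto simp: r_def)
        have "e ^ 7 = e * e ^ (2 ^ 3 - 2)" by (simp add: eval_nat_numeral)
        also have "\<dots> \<le> q" unfolding q_def using r e by (intro mult_mono power_mono) auto
        finally have q: "e ^ 7 \<le> q" .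
        have q0: "0 \<le> q" using q e7(1) by linarith
        have H: "2 * 3 \<le> n \<and> real 3 \<le> \<eta>\<^sup>2 * real n / 4 \<and> 2 \<le> 3 / 4 * r ^ 4 * real (n choose 3) \<and>
           measure_pmf.prob (random_bits n r) {\<xi>. \<not> (many_translates n 3 r \<xi> \<and>
             few_exceptional_translates n 3 \<eta> (r ^ 4 / 20) \<xi> \<and> many_squares n 3 q (\<eta>\<^sup>2 * real n / 2) \<xi>)}
           \<le> 3 * exp (- real n)"
          by (rule elim(2)[rule_format]) (use r q elim(3,4) in \<open>auto simp: q_def\<close>)
        let ?E1 = "{\<xi>. \<not> (many_translates n 3 r \<xi> \<and>
             few_exceptional_translates n 3 \<eta> (r ^ 4 / 20) \<xi> \<and> many_squares n 3 q (\<eta>\<^sup>2 * real n / 2) \<xi>)}"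
        let ?E2 = "{\<xi>. \<exists>k\<in>cube n \<times> slice n K. (\<lambda>(x, Y). real (card {(j, i) \<in> Y \<times> ({..<n} - Y). \<not> \<xi> (x \<oplus> {j, i})})
            \<le> e * real K * real n / 4) k}"
        let ?B = "{\<xi>. \<not> c0 * real n \<le> edge_expansion (graph_union (cube_graph n 1 (point n ` {x \<in> cube n. \<xi> x}))
             (cube_graph n 3 (point n ` {x \<in> cube n. \<xi> x})))}"
        have "?B \<subseteq> ?E1 \<union> ?E2"
        proof
          fix \<xi> assume B: "\<xi> \<in> ?B"
          show "\<xi> \<in> ?E1 \<union> ?E2"
          proof (rule ccontr)
            assume E: "\<xi> \<notin> ?E1 \<union> ?E2"
            hence ev': "many_translates n 3 r \<xi>" "few_exceptional_translates n 3 \<eta> (r ^ 4 / 20) \<xi>"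
                "many_squares n 3 q (\<eta>\<^sup>2 * real n / 2) \<xi>" by auto
            have cl: "e * real K * real n / 4 < real (card {(j, i) \<in> Y \<times> ({..<n} - Y). \<not> \<xi> (x \<oplus> {j, i})})"
                if "x \<in> cube n" "Y \<subseteq> {..<n}" "card Y = K" for x Y
              using E that by (auto simp: slice_def not_le)
            have "c0 * real n \<le> edge_expansion (graph_union (cube_graph n 1 (point n ` {x \<in> cube n. \<xi> x}))
               (cube_graph n 3 (point n ` {x \<in> cube n. \<xi> x})))"
            proof (rule edge_expansion_union_ge[OF refl _ ev' r(4,5) q0 \<eta>(1) \<eta>4 elim(5,6)])
              show "card {j. j < n \<and> real (card {i. i < n \<and> \<not> \<xi> (x \<oplus> {j} \<oplus> {i})}) < \<eta> * real n} < K"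
                if "x \<in> cube n" for x
                by (rule dead_neighbours_few[OF cl[OF that] \<eta>e])
              have "(e ^ 7) ^ 3 * e ^ 16 * (\<eta>\<^sup>2 / 4) ^ 3 / 92160 \<le> q ^ 3 * r ^ 16 * (\<eta>\<^sup>2 / 4) ^ 3 / 92160"
                using q q0 r e by (intro divide_right_mono mult_right_mono mult_mono power_mono) auto
              thus "c0 \<le> q ^ 3 * r ^ 16 * (\<eta>\<^sup>2 / 4) ^ 3 / 92160" by (simp add: c0_def)
            qed (use H in \<open>auto simp: c0_def\<close>)
            thus False using B by simp
          qed
        qed
        hence "measure_pmf.prob (random_bits n r) ?B \<le> measure_pmf.prob (random_bits n r) (?E1 \<union> ?E2)"
          by (intro measure_pmf.finite_measure_mono) auto
        also have "\<dots> \<le> measure_pmf.prob (random_bits n r) ?E1 + measure_pmf.prob (random_bits n r) ?E2"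
          by (intro measure_Un_le) auto
        also have "\<dots> \<le> 3 * exp (- real n) + exp (- real n)"
          using H r elim(5) by (intro add_mono prob_exists_clustered_dead[OF _ _ e(1) K]) auto
        finally show ?case by (simp only: r_def)
      qed
    qed
    thus ?thesis using c0 by blast
  qed

  have b: "\<exists>c\<^sub>0::real. c\<^sub>0 > 0 \<and> (\<forall>(p :: nat \<Rightarrow> real) (d :: nat \<Rightarrow> nat) (q :: nat \<Rightarrow> real).
     (\<forall>n. q n = p n * (1 - p n) ^ (2 ^ d n - 2)) \<longrightarrow>
     (\<forall>\<^sub>F n in sequentially. 0 < p n \<and> p n < 1 / 2 - \<epsilon> \<and> 3 \<le> d n \<and> odd (d n) \<and>
        q n \<ge> real n powr (- 0.1) \<and> real (d n) \<le> c\<^sub>0 * ln (real n)) \<longrightarrow>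
     with_high_probability (\<lambda>n. random_subset n (p n))
       (\<lambda>n V. edge_expansion (cube_graph n (d n) V) \<ge> c\<^sub>0 ^ d n * q n ^ 22 * real (n choose d n) / real n))"
  proof -
    \<comment> \<open>The same constant limits \<open>d\<close> in terms of \<open>ln n\<close> and
      is the base of \<open>c0 ^ d\<close>; lowering it strengthens the hypothesis and weakens the
      conclusion, so both requirements can be met by a minimum.\<close>
    define c0 where "c0 = min c (\<eta>\<^sup>2 / 15360)"
    have c0: "0 < c0" "c0 \<le> c" "c0 \<le> \<eta>\<^sup>2 / 15360" using c \<eta> by (auto simp: c0_def)
    have "with_high_probability (\<lambda>n. random_subset n (p n))
       (\<lambda>n V. edge_expansion (cube_graph n (d n) V) \<ge> c0 ^ d n * q n ^ 22 * real (n choose d n) / real n)"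
      if q: "\<forall>n. q n = p n * (1 - p n) ^ (2 ^ d n - 2)"
        and hyp: "\<forall>\<^sub>F n in sequentially. 0 < p n \<and> p n < 1 / 2 - \<epsilon> \<and> 3 \<le> d n \<and> odd (d n) \<and>
          q n \<ge> real n powr (- 0.1) \<and> real (d n) \<le> c0 * ln (real n)" for p d q
    proof (rule with_high_probability_random_subsetI)
      have "0 \<le> 1 - e / 2" "1 - e / 2 < 1" using e by auto
      hence "(\<lambda>n. (1 - e / 2) ^ n) \<longlonglongrightarrow> 0" by (intro LIMSEQ_realpow_zero)
      moreover have "(\<lambda>n. 3 * exp (- real n)) \<longlonglongrightarrow> 0" by real_asymp
      ultimately show "(\<lambda>n. 3 * exp (- real n) + (1 - e / 2) ^ n) \<longlonglongrightarrow> 0"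
        using tendsto_add by fastforce
      show "\<forall>\<^sub>F n in sequentially. measure_pmf.prob (random_bits n (p n))
          {\<xi>. \<not> c0 ^ d n * q n ^ 22 * real (n choose d n) / real n \<le>
             edge_expansion (cube_graph n (d n) (point n ` {x \<in> cube n. \<xi> x}))}
          \<le> 3 * exp (- real n) + (1 - e / 2) ^ n"
        using hyp ev eventually_gt_at_top[of 0]
      proof eventually_elim
        case (elim n)
        define r s D where "r = p n" and "s = q n" and "D = d n"
        have r: "0 < r" "r < 1 / 2 - \<epsilon>" "r < 1 / 2 - e" "r \<le> 1 - e" "r \<le> 1" and D: "3 \<le> D" "odd D"
          and s: "real n powr (- 0.1) \<le> s" and Dc: "real D \<le> c0 * ln (real n)"
          using elim(1) e by (auto simp: r_def s_def D_def)
        have s_eq: "s = r * (1 - r) ^ (2 ^ D - 2)" using q by (simp add: s_def r_def D_def)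
        have s0: "0 \<le> s" unfolding s_eq using r by simp
        have sr: "s \<le> r" unfolding s_eq using r by (simp add: mult_left_le power_le_one)
        have "c0 * ln (real n) \<le> c * ln (real n)" using c0 elim(3) by (intro mult_right_mono) auto
        hence Dc': "real D \<le> c * ln (real n)" using Dc by linarith
        have H: "2 * D \<le> n \<and> real D \<le> \<eta>\<^sup>2 * real n / 4 \<and> 2 \<le> 3 / 4 * r ^ 4 * real (n choose D) \<and>
           measure_pmf.prob (random_bits n r) {\<xi>. \<not> (many_translates n D r \<xi> \<and>
             few_exceptional_translates n D \<eta> (r ^ 4 / 20) \<xi> \<and> many_squares n D s (\<eta>\<^sup>2 * real n / 2) \<xi>)}
           \<le> 3 * exp (- real n)"
          by (rule elim(2)[rule_format]) (use r D s s_eq Dc' in auto)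
        let ?E1 = "{\<xi>. \<not> (many_translates n D r \<xi> \<and>
             few_exceptional_translates n D \<eta> (r ^ 4 / 20) \<xi> \<and> many_squares n D s (\<eta>\<^sup>2 * real n / 2) \<xi>)}"
        let ?E2 = "{\<xi>. \<exists>x\<in>cube n. real (card {i. i < n \<and> \<not> \<xi> (x \<oplus> {i})}) < \<eta> * real n}"
        let ?B = "{\<xi>. \<not> c0 ^ D * s ^ 22 * real (n choose D) / real n \<le>
             edge_expansion (cube_graph n D (point n ` {x \<in> cube n. \<xi> x}))}"
        have "?B \<subseteq> ?E1 \<union> ?E2"
        proof
          fix \<xi> assume B: "\<xi> \<in> ?B"
          show "\<xi> \<in> ?E1 \<union> ?E2"
          proof (rule ccontr)
            assume E: "\<xi> \<notin> ?E1 \<union> ?E2"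
            hence ev': "many_translates n D r \<xi>" "few_exceptional_translates n D \<eta> (r ^ 4 / 20) \<xi>"
                "many_squares n D s (\<eta>\<^sup>2 * real n / 2) \<xi>" by auto
            have live: "\<eta> * real n \<le> real (card {i. i < n \<and> \<not> \<xi> (x \<oplus> {i})})" if "x \<in> cube n" for x
              using E that by (auto simp: not_less)
            have "c0 ^ D * s ^ 22 * real (n choose D) / real n \<le>
                edge_expansion (cube_graph n D (point n ` {x \<in> cube n. \<xi> x}))"
              by (rule edge_expansion_cube_graph_ge[OF refl live ev' r(1,5) s0 sr \<eta>(1)])
                 (use H D \<eta>4 c0 in auto)
            thus False using B by simp
          qed
        qed
        hence "measure_pmf.prob (random_bits n r) ?B \<le> measure_pmf.prob (random_bits n r) (?E1 \<union> ?E2)"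
          by (intro measure_pmf.finite_measure_mono) auto
        also have "\<dots> \<le> measure_pmf.prob (random_bits n r) ?E1 + measure_pmf.prob (random_bits n r) ?E2"
          by (intro measure_Un_le) auto
        also have "\<dots> \<le> 3 * exp (- real n) + (1 - e / 2) ^ n"
          using H r by (intro add_mono prob_exists_few_nonneighbours[OF _ r(3) e(1,2) \<eta>ln]) auto
        finally show ?case by (simp only: r_def s_def D_def)
      qed
    qed
    thus ?thesis using c0 by blast
  qed
  from a b show ?thesis by (rule conjI)
qed

end
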